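(* There exists a covering system of the integers such that all moduli are odd, greater than $1$, and pairwise distinct, except that $11$ is used exactly seven times as a modulus.
   Context: A covering system of the integers is a finite collection of congruences $x\equiv r_j \pmod{m_j}$ such that every integer satisfies at least one of them. "$11$ is used exactly seven times as a modulus" means exactly seven congruences of the system have modulus $11$, while all other moduli are distinct from each other and from $11$. *)

theory Defs
  imports "HOL-Number_Theory.Cong"
begin

text \<open>
  A pair \<open>(r, m)\<close> stands for the congruence \<open>x \<equiv> r (mod m)\<close>.  The residue is required to be
  the canonical one, \<open>0 \<le> r < m\<close>: this makes \<open>m\<close> positive and ensures that
  different pairs are different congruences (different residue classes), so that cardinalities
  of sets of pairs count congruences.
\<close>

definition covering_system :: "(int \<times> int) set \<Rightarrow> bool" where
  "covering_system C \<longleftrightarrow>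
     finite C \<and>
     (\<forall>(r, m) \<in> C. 0 \<le> r \<and> r < m) \<and>
     (\<forall>x::int. \<exists>(r, m) \<in> C. [x = r] (mod m))"

end

theory Submission imports Defs "HOL-Computational_Algebra.Primes" begin

text \<open>
  Relative to the primes used so far, keep a family of congruences with pairwise distinct moduli
  such that every uncovered integer lies in one congruence of each of \<open>g\<close> reserve groups.
  The reserve groups are never used directly: multiplied by a new modulus \<open>e\<close> coprime to everything
  before, each of them turns into a congruence class mod \<open>e\<close>, so that \<open>g\<close> different residues mod
  \<open>e\<close> can be removed at once. Residues \<open>0, \<dots>, 6\<close> mod 11 are the seven repeated congruences, so the
  other moduli only have to deal with \<open>7, 8, 9, 10\<close>.

  Powers of 3 yield two groups: \<open>3 ^ k\<close> removes one residue class at every level and reserves another,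
  and what remains is divisible by \<open>3 ^ 83\<close> and is cleaned up by the extra prime 83, whose 83 classes
  are spread over the moduli \<open>3 ^ i * 83\<close> with \<open>i < 83\<close>. The same device, with extra primes 89 and 97, is used for the powers of 5 and 7. Together with 11, 13 and 17
  this produces 15 groups on all but 225 residue classes, and each of those is treated by a
  patch: for a further prime \<open>p\<close> up to 79 every class mod \<open>p\<close> is removed separately by congruences with
  modulus exactly divisible by \<open>p\<close>. The primes 19, 23, 29 then raise the number of groups to 37,
  and with 37 groups the modulus 37 covers everything that is left.
\<close>

text \<open>Reserve groups may repeat moduli that are already in use, because they enter the system
  only after multiplication by a new factor. So one modulus can serve twice, once to remove a class
  and once to reserve another. With g groups, a prime p = 2g + 1 has 2g nonzero digits at each
  level: g of them are removed and the other g make up one new group. This is where 3, 5 and 7 come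
  from, with g = 1, 2, 3. For 5 and 7 this scheme is fixed for the higher powers only. How moduli
  with a single factor 5 or 7 are spent is decided by the search data, and a surviving multiple of 5
  or of 7 behaves as if it met one more reserve group. Patches are possible because 5 * 7 * 11^2 *
  13 * 17 has 48 divisors: on two groups, a single residue class modulo this number can use 96
  different moduli, enough to treat every class modulo a prime up to 79. Smaller primes treat
  several residue classes together. The primes 83, 89 and 97 only have to differ from all others;
  the patches take the primes from 31 to 79 except 37, which is kept for the last step.\<close>

section \<open>Kits: removed congruences and reserve groups\<close>

definition smooth :: "nat set \<Rightarrow> nat \<Rightarrow> bool" where
  "smooth P m \<longleftrightarrow> 0 < m \<and> (\<forall>p. prime p \<longrightarrow> p dvd m \<longrightarrow> p \<in> P)"

text \<open>Pairs in the construction list the modulus first, in contrast to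
  \<open>covering_system\<close>. The choice of the residue is meaningful because
  \<open>lift\<close> combines only coprime moduli when the prime sets are disjoint.\<close>

definition crt :: "nat \<times> int \<Rightarrow> nat \<times> int \<Rightarrow> nat \<times> int" where
  "crt = (\<lambda>(d, r) (e, s). (d * e, SOME z. [z = r] (mod int d) \<and> [z = s] (mod int e)))"

definition hit :: "int \<Rightarrow> nat \<times> int \<Rightarrow> bool" where
  "hit x = (\<lambda>(m, r). [x = r] (mod int m))"

text \<open>The moduli of \<open>B\<close> are kept distinct, and so are those of all groups
  together, but a modulus may occur both in \<open>B\<close> and in a group. Modulus 1 can lie in
  one group only; fixing that group as 0 turns the ban on the modulus 11 in later products into a
  condition on the group index.\<close>

definition kit :: "nat set \<Rightarrow> nat \<Rightarrow> (nat \<times> int) set \<Rightarrow> (nat \<Rightarrow> (nat \<times> int) set) \<Rightarrow> bool" where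
  "kit P g B G \<longleftrightarrow>
     finite B \<and> (\<forall>t<g. finite (G t)) \<and>
     (\<forall>(m, r) \<in> B. smooth P m \<and> 1 < m \<and> m \<noteq> 11) \<and>
     (\<forall>t<g. \<forall>(m, r) \<in> G t. smooth P m \<and> (m = 1 \<longrightarrow> t = 0)) \<and>
     (\<forall>m r r'. (m, r) \<in> B \<longrightarrow> (m, r') \<in> B \<longrightarrow> r = r') \<and>
     (\<forall>s<g. \<forall>t<g. \<forall>m r r'. (m, r) \<in> G s \<longrightarrow> (m, r') \<in> G t \<longrightarrow> s = t \<and> r = r') \<and>
     (\<forall>x. x mod 11 < 7 \<or> (\<exists>c\<in>B. hit x c) \<or> (\<forall>t<g. \<exists>c\<in>G t. hit x c))"

lemma kitD:
  assumes "kit P g B G"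
  shows "finite B" "\<And>t. t < g \<Longrightarrow> finite (G t)"
    "\<And>m r. (m, r) \<in> B \<Longrightarrow> smooth P m \<and> 1 < m \<and> m \<noteq> 11"
    "\<And>t m r. t < g \<Longrightarrow> (m, r) \<in> G t \<Longrightarrow> smooth P m \<and> (m = 1 \<longrightarrow> t = 0)"
    "\<And>m r r'. (m, r) \<in> B \<Longrightarrow> (m, r') \<in> B \<Longrightarrow> r = r'"
    "\<And>s t m r r'. s < g \<Longrightarrow> t < g \<Longrightarrow> (m, r) \<in> G s \<Longrightarrow> (m, r') \<in> G t \<Longrightarrow> s = t \<and> r = r'"
    "\<And>x. x mod 11 < 7 \<or> (\<exists>c\<in>B. hit x c) \<or> (\<forall>t<g. \<exists>c\<in>G t. hit x c)"
  using assms unfolding kit_def by blast+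

text \<open>A triple \<open>(e, s, t)\<close> asks for the class of \<open>s\<close> modulo
  \<open>e\<close> at the expense of group \<open>t\<close>: an integer of this class that meets
  group \<open>t\<close> is hit by one of the products.\<close>

definition lift :: "(nat \<Rightarrow> (nat \<times> int) set) \<Rightarrow> (nat \<times> int \<times> nat) set \<Rightarrow> (nat \<times> int) set" where
  "lift G X = (\<Union>(e, s, t)\<in>X. (\<lambda>c. crt c (e, s)) ` G t)"

lemma smooth_mono: "smooth P m \<Longrightarrow> P \<subseteq> Q \<Longrightarrow> smooth Q m"
  unfolding smooth_def by blast

lemma smooth_mult: "smooth P d \<Longrightarrow> smooth Q e \<Longrightarrow> smooth (P \<union> Q) (d * e)"
  unfolding smooth_def by (auto simp: prime_dvd_mult_iff)

lemma smooth_one [simp]: "smooth P 1" "smooth P (Suc 0)"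
  unfolding smooth_def by auto

lemma smooth_power:
  assumes "prime p" "p \<in> P"
  shows "smooth P (p ^ k)"
  unfolding smooth_def
proof (intro conjI allI impI)
  show "0 < p ^ k" using assms(1) prime_gt_0_nat by simp
  fix q assume q: "prime q" "q dvd p ^ k"
  then have "q dvd p" using prime_dvd_power by blast
  then show "q \<in> P" using primes_dvd_imp_eq[OF q(1) assms(1)] assms(2) by simp
qed

lemma smooth_coprime:
  assumes "smooth P d" "smooth Q e" "P \<inter> Q = {}"
  shows "coprime d e"
proof (rule ccontr)
  assume "\<not> coprime d e"
  then obtain p where "prime p" "p dvd gcd d e"
    by (metis coprime_iff_gcd_eq_1 prime_factor_nat)
  then show False using assms unfolding smooth_def by auto
qed

text \<open>Unique factorization: the part of a product made of primes in \<open>P\<close> and the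
  part made of primes in \<open>Q\<close> can be read off from it.\<close>

lemma smooth_mult_unique:
  assumes "smooth P d" "smooth Q e" "smooth P d'" "smooth Q e'" "P \<inter> Q = {}" "d * e = d' * e'"
  shows "d = d'" "e = e'"
proof -
  have "coprime d e'" "coprime d' e"
    using assms smooth_coprime by blast+
  then have "d dvd d'" "d' dvd d"
    using assms(6) by (metis coprime_dvd_mult_left_iff dvd_triv_left)+
  then show "d = d'" by (simp add: dvd_antisym)
  then show "e = e'" using assms(1,6) unfolding smooth_def by auto
qed

lemma crt_hit:
  assumes "coprime d e" "hit x (d, r)" "hit x (e, s)"
  shows "hit x (crt (d, r) (e, s))"
proof -
  let ?z = "SOME z. [z = r] (mod int d) \<and> [z = s] (mod int e)"
  have "[?z = r] (mod int d) \<and> [?z = s] (mod int e)"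
    by (rule someI [of _ x]) (use assms in \<open>auto simp: hit_def\<close>)
  then have "[x = ?z] (mod int d)" "[x = ?z] (mod int e)"
    using assms by (auto simp: hit_def cong_def)
  then show ?thesis
    using assms(1) by (auto simp: hit_def crt_def coprime_cong_mult)
qed

lemma fst_crt [simp]: "fst (crt (d, r) (e, s)) = d * e"
  by (simp add: crt_def)

text \<open>A new modulus determines its factors \<open>d\<close> and \<open>e\<close>, and
  \<open>d\<close> determines the group \<open>t\<close>; so a clash can only come from two triples
  with the same \<open>e\<close> and \<open>t\<close>, which \<open>U1\<close> and \<open>W1\<close>
  rule out. In \<open>W\<close> the value \<open>e = 1\<close> is allowed and carries an old group
  over. The modulus 11 could only arise as 1 * 11, that is with \<open>e = 11\<close> on group
  0.\<close>

theorem kit_compose: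
  assumes kit: "kit P g B G" and PQ: "P \<inter> Q = {}"
    and finU: "finite U" and finW: "\<And>h. h < g' \<Longrightarrow> finite (W h)"
    and U: "\<And>e s t. (e, s, t) \<in> U \<Longrightarrow> t < g \<and> smooth Q e \<and> 1 < e \<and> (e = 11 \<longrightarrow> t \<noteq> 0)"
    and U1: "\<And>e s s' t. (e, s, t) \<in> U \<Longrightarrow> (e, s', t) \<in> U \<Longrightarrow> s = s'"
    and W: "\<And>h e s t. h < g' \<Longrightarrow> (e, s, t) \<in> W h \<Longrightarrow>
              t < g \<and> smooth Q e \<and> (e = 1 \<and> t = 0 \<longrightarrow> h = 0)"
    and W1: "\<And>h h' e s s' t. h < g' \<Longrightarrow> h' < g' \<Longrightarrow> (e, s, t) \<in> W h \<Longrightarrow> (e, s', t) \<in> W h' \<Longrightarrow>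
              h = h' \<and> s = s'"
    and cover: "\<And>y. y mod 11 < 7 \<or> (\<exists>(e, s, t)\<in>U. hit y (e, s)) \<or>
                  (\<forall>h<g'. \<exists>(e, s, t)\<in>W h. hit y (e, s))"
  shows "kit (P \<union> Q) g' (B \<union> lift G U) (\<lambda>h. lift G (W h))"
proof -
  note Bfin = kitD(1)[OF kit] and Gfin = kitD(2)[OF kit] and Bsm = kitD(3)[OF kit]
    and Gsm = kitD(4)[OF kit] and B1 = kitD(5)[OF kit] and G1 = kitD(6)[OF kit] and kcov = kitD(7)[OF kit]
  have liftE: "\<exists>e s t d r'. (e, s, t) \<in> X \<and> (d, r') \<in> G t \<and> (m, r) = crt (d, r') (e, s) \<and> m = d * e"
    if "(m, r) \<in> lift G X" for m r X
    using that unfolding lift_def crt_def by force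
  have lift1: "t = t' \<and> e = e' \<and> c = c'"
    if "t < g" "t' < g" "smooth Q e" "smooth Q e'" "c \<in> G t" "c' \<in> G t'" "fst c * e = fst c' * e'"
    for t t' e e' c c'
  proof -
    obtain d r d' r' where c: "c = (d, r)" "c' = (d', r')" by fastforce
    have "d = d'" "e = e'"
      using smooth_mult_unique[of P d Q e d' e'] Gsm that PQ unfolding c by auto
    then show ?thesis using G1 that unfolding c by blast
  qed
  have lift_hit: "\<exists>c\<in>lift G X. hit x c"
    if X: "\<And>e s t. (e, s, t) \<in> X \<Longrightarrow> t < g \<and> smooth Q e" and all: "\<forall>t<g. \<exists>c\<in>G t. hit x c"
      and ex: "\<exists>(e, s, t)\<in>X. hit x (e, s)" for X x
  proof -
    obtain e s t where est: "(e, s, t) \<in> X" "hit x (e, s)" using ex by blast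
    then obtain d r where dr: "(d, r) \<in> G t" "hit x (d, r)" using all X by (metis surj_pair)
    have "hit x (crt (d, r) (e, s))"
      using crt_hit smooth_coprime est dr X Gsm PQ by blast
    then show ?thesis using est dr unfolding lift_def by blast
  qed
  show ?thesis unfolding kit_def
  proof (intro conjI)
    show "finite (B \<union> lift G U)" "\<forall>t<g'. finite (lift G (W t))"
      using Bfin finU finW U W Gfin unfolding lift_def by fastforce+
    show "\<forall>(m, r)\<in>B \<union> lift G U. smooth (P \<union> Q) m \<and> 1 < m \<and> m \<noteq> 11"
    proof (clarify)
      fix m r assume "(m, r) \<in> B \<union> lift G U"
      then consider "(m, r) \<in> B" | "(m, r) \<in> lift G U" by blast
      then show "smooth (P \<union> Q) m \<and> 1 < m \<and> m \<noteq> 11"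
      proof cases
        case 1 then show ?thesis using Bsm smooth_mono by blast
      next
        case 2
        then obtain e s t d r' where est: "(e, s, t) \<in> U" "(d, r') \<in> G t" "m = d * e"
          using liftE by blast
        then have *: "t < g" "smooth Q e" "1 < e" "e = 11 \<longrightarrow> t \<noteq> 0" "smooth P d" "d = 1 \<longrightarrow> t = 0"
          using U Gsm by blast+
        have d: "0 < d" using *(5) unfolding smooth_def by simp
        have "m \<noteq> 11"
        proof
          assume m: "m = 11"
          have "prime (11::nat)" by simp
          then have "d = 1 \<or> e = 1" using m est(3) by (metis prime_product)
          then show False using * m est(3) by auto
        qed
        moreover have "e \<le> m" using d est(3) by simp
        then have "1 < m" using *(3) by linarith
        moreover have "smooth (P \<union> Q) m" using smooth_mult[OF *(5) *(2)] est(3) by simp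
        ultimately show ?thesis by blast
      qed
    qed
    show "\<forall>t<g'. \<forall>(m, r)\<in>lift G (W t). smooth (P \<union> Q) m \<and> (m = 1 \<longrightarrow> t = 0)"
    proof (clarify)
      fix h m r assume h: "h < g'" "(m, r) \<in> lift G (W h)"
      then obtain e s t d r' where est: "(e, s, t) \<in> W h" "(d, r') \<in> G t" "m = d * e"
        using liftE by blast
      then have *: "t < g" "smooth Q e" "e = 1 \<and> t = 0 \<longrightarrow> h = 0" "smooth P d" "d = 1 \<longrightarrow> t = 0"
        using W h Gsm by blast+
      show "smooth (P \<union> Q) m \<and> (m = 1 \<longrightarrow> h = 0)"
        using smooth_mult * est(3) by auto
    qed
    show "\<forall>m r r'. (m, r) \<in> B \<union> lift G U \<longrightarrow> (m, r') \<in> B \<union> lift G U \<longrightarrow> r = r'"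
    proof (clarify)
      fix m r r' assume 1: "(m, r) \<in> B \<union> lift G U" and 2: "(m, r') \<in> B \<union> lift G U"
      \<comment> \<open>Since \<open>e > 1\<close>, a lifted modulus has a prime factor in
        \<open>Q\<close>, whereas all prime factors of an old one are in \<open>P\<close>.\<close>
      have no: False if "(m, a) \<in> B" "(m, b) \<in> lift G U" for a b
      proof -
        obtain e s t d r' where est: "(e, s, t) \<in> U" "(d, r') \<in> G t" "m = d * e"
          using liftE \<open>(m, b) \<in> lift G U\<close> by blast
        then have "smooth Q e" "1 < e" "smooth P m" using U Bsm that by blast+
        then obtain p where "prime p" "p dvd e" by (metis less_irrefl prime_factor_nat)
        then have "p \<in> Q" "p \<in> P"
          using est(3) \<open>smooth Q e\<close> \<open>smooth P m\<close> unfolding smooth_def by (blast, metis dvd_mult)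
        then show False using PQ by blast
      qed
      consider "(m, r) \<in> B" "(m, r') \<in> B" | "(m, r) \<in> lift G U" "(m, r') \<in> lift G U"
        using 1 2 no by blast
      then show "r = r'"
      proof cases
        case 1 then show ?thesis using B1 by blast
      next
        case 2
        obtain e s t c where a: "(e, s, t) \<in> U" "c \<in> G t" "(m, r) = crt c (e, s)"
          using 2(1) unfolding lift_def by auto
        obtain e' s' t' c' where b: "(e', s', t') \<in> U" "c' \<in> G t'" "(m, r') = crt c' (e', s')"
          using 2(2) unfolding lift_def by auto
        have "fst c * e = fst c' * e'"
          using a(3) b(3) by (metis fst_conv fst_crt surj_pair)
        then have "t = t' \<and> e = e' \<and> c = c'" using lift1 U a b by blast
        moreover from this have "s = s'" using U1 a b by blast
        ultimately show ?thesis using a(3) b(3) by (metis snd_conv)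
      qed
    qed
    show "\<forall>h<g'. \<forall>h'<g'. \<forall>m r r'. (m, r) \<in> lift G (W h) \<longrightarrow> (m, r') \<in> lift G (W h') \<longrightarrow>
            h = h' \<and> r = r'"
    proof (intro allI impI)
      fix h h' m r r' assume h: "h < g'" "h' < g'"
        and 2: "(m, r) \<in> lift G (W h)" "(m, r') \<in> lift G (W h')"
      obtain e s t c where a: "(e, s, t) \<in> W h" "c \<in> G t" "(m, r) = crt c (e, s)"
        using 2(1) unfolding lift_def by auto
      obtain e' s' t' c' where b: "(e', s', t') \<in> W h'" "c' \<in> G t'" "(m, r') = crt c' (e', s')"
        using 2(2) unfolding lift_def by auto
      have "fst c * e = fst c' * e'"
        using a(3) b(3) by (metis fst_conv fst_crt surj_pair)
      then have "t = t' \<and> e = e' \<and> c = c'" using lift1 W h a b by blast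
      moreover from this have "h = h' \<and> s = s'" using W1 h a b by blast
      ultimately show "h = h' \<and> r = r'" using a(3) b(3) by (metis snd_conv)
    qed
    show "\<forall>x. x mod 11 < 7 \<or> (\<exists>c\<in>B \<union> lift G U. hit x c) \<or> (\<forall>h<g'. \<exists>c\<in>lift G (W h). hit x c)"
    proof
      fix x
      consider "x mod 11 < 7" | "\<exists>c\<in>B. hit x c"
        | "\<forall>t<g. \<exists>c\<in>G t. hit x c" "\<exists>(e, s, t)\<in>U. hit x (e, s)"
        | "\<forall>t<g. \<exists>c\<in>G t. hit x c" "\<forall>h<g'. \<exists>(e, s, t)\<in>W h. hit x (e, s)"
        using kcov[of x] cover[of x] by blast
      then show "x mod 11 < 7 \<or> (\<exists>c\<in>B \<union> lift G U. hit x c) \<or> (\<forall>h<g'. \<exists>c\<in>lift G (W h). hit x c)"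
      proof cases
        case 3
        then show ?thesis using lift_hit[of U x] U by blast
      next
        case 4
        have "\<exists>c\<in>lift G (W h). hit x c" if "h < g'" for h
          using lift_hit[of "W h" x] W that 4 by blast
        then show ?thesis by blast
      qed blast+
    qed
  qed
qed

text \<open>The starting point: nothing is removed, and the trivial congruence is the only
  reserve.\<close>

lemma kit_one: "kit {} 1 {} (\<lambda>_. {(1, 0)})"
  unfolding kit_def by (auto simp: hit_def)

section \<open>Moduli as exponent vectors\<close>

definition pprod :: "nat list \<Rightarrow> nat list \<Rightarrow> nat" where
  "pprod ps v = prod_list (map2 (^) ps v)"

text \<open>This says that \<open>Y\<close> lies within one residue class modulo
  \<open>pprod ps v\<close>, prime power by prime power. It need not fill the class and may be
  empty, so classes can be given by digit conditions instead of computed residues.\<close>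

definition cls :: "nat list \<Rightarrow> nat list \<Rightarrow> int set \<Rightarrow> bool" where
  "cls ps v Y \<longleftrightarrow> (\<forall>y\<in>Y. \<forall>z\<in>Y. list_all2 (\<lambda>p k. [y = z] (mod int (p ^ k))) ps v)"

lemma pprod_simps [simp]: "pprod [] [] = 1" "pprod (p # ps) (k # v) = p ^ k * pprod ps v"
  by (simp_all add: pprod_def)

lemma smooth_pprod:
  "list_all prime ps \<Longrightarrow> length v = length ps \<Longrightarrow> smooth (set ps) (pprod ps v)"
proof (induction ps arbitrary: v)
  case (Cons p ps)
  then obtain k w where v: "v = k # w" by (cases v) auto
  have "smooth {p} (p ^ k)" using Cons.prems smooth_power by auto
  then show ?case using Cons smooth_mult[of "{p}" "p ^ k" "set ps" "pprod ps w"] v by simp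
qed simp

lemma pprod_inj:
  "list_all prime ps \<Longrightarrow> distinct ps \<Longrightarrow> length v = length ps \<Longrightarrow> length w = length ps \<Longrightarrow>
   pprod ps v = pprod ps w \<Longrightarrow> v = w"
proof (induction ps arbitrary: v w)
  case (Cons p ps)
  obtain k v' l w' where vw: "v = k # v'" "w = l # w'"
    using Cons.prems by (cases v; cases w) auto
  have p: "prime p" "p \<notin> set ps" using Cons.prems by auto
  have "smooth {p} (p ^ k)" "smooth {p} (p ^ l)" using p smooth_power by auto
  moreover have "smooth (set ps) (pprod ps v')" "smooth (set ps) (pprod ps w')"
    using Cons.prems vw by (auto intro!: smooth_pprod)
  ultimately have "p ^ k = p ^ l" "pprod ps v' = pprod ps w'"
    using smooth_mult_unique[of "{p}" "p ^ k" "set ps" "pprod ps v'" "p ^ l" "pprod ps w'"]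
      p Cons.prems(5) unfolding vw by auto
  moreover have "1 < p" using p prime_gt_1_nat by blast
  ultimately have "k = l" "v' = w'"
    using Cons vw by (auto simp: power_inject_exp)
  then show ?case using vw by simp
qed simp

lemma pprod_zero: "\<forall>k\<in>set v. k = 0 \<Longrightarrow> length v = length ps \<Longrightarrow> pprod ps v = 1"
proof (induction ps arbitrary: v)
  case (Cons p ps) then show ?case by (cases v) auto
qed simp

lemma cls_cong:
  assumes "cls ps v Y" "y \<in> Y" "z \<in> Y" "list_all prime ps" "distinct ps"
  shows "[y = z] (mod int (pprod ps v))"
proof -
  have "list_all2 (\<lambda>p k. [y = z] (mod int (p ^ k))) ps v"
    using assms unfolding cls_def by blast
  then show ?thesis using assms(4,5)
  proof (induction rule: list_all2_induct)
    case (Cons p ps k v)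
    have "smooth {p} (p ^ k)" "smooth (set ps) (pprod ps v)"
      using Cons.prems Cons.hyps smooth_power smooth_pprod by (auto dest: list_all2_lengthD)
    moreover have "{p} \<inter> set ps = {}" using Cons.prems by auto
    ultimately have "coprime (p ^ k) (pprod ps v)" by (rule smooth_coprime)
    then have "coprime (int (p ^ k)) (int (pprod ps v))" by (metis coprime_int_iff)
    then show ?case using Cons coprime_cong_mult[of y z] by simp
  qed simp
qed

text \<open>\<open>kit_compose\<close> in terms of exponent vectors: by \<open>pprod_inj\<close>,
  equality of moduli becomes equality of vectors, and any element of \<open>Y\<close> can represent
  its class.\<close>

theorem kit_units:
  assumes kit: "kit P g B G" and ps: "list_all prime ps" "distinct ps" "P \<inter> set ps = {}"
    and finU: "finite U" and finW: "\<And>h. h < g' \<Longrightarrow> finite (W h)"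
    and U: "\<And>v Y t. (v, Y, t) \<in> U \<Longrightarrow> t < g \<and> length v = length ps \<and> cls ps v Y \<and>
              \<not> (\<forall>k\<in>set v. k = 0) \<and> (t = 0 \<longrightarrow> pprod ps v \<noteq> 11)"
    and U1: "\<And>v Y Y' t. (v, Y, t) \<in> U \<Longrightarrow> (v, Y', t) \<in> U \<Longrightarrow> Y = Y'"
    and W: "\<And>h v Y t. h < g' \<Longrightarrow> (v, Y, t) \<in> W h \<Longrightarrow>
              t < g \<and> length v = length ps \<and> cls ps v Y \<and> ((\<forall>k\<in>set v. k = 0) \<and> t = 0 \<longrightarrow> h = 0)"
    and W1: "\<And>h h' v Y Y' t. h < g' \<Longrightarrow> h' < g' \<Longrightarrow> (v, Y, t) \<in> W h \<Longrightarrow> (v, Y', t) \<in> W h' \<Longrightarrow>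
              h = h' \<and> Y = Y'"
    and cover: "\<And>y. y mod 11 < 7 \<or> (\<exists>(v, Y, t)\<in>U. y \<in> Y) \<or> (\<forall>h<g'. \<exists>(v, Y, t)\<in>W h. y \<in> Y)"
  shows "\<exists>B' G'. kit (P \<union> set ps) g' B' G'"
proof -
  \<comment> \<open>An empty \<open>Y\<close> receives an arbitrary residue; this is harmless
    because hits are claimed only for elements of \<open>Y\<close>.\<close>
  define f where "f = (\<lambda>(v, Y, t :: nat). (pprod ps v, SOME y :: int. y \<in> Y, t))"
  have f: "f (v, Y, t) = (pprod ps v, SOME y. y \<in> Y, t)" for v Y t by (simp add: f_def)
  have fE: "\<exists>v Y. (v, Y, t) \<in> X \<and> e = pprod ps v \<and> s = (SOME y. y \<in> Y)" if "(e, s, t) \<in> f ` X" for e s t X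
    using that by (force simp: f_def)
  have hitf: "hit y (pprod ps v, SOME y. y \<in> Y)" if "cls ps v Y" "y \<in> Y" for y v Y
  proof -
    have "(SOME y. y \<in> Y) \<in> Y" using that(2) by (rule someI)
    then show ?thesis using cls_cong that ps unfolding hit_def by auto
  qed
  have one: "(\<forall>k\<in>set v. k = 0) \<longleftrightarrow> pprod ps v = 1" if "length v = length ps" for v
  proof
    assume "pprod ps v = 1"
    moreover have "pprod ps (map (\<lambda>_. 0) ps) = 1" by (rule pprod_zero) auto
    ultimately have "v = map (\<lambda>_. 0) ps" using pprod_inj ps that by (metis length_map)
    then show "\<forall>k\<in>set v. k = 0" by auto
  qed (use pprod_zero that in blast)
  have sm: "smooth (set ps) (pprod ps v)" if "length v = length ps" for v
    using smooth_pprod ps that by blast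
  have "kit (P \<union> set ps) g' (B \<union> lift G (f ` U)) (\<lambda>h. lift G (f ` W h))"
  proof (rule kit_compose [OF kit ps(3)])
    show "finite (f ` U)" "\<And>h. h < g' \<Longrightarrow> finite (f ` W h)" using finU finW by auto
    show "t < g \<and> smooth (set ps) e \<and> 1 < e \<and> (e = 11 \<longrightarrow> t \<noteq> 0)" if e: "(e, s, t) \<in> f ` U" for e s t
    proof -
      obtain v Y where v: "(v, Y, t) \<in> U" "e = pprod ps v" using fE[OF e] by blast
      note Uv = U[OF v(1)]
      have "e \<noteq> 1" unfolding v(2) using Uv one[of v] by metis
      moreover have "smooth (set ps) e" using Uv sm[of v] v(2) by blast
      moreover from this have "0 < e" unfolding smooth_def by simp
      ultimately show ?thesis using Uv v(2) by auto
    qed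
    show "s = s'" if e: "(e, s, t) \<in> f ` U" "(e, s', t) \<in> f ` U" for e s s' t
    proof -
      obtain v Y where v1: "(v, Y, t) \<in> U" "e = pprod ps v" "s = (SOME y. y \<in> Y)"
        using fE[OF e(1)] by blast
      obtain v' Y' where v2: "(v', Y', t) \<in> U" "e = pprod ps v'" "s' = (SOME y. y \<in> Y')"
        using fE[OF e(2)] by blast
      note v = v1 v2
      have "v = v'" using pprod_inj[OF ps(1,2), of v v'] U[OF v(1)] U[OF v(4)] v(2,5) by simp
      then have "Y = Y'" using U1 v(1,4) by blast
      then show ?thesis using v by simp
    qed
    show "t < g \<and> smooth (set ps) e \<and> (e = 1 \<and> t = 0 \<longrightarrow> h = 0)"
      if h: "h < g'" and e: "(e, s, t) \<in> f ` W h" for h e s t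
    proof -
      obtain v Y where v: "(v, Y, t) \<in> W h" "e = pprod ps v" using fE[OF e] by blast
      then show ?thesis using W[OF h v(1)] one[of v] sm[of v] by auto
    qed
    show "h = h' \<and> s = s'"
      if h: "h < g'" "h' < g'" and e: "(e, s, t) \<in> f ` W h" "(e, s', t) \<in> f ` W h'" for h h' e s s' t
    proof -
      obtain v Y where v1: "(v, Y, t) \<in> W h" "e = pprod ps v" "s = (SOME y. y \<in> Y)"
        using fE[OF e(1)] by blast
      obtain v' Y' where v2: "(v', Y', t) \<in> W h'" "e = pprod ps v'" "s' = (SOME y. y \<in> Y')"
        using fE[OF e(2)] by blast
      note v = v1 v2
      have "v = v'"
        using pprod_inj[OF ps(1,2), of v v'] W[OF h(1) v(1)] W[OF h(2) v(4)] v(2,5) by simp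
      then have "h = h' \<and> Y = Y'" using W1[OF h] v(1,4) by blast
      then show ?thesis using v by simp
    qed
    fix y :: int
    have *: "\<exists>(e, s, t)\<in>f ` X. hit y (e, s)"
      if X: "\<exists>(v, Y, t)\<in>X. y \<in> Y" "\<And>v Y t. (v, Y, t) \<in> X \<Longrightarrow> cls ps v Y" for X
    proof -
      obtain v Y t where v: "(v, Y, t) \<in> X" "y \<in> Y" using X(1) by blast
      then have "hit y (pprod ps v, SOME y. y \<in> Y)" using hitf X(2) by blast
      moreover have "(pprod ps v, SOME y. y \<in> Y, t) \<in> f ` X"
        using v(1) f[of v Y t] by (metis imageI)
      ultimately show ?thesis by blast
    qed
    consider "y mod 11 < 7" | "\<exists>(v, Y, t)\<in>U. y \<in> Y" | "\<forall>h<g'. \<exists>(v, Y, t)\<in>W h. y \<in> Y"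
      using cover[of y] by blast
    then show "y mod 11 < 7 \<or> (\<exists>(e, s, t)\<in>f ` U. hit y (e, s)) \<or> (\<forall>h<g'. \<exists>(e, s, t)\<in>f ` W h. hit y (e, s))"
    proof cases
      case 2
      then show ?thesis using *[of U] U by simp
    next
      case 3
      have "\<exists>(e, s, t)\<in>f ` W h. hit y (e, s)" if "h < g'" for h
        using *[of "W h"] 3 W[OF that] that by simp
      then show ?thesis by blast
    qed blast
  qed
  then show ?thesis by blast
qed

section \<open>Digit levels and the passage from g to g + 1 groups\<close>

text \<open>The integers whose \<open>p\<close>-adic expansion begins with \<open>k\<close> zeros
  followed by the digit \<open>d\<close>.\<close>

definition lev :: "nat \<Rightarrow> nat \<Rightarrow> nat \<Rightarrow> int set" where
  "lev p k d = {y. [y = int (d * p ^ k)] (mod int (p ^ Suc k))}"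

text \<open>A multiple of \<open>p ^ q\<close> is divisible by every \<open>p ^ i\<close> with
  \<open>i < q\<close>. Hence its residue \<open>i\<close> modulo \<open>q\<close> can be handled
  with the modulus \<open>p ^ i * q\<close>, a different modulus for each residue.\<close>

definition spare :: "nat \<Rightarrow> nat \<Rightarrow> nat \<Rightarrow> int set" where
  "spare p q i = {y. int (p ^ i) dvd y \<and> y mod int q = int i}"

lemma levD: "y \<in> lev p k d \<Longrightarrow> z \<in> lev p k d \<Longrightarrow> [y = z] (mod int (p ^ Suc k))"
  unfolding lev_def using cong_trans cong_sym by blast

lemma spareD:
  assumes "y \<in> spare p q i" "z \<in> spare p q i"
  shows "[y = z] (mod int (p ^ i))" "[y = z] (mod int q)"
  using assms unfolding spare_def by (auto simp: cong_def dvd_imp_mod_0)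

lemma spare_cases:
  assumes "0 < q" "int (p ^ q) dvd y"
  shows "\<exists>i<q. y \<in> spare p q i"
proof -
  define i where "i = nat (y mod int q)"
  have i: "i < q" "y mod int q = int i"
    unfolding i_def using assms(1) by (auto simp: nat_less_iff)
  have "int (p ^ i) dvd y"
    using assms(2) i(1) by (meson dvd_trans int_dvd_int_iff le_imp_power_dvd less_imp_le_nat)
  then show ?thesis using i unfolding spare_def by blast
qed

lemma lev_cases:
  assumes "1 < p" "\<not> int (p ^ b) dvd y"
  shows "\<exists>k<b. \<exists>d<p. d \<noteq> 0 \<and> y \<in> lev p k d"
proof -
  define k where "k = (LEAST k. \<not> int (p ^ Suc k) dvd y)"
  have b: "b \<noteq> 0" using assms(2) by (cases b) auto
  have ex: "\<not> int (p ^ Suc (b - 1)) dvd y" using assms b by simp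
  have k: "\<not> int (p ^ Suc k) dvd y" "k < b"
    unfolding k_def using LeastI[of "\<lambda>k. \<not> int (p ^ Suc k) dvd y", OF ex]
      Least_le[of "\<lambda>k. \<not> int (p ^ Suc k) dvd y", OF ex] b by auto
  have "int (p ^ k) dvd y"
  proof (cases k)
    case (Suc k')
    then show ?thesis using not_less_Least[of k' "\<lambda>k. \<not> int (p ^ Suc k) dvd y"] k_def by auto
  qed auto
  then obtain u where u: "y = int (p ^ k) * u" by blast
  define d where "d = nat (u mod int p)"
  have d: "int d = u mod int p" "d < p" unfolding d_def using assms(1) by (auto simp: nat_less_iff)
  have "d \<noteq> 0"
  proof
    assume "d = 0"
    then have "int p dvd u" using d by auto
    then show False using k(1) u by (simp add: mult.commute)
  qed
  have "[u = int d] (mod int p)" using d by (simp add: cong_def)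
  then have "[int (p ^ k) * u = int (p ^ k) * int d] (mod (int (p ^ k) * int p))"
    by (simp add: cong_def)
  then have "y \<in> lev p k d" unfolding lev_def u by (simp add: mult.commute)
  then show ?thesis using k(2) d(2) \<open>d \<noteq> 0\<close> by blast
qed

text \<open>At level \<open>k\<close> the digits 1 to \<open>g\<close> are removed with the modulus
  \<open>p ^ Suc k\<close> on the groups 0 to \<open>g - 1\<close>. The digits \<open>g + 1\<close>
  to \<open>2 * g\<close> are reserved with the very same moduli and groups. An integer that is not
  removed has a digit of the second kind at its first nonzero position, so it meets the new
  group.\<close>

theorem kit_Suc:
  assumes kit: "kit P g B G" and g: "p = 2 * g + 1" "0 < g"
    and pq: "prime p" "prime q" "p \<noteq> q" "p \<notin> P" "q \<notin> P" "p \<noteq> 11" "q \<noteq> 11"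
  shows "\<exists>B' G'. kit (P \<union> {p, q}) (Suc g) B' G'"
proof -
  define U1 where "U1 = (\<lambda>(j, t). ([Suc j, 0], lev p j (t + 1), t)) ` ({..<q} \<times> {..<g})"
  define U2 where "U2 = (\<lambda>i. ([i, 1], spare p q i, 0 :: nat)) ` {..<q}"
  \<comment> \<open>The vector \<open>[0, 0]\<close> has modulus 1 and keeps group \<open>h\<close>
    as it is; the reserved digits of all levels together form the single group
    \<open>g\<close>.\<close>
  define W where "W h = (if h < g then {([0, 0], UNIV, h)} else
      (\<lambda>(j, t). ([Suc j, 0], lev p j (g + 1 + t), t)) ` ({..<q} \<times> {..<g}))" for h
  have p1: "1 < p" "1 < q" using pq prime_gt_1_nat by blast+
  have n11: "p ^ Suc j \<noteq> 11" "p ^ i * q \<noteq> 11" for i j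
  proof -
    have "prime (11 :: nat)" by simp
    then have "\<not> p dvd 11" "\<not> q dvd 11" using pq primes_dvd_imp_eq by blast+
    then show "p ^ Suc j \<noteq> 11" "p ^ i * q \<noteq> 11"
      by (metis dvd_triv_left power_Suc, metis dvd_triv_right)
  qed
  have "\<exists>B' G'. kit (P \<union> set [p, q]) (Suc g) B' G'"
  proof (rule kit_units [OF kit])
    show "list_all prime [p, q]" "distinct [p, q]" "P \<inter> set [p, q] = {}" using pq by auto
    show "finite (U1 \<union> U2)" "\<And>h. finite (W h)" unfolding U1_def U2_def W_def by auto
    have cls: "cls [p, q] [Suc j, 0] (lev p j d)" "cls [p, q] [i, 1] (spare p q i)" for i j d
      unfolding cls_def using levD spareD by (simp_all del: power_Suc)
    show "t < g \<and> length v = length [p, q] \<and> cls [p, q] v Y \<and> \<not> (\<forall>k\<in>set v. k = 0) \<and>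
        (t = 0 \<longrightarrow> pprod [p, q] v \<noteq> 11)" if "(v, Y, t) \<in> U1 \<union> U2" for v Y t
    proof -
      from that consider j where "v = [Suc j, 0]" "Y = lev p j (t + 1)" "t < g"
        | i where "v = [i, 1]" "Y = spare p q i" "t = 0"
        unfolding U1_def U2_def by force
      then show ?thesis using cls n11 g(2) by cases (auto simp del: power_Suc)
    qed
    show "Y = Y'" if "(v, Y, t) \<in> U1 \<union> U2" "(v, Y', t) \<in> U1 \<union> U2" for v Y Y' t
      using that unfolding U1_def U2_def by auto
    show "t < g \<and> length v = length [p, q] \<and> cls [p, q] v Y \<and> ((\<forall>k\<in>set v. k = 0) \<and> t = 0 \<longrightarrow> h = 0)"
      if "(v, Y, t) \<in> W h" for h v Y t
      using that cls(1) unfolding W_def by (auto simp: cls_def split: if_splits)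
    show "h = h' \<and> Y = Y'" if "h < Suc g" "h' < Suc g" "(v, Y, t) \<in> W h" "(v, Y', t) \<in> W h'" for h h' v Y Y' t
      using that unfolding W_def by (auto split: if_splits)
    fix y :: int
    show "y mod 11 < 7 \<or> (\<exists>(v, Y, t)\<in>U1 \<union> U2. y \<in> Y) \<or> (\<forall>h<Suc g. \<exists>(v, Y, t)\<in>W h. y \<in> Y)"
    proof (cases "int (p ^ q) dvd y")
      case True
      then obtain i where "i < q" "y \<in> spare p q i" using spare_cases[of q p y] p1 by auto
      then have "([i, 1], spare p q i, 0) \<in> U2" "y \<in> spare p q i" unfolding U2_def by auto
      then show ?thesis by blast
    next
      case False
      then obtain k d where kd: "k < q" "d < p" "d \<noteq> 0" "y \<in> lev p k d"
        using lev_cases p1 by blast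
      show ?thesis
      proof (cases "d \<le> g")
        case True
        then have "([Suc k, 0], lev p k d, d - 1) \<in> U1"
          unfolding U1_def using kd by (intro image_eqI[of _ _ "(k, d - 1)"]) auto
        then show ?thesis using kd(4) by blast
      next
        case False
        then have "([Suc k, 0], lev p k d, d - g - 1) \<in> W g"
          unfolding W_def using kd g by (auto intro!: image_eqI[of _ _ "(k, d - g - 1)"])
        then have "\<exists>(v, Y, t)\<in>W g. y \<in> Y" using kd(4) by blast
        moreover have "\<exists>(v, Y, t)\<in>W h. y \<in> Y" if "h < g" for h
          using that unfolding W_def by auto
        ultimately show ?thesis by (auto simp: less_Suc_eq)
      qed
    qed
  qed
  then show ?thesis by simp
qed

section \<open>Chains of powers of 5 and 7\<close>

text \<open>
  An item \<open>(s, a, b, w, M)\<close> with \<open>s < 2\<close> is the class \<open>M\<close> with exponents \<open>a\<close>, \<open>b\<close>, \<open>w\<close> of 5, 7 and the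
  primes \<open>rs\<close>, used on top of reserve group \<open>s\<close>. The value \<open>s = 2\<close> stands for a whole chain of
  congruences that covers the multiples of 5 in \<open>M\<close>: the first nonzero 5-adic digit of such a number is
  1 or 2 and removed once and for all, or it is \<open>3 + t\<close> at some level and handled by that power of 5 on
  top of group \<open>t\<close>. Likewise \<open>s = 3\<close> covers the multiples of 7 in \<open>M\<close>: first digits 1, 2, 3 are removed
  once and for all, 4 and 5 use powers of 7 alone, and 6 in addition uses the 5-adic level.
\<close>

type_synonym item = "nat \<times> nat \<times> nat \<times> nat list \<times> int set"

text \<open>Higher powers of 5 and 7 belong to the chains, so an item prescribes exponents at most
  1, and a chain leaves open the exponents that it supplies itself.\<close>

definition wf_item :: "nat list \<Rightarrow> item \<Rightarrow> bool" where
  "wf_item rs = (\<lambda>(s, a, b, w, M). s < 4 \<and> a \<le> 1 \<and> b \<le> 1 \<and> length w = length rs \<and>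
     (s = 2 \<longrightarrow> a = 0) \<and> (s = 3 \<longrightarrow> a = 0 \<and> b = 0) \<and> cls (5 # 7 # rs) (a # b # w) M)"

definition covers :: "item \<Rightarrow> int \<Rightarrow> bool" where
  "covers = (\<lambda>(s, a, b, w, M) y. y \<in> M \<and> (s = 2 \<longrightarrow> 5 dvd y) \<and> (s = 3 \<longrightarrow> 7 dvd y))"

text \<open>Level is exponent minus 1, as \<open>lev p k\<close> is a class modulo
  \<open>p ^ Suc k\<close>. The offsets skip the removed digits: for 5 the digits 3 and 4 go to the
  groups 0 and 1. For 7 the digits 4 and 5 go to the groups 0 and 1, and 6 to the third group, which
  consists of the surviving 5-adic levels.\<close>

definition shape :: "nat \<Rightarrow> nat \<Rightarrow> nat \<Rightarrow> int set \<Rightarrow> int set" where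
  "shape a b t M =
     (if 2 \<le> b then (if a = 0 then M \<inter> lev 7 (b - 1) (4 + t) else M \<inter> lev 7 (b - 1) 6 \<inter> lev 5 (a - 1) (3 + t))
      else if 2 \<le> a then M \<inter> lev 5 (a - 1) (3 + t) else M)"

text \<open>Chains start at exponent 2 because a multiple of 5 or 7 has level at least 1. In the
  last case \<open>i = 0\<close> means no power of 5 and \<open>i = Suc k\<close> means level
  \<open>k < q5\<close>, hence the closed range for \<open>i\<close>.\<close>

definition expand :: "nat \<Rightarrow> nat \<Rightarrow> item \<Rightarrow> (nat list \<times> int set \<times> nat) set" where
  "expand q5 q7 = (\<lambda>(s, a, b, w, M).
     if s < 2 then {(a # b # 0 # 0 # w, M, s)}
     else if s = 2 then (\<lambda>(j, t). ((j + 2) # b # 0 # 0 # w, shape (j + 2) b t M, t)) ` ({..<q5} \<times> {..<2})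
     else (\<lambda>(i, j, t). (i # (j + 2) # 0 # 0 # w, shape i (j + 2) t M, t)) ` ({..q5} \<times> {..<q7} \<times> {..<2}))"

text \<open>The vector reveals its origin: an exponent of 7 above 1 comes from slot 3 only; failing
  that, an exponent of 5 above 1 comes from slot 2 only; otherwise the slot is the group. Thus items
  that differ in \<open>(s, a, b, w)\<close> never share a modulus on the same group.\<close>

lemma expand_shape:
  assumes "wf_item rs (s, a, b, w, M)" "(v, Y, t) \<in> expand q5 q7 (s, a, b, w, M)"
  shows "\<exists>a' b'. v = a' # b' # 0 # 0 # w \<and> Y = shape a' b' t M \<and> t < 2 \<and>
    (if 2 \<le> b' then s = 3 \<and> a = 0 \<and> b = 0 else if 2 \<le> a' then s = 2 \<and> a = 0 \<and> b' = b
     else s = t \<and> a' = a \<and> b' = b)"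
proof -
  have wf: "s < 4" "a \<le> 1" "b \<le> 1" "s = 2 \<longrightarrow> a = 0" "s = 3 \<longrightarrow> a = 0 \<and> b = 0"
    using assms(1) unfolding wf_item_def by auto
  consider "s < 2" | "s = 2" | "s = 3" using wf(1) by linarith
  then show ?thesis
  proof cases
    case 1
    then have "v = a # b # 0 # 0 # w" "Y = shape a b t M" "t = s"
      using assms(2) wf unfolding expand_def shape_def by auto
    then show ?thesis using 1 wf by auto
  next
    case 2
    then obtain j where "v = (j + 2) # b # 0 # 0 # w" "Y = shape (j + 2) b t M" "t < 2"
      using assms(2) unfolding expand_def by auto
    then show ?thesis using 2 wf by auto
  next
    case 3
    then obtain i j where "v = i # (j + 2) # 0 # 0 # w" "Y = shape i (j + 2) t M" "t < 2"
      using assms(2) unfolding expand_def by auto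
    then show ?thesis using 3 wf by auto
  qed
qed

lemma lev_le: "y \<in> lev p k d \<Longrightarrow> z \<in> lev p k d \<Longrightarrow> j \<le> Suc k \<Longrightarrow> [y = z] (mod int (p ^ j))"
  using levD[of y p k d z] by (meson cong_dvd_modulus int_dvd_int_iff le_imp_power_dvd)

lemma cls_shape:
  assumes "wf_item rs (s, a, b, w, M)" "(a' # b' # 0 # 0 # w, Y, t) \<in> expand q5 q7 (s, a, b, w, M)"
  shows "cls (5 # 7 # q5 # q7 # rs) (a' # b' # 0 # 0 # w) Y"
proof -
  have M: "cls (5 # 7 # rs) (a # b # w) M" and ab: "a \<le> 1" "b \<le> 1"
    using assms(1) unfolding wf_item_def by auto
  have Y: "Y = shape a' b' t M" "if 2 \<le> b' then s = 3 \<and> a = 0 \<and> b = 0 else if 2 \<le> a' then s = 2 \<and> a = 0 \<and> b' = b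
     else s = t \<and> a' = a \<and> b' = b"
    using expand_shape[OF assms] by auto
  have sub: "shape a' b' t M \<subseteq> M" unfolding shape_def by auto
  show ?thesis unfolding cls_def
  proof (intro ballI)
    fix y z assume yz: "y \<in> Y" "z \<in> Y"
    then have *: "list_all2 (\<lambda>p k. [y = z] (mod int (p ^ k))) (5 # 7 # rs) (a # b # w)"
      using M sub Y(1) unfolding cls_def by blast
    have "[y = z] (mod int (5 ^ a')) \<and> [y = z] (mod int (7 ^ b'))"
    proof (cases "2 \<le> b'")
      case True
      have 7: "[y = z] (mod int (7 ^ b'))"
      proof (rule lev_le)
        show "y \<in> lev 7 (b' - 1) (if a' = 0 then 4 + t else 6)" "z \<in> lev 7 (b' - 1) (if a' = 0 then 4 + t else 6)"
          using yz Y(1) True unfolding shape_def by (auto split: if_splits)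
      qed (use True in simp)
      have 5: "[y = z] (mod int (5 ^ a'))"
      proof (cases "a' = 0")
        case False
        show ?thesis
        proof (rule lev_le)
          show "y \<in> lev 5 (a' - 1) (3 + t)" "z \<in> lev 5 (a' - 1) (3 + t)"
            using yz Y(1) True False unfolding shape_def by (auto split: if_splits)
        qed (use False in simp)
      qed (simp add: cong_def)
      show ?thesis using 5 7 by blast
    next
      case False
      then have b': "b' = b" using Y(2) by (auto split: if_splits)
      have 5: "[y = z] (mod int (5 ^ a'))"
      proof (cases "2 \<le> a'")
        case True
        show ?thesis
        proof (rule lev_le)
          show "y \<in> lev 5 (a' - 1) (3 + t)" "z \<in> lev 5 (a' - 1) (3 + t)"
            using yz Y(1) True False unfolding shape_def by (auto split: if_splits)
        qed (use True in simp)
      next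
        case F: False
        then show ?thesis using Y(2) False * by (auto split: if_splits)
      qed
      then show ?thesis using * b' by auto
    qed
    then show "list_all2 (\<lambda>p k. [y = z] (mod int (p ^ k))) (5 # 7 # q5 # q7 # rs) (a' # b' # 0 # 0 # w)"
      using * by (simp add: cong_def)
  qed
qed

text \<open>The set \<open>K\<close> in the proof is the automatic part. An integer outside it has
  first nonzero 5-adic digit 3 or 4 and, if it is a multiple of 7, first nonzero 7-adic digit 4, 5
  or 6. Its digits therefore select a member of any chain whose class contains it. \<open>I0\<close>
  keeps the items away from the moduli of \<open>K\<close>, which involve no prime of
  \<open>rs\<close>; \<open>I11\<close> keeps out the modulus 11.\<close>

theorem kit_flex:
  fixes I :: "item set" and J :: "nat \<Rightarrow> item set"
  assumes kit: "kit P 2 B G"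
    and ps: "list_all prime (5 # 7 # q5 # q7 # rs)" "distinct (5 # 7 # q5 # q7 # rs)"
      "P \<inter> set (5 # 7 # q5 # q7 # rs) = {}" "q5 \<noteq> 11" "q7 \<noteq> 11"
    and fin: "finite I" "\<And>h. h < g \<Longrightarrow> finite (J h)"
    and wfI: "\<And>i. i \<in> I \<Longrightarrow> wf_item rs i" and wfJ: "\<And>h i. h < g \<Longrightarrow> i \<in> J h \<Longrightarrow> wf_item rs i"
    and I1: "\<And>s a b w M M'. (s, a, b, w, M) \<in> I \<Longrightarrow> (s, a, b, w, M') \<in> I \<Longrightarrow> M = M'"
    and I0: "\<And>s a b w M. (s, a, b, w, M) \<in> I \<Longrightarrow> \<not> (b = 0 \<and> (\<forall>k\<in>set w. k = 0))"
    and I11: "\<And>M w. (0, 0, 0, w, M) \<in> I \<Longrightarrow> pprod rs w \<noteq> 11"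
    and J1: "\<And>h h' s a b w M M'. h < g \<Longrightarrow> h' < g \<Longrightarrow> (s, a, b, w, M) \<in> J h \<Longrightarrow>
        (s, a, b, w, M') \<in> J h' \<Longrightarrow> h = h' \<and> M = M'"
    and J0: "\<And>h w M. h < g \<Longrightarrow> (0, 0, 0, w, M) \<in> J h \<Longrightarrow> \<forall>k\<in>set w. k = 0 \<Longrightarrow> h = 0"
    and cover: "\<And>y. y mod 11 < 7 \<or> y mod 5 = 1 \<or> y mod 5 = 2 \<or> (\<exists>i\<in>I. covers i y) \<or>
        (\<forall>h<g. \<exists>i\<in>J h. covers i y)"
  shows "\<exists>B' G'. kit (P \<union> set (5 # 7 # q5 # q7 # rs)) g B' G'"
proof -
  define ps where "ps = 5 # 7 # q5 # q7 # rs"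
  define z where "z = map (\<lambda>_. 0 :: nat) rs"
  define K5 where "K5 = (\<lambda>(j, t). (Suc j # 0 # 0 # 0 # z, lev 5 j (1 + t), t)) ` ({..<q5} \<times> {..<2 :: nat})"
  define S5 where "S5 = (\<lambda>i. (i # 0 # 1 # 0 # z, spare 5 q5 i, 0 :: nat)) ` {..<q5}"
  \<comment> \<open>Unlike \<open>K5\<close>, this starts at level 1, because the modulus 7 itself
    is left to the items. Digit 3 is removed by \<open>L7\<close>, where the 5-adic level with digit
    \<open>3 + t\<close> acts as third group.\<close>
  define K7 where "K7 = (\<lambda>(j, t). (0 # (j + 2) # 0 # 0 # z, lev 7 (j + 1) (1 + t), t)) ` ({..<q7} \<times> {..<2 :: nat})"
  define L7 where "L7 = (\<lambda>(i, j, t). (Suc i # (j + 2) # 0 # 0 # z, lev 7 (j + 1) 3 \<inter> lev 5 i (3 + t), t)) `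
      ({..<q5} \<times> {..<q7} \<times> {..<2 :: nat})"
  define S7 where "S7 = (\<lambda>i. (0 # i # 0 # 1 # z, spare 7 q7 i, 0 :: nat)) ` {..<q7}"
  define K where "K = K5 \<union> S5 \<union> K7 \<union> L7 \<union> S7"
  define E where "E = (\<Union>i\<in>I. expand q5 q7 i)"
  define W where "W h = (\<Union>i\<in>J h. expand q5 q7 i)" for h
  note defs = K_def K5_def S5_def K7_def L7_def S7_def
  have lz: "length z = length rs" "\<And>k. k \<in> set z \<Longrightarrow> k = 0" unfolding z_def by auto
  have zw: "w = z" if "\<forall>k\<in>set w. k = 0" "length w = length rs" for w
    using that unfolding z_def by (simp add: list_eq_iff_nth_eq)
  have q1: "1 < q5" "1 < q7" using ps(1) prime_gt_1_nat by auto
  have fine: "finite (expand q5 q7 i)" for i by (cases i) (simp add: expand_def)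
  have clsz: "cls ps (a # b # c # d # z) Y"
    if "\<And>y x. y \<in> Y \<Longrightarrow> x \<in> Y \<Longrightarrow> [y = x] (mod int (5 ^ a)) \<and> [y = x] (mod int (7 ^ b)) \<and>
      [y = x] (mod int (q5 ^ c)) \<and> [y = x] (mod int (q7 ^ d))" for a b c d Y
  proof -
    have "list_all2 (\<lambda>p k. [y = x] (mod int (p ^ k))) rs z" for y x :: int
      unfolding z_def by (simp add: list_all2_map2 list_all2_same cong_def)
    then show ?thesis unfolding cls_def ps_def using that by simp
  qed
  have Kform: "t < 2 \<and> length v = length ps \<and> cls ps v Y \<and> (\<exists>a b c d. v = a # b # c # d # z \<and>
      (a, b, c, d) \<noteq> (0, 0, 0, 0) \<and> Y = (if c = 1 then spare 5 q5 a else if d = 1 then spare 7 q7 b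
      else if b = 0 then lev 5 (a - 1) (1 + t) else if a = 0 then lev 7 (b - 1) (1 + t)
      else lev 7 (b - 1) 3 \<inter> lev 5 (a - 1) (3 + t)) \<and> (c = 0 \<and> d = 0 \<longrightarrow> b \<noteq> 1))"
    if "(v, Y, t) \<in> K" for v Y t
  proof -
    from that consider
        j where "v = Suc j # 0 # 0 # 0 # z" "Y = lev 5 j (1 + t)" "t < 2"
      | i where "v = i # 0 # 1 # 0 # z" "Y = spare 5 q5 i" "t = 0"
      | j where "v = 0 # (j + 2) # 0 # 0 # z" "Y = lev 7 (j + 1) (1 + t)" "t < 2"
      | i j where "v = Suc i # (j + 2) # 0 # 0 # z" "Y = lev 7 (j + 1) 3 \<inter> lev 5 i (3 + t)" "t < 2"
      | i where "v = 0 # i # 0 # 1 # z" "Y = spare 7 q7 i" "t = 0"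
      unfolding defs by force
    then show ?thesis
    proof cases
      case 1
      have "cls ps v Y" unfolding 1 by (rule clsz) (auto simp del: power_Suc dest: levD)
      then show ?thesis using 1 lz by (auto simp: ps_def)
    next
      case 2
      have "cls ps v Y" unfolding 2 by (rule clsz) (auto dest: spareD)
      then show ?thesis using 2 lz by (auto simp: ps_def)
    next
      case 3
      have "cls ps v Y" unfolding 3 by (rule clsz) (auto simp del: power_Suc dest: levD)
      then show ?thesis using 3 lz by (auto simp: ps_def)
    next
      case 4
      have "cls ps v Y" unfolding 4 by (rule clsz) (auto simp del: power_Suc dest: levD)
      then show ?thesis using 4 lz by (auto simp: ps_def)
    next
      case 5
      have "cls ps v Y" unfolding 5 by (rule clsz) (auto dest: spareD)
      then show ?thesis using 5 lz by (auto simp: ps_def)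
    qed
  qed
  have form: "length v = length ps \<and> cls ps v Y \<and> t < 2 \<and> (\<exists>s a b w M a' b'. (s, a, b, w, M) \<in> X \<and>
      v = a' # b' # 0 # 0 # w \<and> Y = shape a' b' t M \<and> length w = length rs \<and> a \<le> 1 \<and> b \<le> 1 \<and> (s = 3 \<longrightarrow> b = 0) \<and>
      (if 2 \<le> b' then s = 3 \<and> a = 0 \<and> b = 0 else if 2 \<le> a' then s = 2 \<and> a = 0 \<and> b' = b
       else s = t \<and> a' = a \<and> b' = b))"
    if vX: "(v, Y, t) \<in> (\<Union>i\<in>X. expand q5 q7 i)" and wfX: "\<And>i. i \<in> X \<Longrightarrow> wf_item rs i" for v Y t X
  proof -
    obtain s a b w M where i: "(s, a, b, w, M) \<in> X" "(v, Y, t) \<in> expand q5 q7 (s, a, b, w, M)"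
      using vX by auto
    note wf = wfX[OF i(1)]
    obtain a' b' where ab: "v = a' # b' # 0 # 0 # w" "Y = shape a' b' t M" "t < 2"
      "if 2 \<le> b' then s = 3 \<and> a = 0 \<and> b = 0 else if 2 \<le> a' then s = 2 \<and> a = 0 \<and> b' = b
       else s = t \<and> a' = a \<and> b' = b"
      using expand_shape[OF wf i(2)] by blast
    have c: "cls ps v Y" using cls_shape[OF wf] i(2) unfolding ab(1) ps_def by blast
    have w: "length w = length rs" "a \<le> 1" "b \<le> 1" "s = 3 \<longrightarrow> b = 0"
      using wf unfolding wf_item_def by auto
    have l: "length v = length ps" using ab(1) w(1) by (simp add: ps_def)
    show ?thesis
      by (rule conjI[OF l conjI[OF c conjI[OF ab(3)]]], intro exI conjI) (fact i(1) ab w)+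
  qed
  have pr11: "prime (11 :: nat)" by simp
  have not11: "pprod ps v \<noteq> 11" if v: "v = a # b # c # d # w" and n: "(a, b, c, d) \<noteq> (0, 0, 0, 0)" for v a b c d w
  proof
    assume 11: "pprod ps v = 11"
    have "p = 11" if "p \<in> {5, 7, q5, q7}" "p ^ k dvd pprod ps v" "k \<noteq> 0" for p k
    proof -
      have "p dvd 11" using that 11 by (metis dvd_power dvd_trans neq0_conv)
      moreover have "prime p" using that(1) \<open>list_all prime (5 # 7 # q5 # q7 # rs)\<close> by auto
      ultimately show ?thesis using pr11 primes_dvd_imp_eq by blast
    qed
    note * = this
    have "5 ^ a dvd pprod ps v" "7 ^ b dvd pprod ps v" "q5 ^ c dvd pprod ps v" "q7 ^ d dvd pprod ps v"
      unfolding v ps_def by simp_all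
    then show False using *[of 5 a] *[of 7 b] *[of q5 c] *[of q7 d] n \<open>q5 \<noteq> 11\<close> \<open>q7 \<noteq> 11\<close> by auto
  qed
  have "\<exists>B' G'. kit (P \<union> set ps) g B' G'"
  proof (rule kit_units [OF kit])
    show "list_all prime ps" "distinct ps" "P \<inter> set ps = {}"
      using assms(2-4) unfolding ps_def by auto
    show "finite (K \<union> E)" "\<And>h. h < g \<Longrightarrow> finite (W h)"
      using fin fine unfolding defs E_def W_def by auto
    show "t < 2 \<and> length v = length ps \<and> cls ps v Y \<and> \<not> (\<forall>k\<in>set v. k = 0) \<and> (t = 0 \<longrightarrow> pprod ps v \<noteq> 11)"
      if vU: "(v, Y, t) \<in> K \<union> E" for v Y t
    proof (cases "(v, Y, t) \<in> K")
      case True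
      note F = Kform[OF True]
      then obtain a b c d where v: "v = a # b # c # d # z" "(a, b, c, d) \<noteq> (0, 0, 0, 0)" by blast
      have "\<not> (\<forall>k\<in>set v. k = 0)" using v by auto
      then show ?thesis using F not11[OF v] by blast
    next
      case False
      then have "(v, Y, t) \<in> (\<Union>i\<in>I. expand q5 q7 i)" using vU unfolding E_def by blast
      note F = form[OF this wfI]
      then obtain s a b w M a' b' where i: "(s, a, b, w, M) \<in> I" "v = a' # b' # 0 # 0 # w"
        "if 2 \<le> b' then s = 3 \<and> a = 0 \<and> b = 0 else if 2 \<le> a' then s = 2 \<and> a = 0 \<and> b' = b
         else s = t \<and> a' = a \<and> b' = b" by blast
      have "\<not> (\<forall>k\<in>set v. k = 0)" using I0[OF i(1)] i(2,3) by (auto split: if_splits)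
      moreover have "pprod ps v \<noteq> 11" if "t = 0"
      proof (cases "a' = 0 \<and> b' = 0")
        case True
        then have "(0, 0, 0, w, M) \<in> I" using i that by auto
        then show ?thesis using I11 i(2) True by (simp add: ps_def)
      next
        case False
        then show ?thesis using not11[OF i(2)] by auto
      qed
      ultimately show ?thesis using F by blast
    qed
    show "Y = Y'" if vU: "(v, Y, t) \<in> K \<union> E" "(v, Y', t) \<in> K \<union> E" for v Y Y' t
    proof -
      \<comment> \<open>In \<open>K\<close> the exponent of 7 is never 1 unless \<open>q5\<close> or
        \<open>q7\<close> occurs, and it has no primes of \<open>rs\<close>. A common vector would
        come from an item with \<open>b = 0\<close> and zero \<open>w\<close>, which
        \<open>I0\<close> excludes.\<close>
      have no: False if k: "(v, Y, t) \<in> K" and e: "(v, Y', t) \<in> E" for Y Y'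
      proof -
        obtain a b c d where v: "v = a # b # c # d # z" "c = 0 \<and> d = 0 \<longrightarrow> b \<noteq> 1"
          using Kform[OF k] by blast
        obtain s x y w M a' b' where i: "(s, x, y, w, M) \<in> I" "v = a' # b' # 0 # 0 # w" "y \<le> 1" "s = 3 \<longrightarrow> y = 0"
          "if 2 \<le> b' then s = 3 \<and> x = 0 \<and> y = 0 else if 2 \<le> a' then s = 2 \<and> x = 0 \<and> b' = y
           else s = t \<and> a' = x \<and> b' = y"
          using form[OF e[unfolded E_def] wfI] by blast
        have "w = z" "b' \<noteq> 1" using v i(2) by auto
        then have "y = 0" using i(3,5) by (auto split: if_splits)
        then show False using I0[OF i(1)] lz(2) \<open>w = z\<close> by auto
      qed
      consider "(v, Y, t) \<in> K" "(v, Y', t) \<in> K" | "(v, Y, t) \<in> E" "(v, Y', t) \<in> E" using vU no by blast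
      then show ?thesis
      proof cases
        case 1
        show ?thesis using Kform[OF 1(1)] Kform[OF 1(2)] by force
      next
        case 2
        obtain s a b w M a' b' where i: "(s, a, b, w, M) \<in> I" "v = a' # b' # 0 # 0 # w" "Y = shape a' b' t M"
          "if 2 \<le> b' then s = 3 \<and> a = 0 \<and> b = 0 else if 2 \<le> a' then s = 2 \<and> a = 0 \<and> b' = b
           else s = t \<and> a' = a \<and> b' = b"
          using form[OF 2(1)[unfolded E_def] wfI] by blast
        obtain s2 a2 b2 w2 M2 a2' b2' where i2: "(s2, a2, b2, w2, M2) \<in> I" "v = a2' # b2' # 0 # 0 # w2" "Y' = shape a2' b2' t M2"
          "if 2 \<le> b2' then s2 = 3 \<and> a2 = 0 \<and> b2 = 0 else if 2 \<le> a2' then s2 = 2 \<and> a2 = 0 \<and> b2' = b2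
           else s2 = t \<and> a2' = a2 \<and> b2' = b2"
          using form[OF 2(2)[unfolded E_def] wfI] by blast
        have "(s2, a2, b2, w2) = (s, a, b, w)" "a2' = a'" "b2' = b'"
          using i(2,4) i2(2,4) by (auto split: if_splits)
        then show ?thesis using I1[OF i(1), of M2] i2(1) i(3) i2(3) by simp
      qed
    qed
    show "t < 2 \<and> length v = length ps \<and> cls ps v Y \<and> ((\<forall>k\<in>set v. k = 0) \<and> t = 0 \<longrightarrow> h = 0)"
      if h: "h < g" and v: "(v, Y, t) \<in> W h" for h v Y t
    proof -
      note F = form[OF v[unfolded W_def] wfJ[OF h]]
      then obtain s a b w M a' b' where i: "(s, a, b, w, M) \<in> J h" "v = a' # b' # 0 # 0 # w"
        "if 2 \<le> b' then s = 3 \<and> a = 0 \<and> b = 0 else if 2 \<le> a' then s = 2 \<and> a = 0 \<and> b' = b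
         else s = t \<and> a' = a \<and> b' = b" by blast
      have "h = 0" if "\<forall>k\<in>set v. k = 0" "t = 0"
      proof -
        have "(0, 0, 0, w, M) \<in> J h" "\<forall>k\<in>set w. k = 0" using i that by auto
        then show ?thesis using J0 h by blast
      qed
      then show ?thesis using F by blast
    qed
    show "h = h' \<and> Y = Y'"
      if h: "h < g" "h' < g" and v: "(v, Y, t) \<in> W h" "(v, Y', t) \<in> W h'" for h h' v Y Y' t
    proof -
      obtain s a b w M a' b' where i: "(s, a, b, w, M) \<in> J h" "v = a' # b' # 0 # 0 # w" "Y = shape a' b' t M"
        "if 2 \<le> b' then s = 3 \<and> a = 0 \<and> b = 0 else if 2 \<le> a' then s = 2 \<and> a = 0 \<and> b' = b
         else s = t \<and> a' = a \<and> b' = b"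
        using form[OF v(1)[unfolded W_def] wfJ[OF h(1)]] by blast
      obtain s2 a2 b2 w2 M2 a2' b2' where i2: "(s2, a2, b2, w2, M2) \<in> J h'" "v = a2' # b2' # 0 # 0 # w2" "Y' = shape a2' b2' t M2"
        "if 2 \<le> b2' then s2 = 3 \<and> a2 = 0 \<and> b2 = 0 else if 2 \<le> a2' then s2 = 2 \<and> a2 = 0 \<and> b2' = b2
         else s2 = t \<and> a2' = a2 \<and> b2' = b2"
        using form[OF v(2)[unfolded W_def] wfJ[OF h(2)]] by blast
      have "(s2, a2, b2, w2) = (s, a, b, w)" "a2' = a'" "b2' = b'"
        using i(2,4) i2(2,4) by (auto split: if_splits)
      then show ?thesis using J1[OF h i(1), of M2] i2(1) i(3) i2(3) by simp
    qed
    fix y :: int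
    show "y mod 11 < 7 \<or> (\<exists>(v, Y, t)\<in>K \<union> E. y \<in> Y) \<or> (\<forall>h<g. \<exists>(v, Y, t)\<in>W h. y \<in> Y)"
    proof (cases "\<exists>(v, Y, t)\<in>K. y \<in> Y")
      case False
      then have nK: "y \<notin> Y" if "(v, Y, t) \<in> K" for v Y t using that by blast
      have "\<not> int (5 ^ q5) dvd y"
      proof
        assume "int (5 ^ q5) dvd y"
        then obtain i where "i < q5" "y \<in> spare 5 q5 i" using spare_cases q1 by (metis less_trans zero_less_one)
        then show False using nK[of "i # 0 # 1 # 0 # z" "spare 5 q5 i" 0] unfolding defs by blast
      qed
      then obtain k5 d5 where k5: "k5 < q5" "d5 < 5" "d5 \<noteq> 0" "y \<in> lev 5 k5 d5"
        using lev_cases[of 5 q5 y] by auto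
      have d5: "\<not> d5 \<le> 2"
      proof
        assume "d5 \<le> 2"
        then have "(Suc k5 # 0 # 0 # 0 # z, lev 5 k5 d5, d5 - 1) \<in> K5"
          unfolding K5_def using k5 by (intro image_eqI[of _ _ "(k5, d5 - 1)"]) auto
        then show False using nK k5(4) unfolding K_def by blast
      qed
      define t5 where "t5 = d5 - 3"
      have t5: "d5 = 3 + t5" "t5 < 2" using d5 k5(2) unfolding t5_def by auto
      have seven: "\<exists>j d. j < q7 \<and> 4 \<le> d \<and> d < 7 \<and> y \<in> lev 7 (j + 1) d" if dvd7: "7 dvd y"
      proof -
        have "\<not> int (7 ^ q7) dvd y"
        proof
          assume "int (7 ^ q7) dvd y"
          then obtain i where "i < q7" "y \<in> spare 7 q7 i" using spare_cases q1 by (metis less_trans zero_less_one)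
          then show False using nK[of "0 # i # 0 # 1 # z" "spare 7 q7 i" 0] unfolding defs by blast
        qed
        then obtain k7 d7 where k7: "k7 < q7" "d7 < 7" "d7 \<noteq> 0" "y \<in> lev 7 k7 d7"
          using lev_cases[of 7 q7 y] by auto
        have "k7 \<noteq> 0"
        proof
          assume "k7 = 0"
          then have "y mod 7 = int d7 mod 7" using k7(4) unfolding lev_def by (simp add: cong_def)
          then show False using dvd7 k7(2,3) by auto
        qed
        then obtain j where j: "k7 = j + 1" by (metis Suc_eq_plus1 not0_implies_Suc)
        have "\<not> d7 \<le> 2"
        proof
          assume "d7 \<le> 2"
          then have "(0 # (j + 2) # 0 # 0 # z, lev 7 (j + 1) d7, d7 - 1) \<in> K7"
            unfolding K7_def using k7 j by (intro image_eqI[of _ _ "(j, d7 - 1)"]) auto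
          then show False using nK k7(4) j unfolding K_def by blast
        qed
        moreover have "d7 \<noteq> 3"
        proof
          assume "d7 = 3"
          have "(Suc k5 # (j + 2) # 0 # 0 # z, lev 7 (j + 1) 3 \<inter> lev 5 k5 (3 + t5), t5) \<in> L7"
            unfolding L7_def using k7 j k5 t5 by (intro image_eqI[of _ _ "(k5, j, t5)"]) auto
          then show False using nK k7(4) k5(4) j \<open>d7 = 3\<close> t5(1) unfolding K_def by blast
        qed
        ultimately show ?thesis using k7 j by (intro exI[of _ j] exI[of _ d7]) auto
      qed
      \<comment> \<open>The position and value of the first nonzero digits of \<open>y\<close> pick
        the member of the chain. For the 7-adic digit 6, the 5-adic pair \<open>k5\<close>,
        \<open>t5\<close> is used as well, with exponent \<open>Suc k5\<close>.\<close>
      have cov: "\<exists>(v, Y, t)\<in>expand q5 q7 i. y \<in> Y" if i: "covers i y" "wf_item rs i" for i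
      proof -
        obtain s a b w M where ii: "i = (s, a, b, w, M)" by (cases i) auto
        have M: "y \<in> M" "s = 2 \<longrightarrow> 5 dvd y" "s = 3 \<longrightarrow> 7 dvd y" and s: "s < 4" and b1: "b \<le> 1"
          using i unfolding ii covers_def wf_item_def by auto
        consider "s < 2" | "s = 2" | "s = 3" using s by linarith
        then show ?thesis
        proof cases
          case 1
          then show ?thesis using M unfolding ii expand_def by simp
        next
          case 2
          have "k5 \<noteq> 0"
          proof
            assume "k5 = 0"
            then have "y mod 5 = int d5 mod 5" using k5(4) unfolding lev_def by (simp add: cong_def)
            then show False using M(2) 2 k5(2,3) by auto
          qed
          then obtain j where j: "k5 = j + 1" by (metis Suc_eq_plus1 not0_implies_Suc)
          have "y \<in> shape (j + 2) b t5 M" using M(1) k5(4) j t5 b1 unfolding shape_def by simp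
          moreover have "((j + 2) # b # 0 # 0 # w, shape (j + 2) b t5 M, t5) \<in> expand q5 q7 i"
            unfolding ii expand_def using 2 j k5(1) t5(2) by (auto intro!: image_eqI[of _ _ "(j, t5)"])
          ultimately show ?thesis by blast
        next
          case 3
          obtain j d where j: "j < q7" "4 \<le> d" "d < 7" "y \<in> lev 7 (j + 1) d" using seven M 3 by blast
          show ?thesis
          proof (cases "d = 6")
            case True
            have "y \<in> shape (Suc k5) (j + 2) t5 M"
              using M(1) k5(4) j(4) t5 True unfolding shape_def by simp
            moreover have "(Suc k5 # (j + 2) # 0 # 0 # w, shape (Suc k5) (j + 2) t5 M, t5) \<in> expand q5 q7 i"
              unfolding ii expand_def using 3 j(1) k5(1) t5(2) by (auto intro!: image_eqI[of _ _ "(Suc k5, j, t5)"])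
            ultimately show ?thesis by blast
          next
            case False
            define t where "t = d - 4"
            have t: "d = 4 + t" "t < 2" using j(2,3) False unfolding t_def by auto
            have "y \<in> shape 0 (j + 2) t M" using M(1) j(4) t unfolding shape_def by simp
            moreover have "(0 # (j + 2) # 0 # 0 # w, shape 0 (j + 2) t M, t) \<in> expand q5 q7 i"
              unfolding ii expand_def using 3 j(1) t(2) by (auto intro!: image_eqI[of _ _ "(0, j, t)"])
            ultimately show ?thesis by blast
          qed
        qed
      qed
      have "y mod 5 = int d5 mod 5" if "k5 = 0"
        using k5(4) that unfolding lev_def by (simp add: cong_def)
      moreover have "y mod 5 = 0" if "k5 \<noteq> 0"
      proof -
        have "[y = int (d5 * 5 ^ k5)] (mod 5)"
          using k5(4) unfolding lev_def by (rule CollectE) (erule cong_dvd_modulus, simp)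
        moreover have "[int (d5 * 5 ^ k5) = 0] (mod 5)"
          using that by (simp add: cong_0_iff)
        ultimately show ?thesis using cong_trans unfolding cong_def by simp
      qed
      ultimately have y5: "y mod 5 \<noteq> 1" "y mod 5 \<noteq> 2" using k5(2) d5 by (cases "k5 = 0"; auto)+
      consider "y mod 11 < 7" | "\<exists>i\<in>I. covers i y" | "\<forall>h<g. \<exists>i\<in>J h. covers i y"
        using cover[of y] y5 by blast
      then show ?thesis
      proof cases
        case 2
        then obtain i where i: "i \<in> I" "covers i y" by blast
        obtain v Y t where "(v, Y, t) \<in> expand q5 q7 i" "y \<in> Y" using cov[OF i(2) wfI[OF i(1)]] by blast
        moreover from this have "(v, Y, t) \<in> K \<union> E" using i(1) unfolding E_def by blast
        ultimately show ?thesis by blast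
      next
        case 3
        have "\<exists>(v, Y, t)\<in>W h. y \<in> Y" if h: "h < g" for h
        proof -
          obtain i where i: "i \<in> J h" "covers i y" using 3 h by blast
          obtain v Y t where "(v, Y, t) \<in> expand q5 q7 i" "y \<in> Y" using cov[OF i(2) wfJ[OF h i(1)]] by blast
          moreover from this have "(v, Y, t) \<in> W h" using i(1) unfolding W_def by blast
          ultimately show ?thesis by blast
        qed
        then show ?thesis by blast
      qed blast
    qed blast
  qed
  then show ?thesis unfolding ps_def .
qed

text \<open>With at least \<open>p\<close> groups, each of the \<open>p\<close> classes modulo
  \<open>p\<close> gets a group of its own, so all remaining integers are removed and no reserve is
  left to keep.\<close>

theorem kit_covering:
  assumes kit: "kit P g B G" and p: "prime p" "p \<notin> P" "p \<le> g" "p \<noteq> 11" "p \<noteq> 2" "2 \<notin> P"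
  shows "\<exists>C :: (int \<times> int) set.
     covering_system C \<and>
     (\<forall>(r, m) \<in> C. odd m \<and> m > 1) \<and>
     card {(r, m) \<in> C. m = 11} = 7 \<and>
     (\<forall>(r, m) \<in> C. \<forall>(r', m') \<in> C. (r, m) \<noteq> (r', m') \<and> m = m' \<longrightarrow> m = 11)"
proof -
  have p1: "1 < p" using p(1) prime_gt_1_nat by blast
  define U where "U = (\<lambda>t. (p, int t, t)) ` {..<p}"
  define B' where "B' = B \<union> lift G U"
  \<comment> \<open>The one remaining group is empty and meets no integer, so the third alternative
    in \<open>kit\<close> is void and \<open>B'\<close> covers whatever the seven classes modulo 11
    miss.\<close>
  have K: "kit (P \<union> {p}) 1 B' (\<lambda>h. lift G {})"
    unfolding B'_def
  proof (rule kit_compose [OF kit])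
    show "P \<inter> {p} = {}" using p by blast
    show "finite U" unfolding U_def by simp
    show "t < g \<and> smooth {p} e \<and> 1 < e \<and> (e = 11 \<longrightarrow> t \<noteq> 0)" if "(e, s, t) \<in> U" for e s t
      using that p p1 smooth_power[of p "{p}" 1] unfolding U_def by auto
    show "s = s'" if "(e, s, t) \<in> U" "(e, s', t) \<in> U" for e s s' t
      using that unfolding U_def by auto
    fix y :: int
    have "nat (y mod int p) < p" and h: "hit y (p, int (nat (y mod int p)))"
      using p1 by (auto simp: hit_def nat_less_iff)
    then have "(p, int (nat (y mod int p)), nat (y mod int p)) \<in> U"
      unfolding U_def by (intro image_eqI[where x = "nat (y mod int p)"]) auto
    with h show "y mod 11 < 7 \<or> (\<exists>(e, s, t)\<in>U. hit y (e, s)) \<or> (\<forall>h<1. \<exists>(e, s, t)\<in>{}. hit y (e, s))"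
      by blast
  qed auto
  note fin = kitD(1)[OF K] and sm = kitD(3)[OF K] and B1 = kitD(5)[OF K]
  have "lift G {} = {}" by (simp add: lift_def)
  then have cov: "x mod 11 < 7 \<or> (\<exists>c\<in>B'. hit x c)" for x
    using kitD(7)[OF K, of x] by auto
  define C where "C = (\<lambda>i. (i, 11)) ` {0..<7} \<union> (\<lambda>(m, r). (r mod int m, int m)) ` B'"
  have odd: "odd m" if "(m, r) \<in> B'" for m r
  proof
    assume "even m"
    then have "2 \<in> P \<union> {p}" using sm[OF that] two_is_prime_nat unfolding smooth_def by blast
    then show False using p by auto
  qed
  have "{(r, m) \<in> C. m = 11} = (\<lambda>i. (i, 11)) ` {0..<7}"
    unfolding C_def using sm by auto
  then have "card {(r, m) \<in> C. m = 11} = 7"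
    by (simp add: card_image inj_on_def)
  moreover have "covering_system C"
    unfolding covering_system_def
  proof (intro conjI allI)
    show "finite C" unfolding C_def using fin by auto
    show "\<forall>(r, m)\<in>C. 0 \<le> r \<and> r < m" unfolding C_def using sm by fastforce
    fix x :: int
    consider "x mod 11 < 7" | "\<exists>c\<in>B'. hit x c" using cov by blast
    then show "\<exists>(r, m)\<in>C. [x = r] (mod m)"
    proof cases
      case 1
      then have "(x mod 11, 11) \<in> C" unfolding C_def by simp
      then show ?thesis by (metis (mono_tags, lifting) case_prodI cong_mod_right cong_refl)
    next
      case 2
      then obtain m r where "(m, r) \<in> B'" "[x = r] (mod int m)" unfolding hit_def by auto
      then have "(r mod int m, int m) \<in> C" "[x = r mod int m] (mod int m)" unfolding C_def by force+
      then show ?thesis by blast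
    qed
  qed
  moreover have "\<forall>(r, m)\<in>C. odd m \<and> m > 1"
    unfolding C_def using odd sm by fastforce
  moreover have "\<forall>(r, m)\<in>C. \<forall>(r', m')\<in>C. (r, m) \<noteq> (r', m') \<and> m = m' \<longrightarrow> m = 11"
    unfolding C_def using B1 by fastforce
  ultimately show ?thesis by blast
qed

lemma kit_two: "\<exists>B G. kit {3, 83} 2 B G"
proof -
  have "prime (3 :: nat)" "prime (83 :: nat)" by simp_all
  then have "\<exists>B G. kit ({} \<union> {3, 83}) (Suc 1) B G"
    by (intro kit_Suc[OF kit_one]) simp_all
  then show ?thesis by (simp add: numeral_2_eq_2)
qed

section \<open>Digit conditions and paths\<close>

text \<open>The base \<open>p\<close> expansion of \<open>y\<close> begins with the given digits,
  least significant first. As \<open>div\<close> rounds down, negative integers are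
  included.\<close>

fun md :: "nat \<Rightarrow> nat list \<Rightarrow> int \<Rightarrow> bool" where
  "md p [] y = True"
| "md p (d # ds) y = (nat (y mod int p) = d \<and> md p ds (y div int p))"

fun mt :: "nat list \<Rightarrow> nat list list \<Rightarrow> int \<Rightarrow> bool" where
  "mt (p # ps) (b # bs) y = (md p b y \<and> mt ps bs y)"
| "mt _ _ y = True"

lemma md_cong: "0 < p \<Longrightarrow> md p ds y \<Longrightarrow> md p ds z \<Longrightarrow> [y = z] (mod int (p ^ length ds))"
proof (induction ds arbitrary: y z)
  case (Cons d ds)
  have "nat (y mod int p) = nat (z mod int p)" using Cons.prems by simp
  then have m: "y mod int p = z mod int p" using Cons.prems(1) by (simp add: eq_nat_nat_iff)
  have "int (p ^ length ds) dvd y div int p - z div int p"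
    using Cons by (simp add: cong_iff_dvd_diff)
  then have "int p * int (p ^ length ds) dvd int p * (y div int p - z div int p)"
    by (rule mult_dvd_mono[OF dvd_refl])
  moreover have "y - z = int p * (y div int p - z div int p)"
  proof -
    have "y - z = (y - y mod int p) - (z - z mod int p)" using m by simp
    then show ?thesis by (simp only: minus_mod_eq_mult_div right_diff_distrib)
  qed
  ultimately show ?case by (simp add: cong_iff_dvd_diff)
qed (simp add: cong_def)

lemma mt_cong:
  "list_all prime ps \<Longrightarrow> length bs = length ps \<Longrightarrow> mt ps bs y \<Longrightarrow> mt ps bs z \<Longrightarrow>
   list_all2 (\<lambda>p k. [y = z] (mod int (p ^ k))) ps (map length bs)"
proof (induction ps arbitrary: bs)
  case (Cons p ps)
  then obtain b bs' where "bs = b # bs'" by (cases bs) auto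
  moreover have "0 < p" using Cons.prems prime_gt_0_nat by simp
  ultimately show ?case using Cons md_cong[of p b y z] by auto
qed simp

lemma cls_mt:
  "list_all prime ps \<Longrightarrow> length bs = length ps \<Longrightarrow> cls ps (map length bs) {y. mt ps bs y}"
  unfolding cls_def using mt_cong by blast

lemma mt_append: "length ps = length bs \<Longrightarrow> mt (ps @ qs) (bs @ cs) y = (mt ps bs y \<and> mt qs cs y)"
  by (induction ps bs rule: list_induct2) auto

lemma mt_nil: "mt ps (replicate n []) y"
proof (induction n arbitrary: ps)
  case (Suc n) then show ?case by (cases ps) auto
qed simp

lemma mt_unit: "k < length qs \<Longrightarrow> nat (y mod int (qs ! k)) = i \<Longrightarrow> mt qs ((replicate (length qs) [])[k := [i]]) y"
proof (induction qs arbitrary: k)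
  case (Cons q qs) then show ?case by (cases k) (auto simp: mt_nil)
qed simp

fun accp :: "nat option list \<Rightarrow> nat list \<Rightarrow> bool" where
  "accp [] ds = True"
| "accp (None # p) (d # ds) = accp p ds"
| "accp (Some a # p) (d # ds) = (if a = d then accp p ds else False)"
| "accp (_ # _) [] = False"

text \<open>Trailing wildcards are dropped so that a path becomes \<open>[]\<close> as soon as its
  last prescribed digit is matched, which is what \<open>hasnil\<close> tests.\<close>

fun tidy :: "nat option \<Rightarrow> nat option list \<Rightarrow> nat option list" where
  "tidy None [] = []"
| "tidy x p = x # p"

fun strip :: "nat option list \<Rightarrow> nat option list" where
  "strip [] = []"
| "strip (x # p) = tidy x (strip p)"

fun pad :: "nat list list \<Rightarrow> nat list \<Rightarrow> nat option list" where
  "pad [] b = []"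
| "pad (_ # u) [] = None # pad u []"
| "pad (_ # u) (d # b) = Some d # pad u b"

fun pads :: "nat list list list \<Rightarrow> nat list list \<Rightarrow> nat option list" where
  "pads (u # us) (b # bs) = pad u b @ pads us bs"
| "pads _ _ = []"

fun digs :: "nat \<Rightarrow> nat list list \<Rightarrow> int \<Rightarrow> nat list" where
  "digs p [] y = []"
| "digs p (_ # u) y = nat (y mod int p) # digs p u (y div int p)"

fun digits :: "nat list \<Rightarrow> nat list list list \<Rightarrow> int \<Rightarrow> nat list" where
  "digits (p # ps) (u # us) y = digs p u y @ digits ps us y"
| "digits _ _ y = []"

lemma accp_tidy: "accp (tidy x p) (d # ds) \<Longrightarrow> accp (x # p) (d # ds)"
  by (cases x; cases p) auto

lemma accp_strip: "length ds = length p \<Longrightarrow> accp (strip p) ds \<Longrightarrow> accp p ds"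
proof (induction p arbitrary: ds)
  case (Cons x p)
  then obtain d ds' where d: "ds = d # ds'" by (cases ds) auto
  then have "accp (x # strip p) (d # ds')" using Cons.prems accp_tidy by simp
  then show ?case using Cons d by (cases x) (auto split: if_splits)
qed simp

lemma accp_append: "length p = length ds \<Longrightarrow> accp (p @ p') (ds @ ds') = (accp p ds \<and> accp p' ds')"
proof (induction p ds rule: list_induct2)
  case (Cons x p d ds) then show ?case by (cases x) auto
qed simp

lemma length_pad [simp]: "length (pad u b) = length u"
  by (induction u b rule: pad.induct) auto

lemma length_digs [simp]: "length (digs p u y) = length u"
  by (induction u arbitrary: y) auto

lemma accp_pad: "length b \<le> length u \<Longrightarrow> accp (pad u b) (digs p u y) \<Longrightarrow> md p b y"
  by (induction u b arbitrary: y rule: pad.induct) (auto split: if_splits)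

lemma accp_pads:
  "length bs = length ps \<Longrightarrow> length us = length ps \<Longrightarrow> list_all2 (\<lambda>b u. length b \<le> length u) bs us \<Longrightarrow>
   accp (pads us bs) (digits ps us y) \<Longrightarrow> mt ps bs y"
proof (induction ps arbitrary: bs us)
  case (Cons p ps)
  then obtain b bs' u us' where "bs = b # bs'" "us = u # us'" by (cases bs; cases us) auto
  then show ?case using Cons by (auto simp: accp_append dest: accp_pad)
qed simp

lemma length_pads: "length bs = length ps \<Longrightarrow> length us = length ps \<Longrightarrow> length (digits ps us y) = length (pads us bs)"
proof (induction ps arbitrary: bs us)
  case (Cons p ps)
  then obtain b bs' u us' where "bs = b # bs'" "us = u # us'" by (cases bs; cases us) auto
  then show ?case using Cons by auto
qed (simp add: digits.simps)

section \<open>The search for uncovered digit strings\<close>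

text \<open>
  A path prescribes digits of a mixed-radix expansion, \<open>None\<close> being a wildcard. The search is programmed
  without \<open>if\<close> because the simplifier traverses the chosen branch of a conditional again,
  whereas arguments matched by a pattern are not revisited.
\<close>

fun sel :: "bool \<Rightarrow> 'a \<Rightarrow> 'a list \<Rightarrow> 'a list" where
  "sel True x xs = xs"
| "sel False x xs = x # xs"

fun step :: "nat \<Rightarrow> nat option list list \<Rightarrow> nat option list list" where
  "step d [] = []"
| "step d ([] # L) = [] # step d L"
| "step d ((None # p) # L) = p # step d L"
| "step d ((Some a # p) # L) = sel (a \<noteq> d) p (step d L)"

fun hasnil :: "nat option list list \<Rightarrow> bool" where
  "hasnil [] = False"
| "hasnil ([] # L) = True"
| "hasnil ((_ # _) # L) = hasnil L"

fun trim :: "nat option list list list \<Rightarrow> nat option list list list" where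
  "trim [] = []"
| "trim (G # Gs) = sel (hasnil G) G (trim Gs)"

fun steps :: "nat \<Rightarrow> nat option list list list \<Rightarrow> nat option list list list" where
  "steps d [] = []"
| "steps d (G # Gs) = step d G # steps d Gs"

fun some_acc :: "bool \<Rightarrow> nat option list list \<Rightarrow> nat list \<Rightarrow> bool" where
  "some_acc True L ds = True"
| "some_acc False [] ds = False"
| "some_acc False (p # L) ds = some_acc (accp p ds) L ds"

fun all_acc :: "bool \<Rightarrow> nat option list list list \<Rightarrow> nat list \<Rightarrow> bool" where
  "all_acc False Gs ds = False"
| "all_acc True [] ds = True"
| "all_acc True (G # Gs) ds = all_acc (some_acc False G ds) Gs ds"

text \<open>Depth-first traversal of the tree of digit strings: \<open>r\<close> is the reversed
  prefix, \<open>B\<close> and \<open>Gs\<close> hold the rests of the paths compatible with it. A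
  branch is closed when a base path is completely matched or every group has such a path; a leaf
  reached with some group unmatched is a hole. The flag anticipates the test on \<open>B\<close> so
  that patterns can decide.\<close>

fun holes :: "bool \<Rightarrow> nat list list \<Rightarrow> nat option list list \<Rightarrow>
    nat option list list list \<Rightarrow> nat list \<Rightarrow> nat list list" where
  "holes True us B Gs r = []"
| "holes False us B [] r = []"
| "holes False [] B (G # Gs) r = [rev r]"
| "holes False ([] # us) B (G # Gs) r = []"
| "holes False ((d # u) # us) B (G # Gs) r =
     holes (hasnil (step d B)) us (step d B) (trim (steps d (G # Gs))) (d # r) @
     holes False (u # us) B (G # Gs) r"

text \<open>A hole is disposed of by a patch only if every list of the patch accepts it, because
  each list is responsible for one class modulo the patch prime.\<close>

fun sieve :: "nat option list list list \<Rightarrow> nat list list \<Rightarrow> nat list list" where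
  "sieve P [] = []"
| "sieve P (l # ls) = sel (all_acc True P l) l (sieve P ls)"

fun sieves :: "nat option list list list list \<Rightarrow> nat list list \<Rightarrow> nat list list" where
  "sieves [] ls = ls"
| "sieves (P # Ps) ls = sieves Ps (sieve P ls)"

definition acc :: "nat option list list \<Rightarrow> nat list \<Rightarrow> bool" where
  "acc L ds \<longleftrightarrow> (\<exists>p\<in>set L. accp p ds)"

lemma sel_if: "sel c x xs = (if c then xs else x # xs)"
  by (cases c) auto

lemma some_acc: "some_acc c L ds = (c \<or> acc L ds)"
  by (induction c L ds rule: some_acc.induct) (auto simp: acc_def)

lemma all_acc: "all_acc c Gs ds = (c \<and> (\<forall>G\<in>set Gs. acc G ds))"
  by (induction c Gs ds rule: all_acc.induct) (auto simp: some_acc)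

lemma acc_step: "acc (step d L) ds \<Longrightarrow> acc L (d # ds)"
  by (induction d L rule: step.induct) (auto simp: acc_def sel_if split: if_splits)

lemma acc_hasnil: "hasnil L \<Longrightarrow> acc L ds"
  by (induction L rule: hasnil.induct) (auto simp: acc_def)

lemma acc_trim: "(\<forall>G\<in>set (trim Gs). acc G ds) \<longleftrightarrow> (\<forall>G\<in>set Gs. acc G ds)"
  by (induction Gs) (auto simp: sel_if acc_hasnil)

lemma set_steps: "set (steps d Gs) = step d ` set Gs"
  by (induction Gs) auto

text \<open>Following the string \<open>ds\<close> through the tree, only two events end the descent
  early, and they are the first two alternatives. Nothing is claimed about the strings that are
  reported.\<close>

lemma holes_sound:
  "list_all2 (\<lambda>d u. d \<in> set u) ds us \<Longrightarrow> (c \<Longrightarrow> acc B ds) \<Longrightarrow>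
     acc B ds \<or> (\<forall>G\<in>set Gs. acc G ds) \<or> rev r @ ds \<in> set (holes c us B Gs r)"
proof (induction c us B Gs r arbitrary: ds rule: holes.induct)
  case (5 d u us B G Gs r)
  then obtain d' ds' where ds: "ds = d' # ds'" "d' \<in> set (d # u)" "list_all2 (\<lambda>d u. d \<in> set u) ds' us"
    by (cases ds) auto
  show ?case
  proof (cases "d' = d")
    case True
    have "acc (step d B) ds' \<or> (\<forall>G\<in>set (trim (steps d (G # Gs))). acc G ds') \<or>
        rev (d # r) @ ds' \<in> set (holes (hasnil (step d B)) us (step d B) (trim (steps d (G # Gs))) (d # r))"
      by (rule "5.IH"(1)[OF ds(3)]) (rule acc_hasnil)
    then show ?thesis
      unfolding acc_trim set_steps using acc_step True ds(1) by fastforce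
  next
    case False
    then have "list_all2 (\<lambda>d u. d \<in> set u) ds (u # us)" using ds by simp
    from "5.IH"(2)[OF this] show ?thesis by auto
  qed
qed (auto simp: list_all2_Cons2)

lemma sieve_sound: "l \<in> set ls \<Longrightarrow> \<not> (\<forall>G\<in>set P. acc G l) \<Longrightarrow> l \<in> set (sieve P ls)"
  by (induction ls) (auto simp: sel_if all_acc)

lemma sieves_sound: "l \<in> set ls \<Longrightarrow> (\<And>P. P \<in> set Ps \<Longrightarrow> \<not> (\<forall>G\<in>set P. acc G l)) \<Longrightarrow> l \<in> set (sieves Ps ls)"
proof (induction Ps arbitrary: ls)
  case (Cons P Ps)
  then have "l \<in> set (sieve P ls)" by (intro sieve_sound) auto
  then show ?case using Cons by simp
qed simp

lemma search_sound:
  assumes "sieves Ps (holes False us B (trim Gs) []) = []" "list_all2 (\<lambda>d u. d \<in> set u) ds us"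
  shows "acc B ds \<or> (\<forall>G\<in>set Gs. acc G ds) \<or> (\<exists>P\<in>set Ps. \<forall>G\<in>set P. acc G ds)"
proof (rule ccontr)
  assume neg: "\<not> ?thesis"
  then have "ds \<in> set (holes False us B (trim Gs) [])"
    using holes_sound[OF assms(2), of False B "trim Gs" "[]"] by (auto simp: acc_trim)
  then have "ds \<in> set (sieves Ps (holes False us B (trim Gs) []))"
    by (rule sieves_sound) (use neg in blast)
  then show False using assms(1) by simp
qed

fun path :: "nat list list list \<Rightarrow> nat \<times> nat list list \<Rightarrow> nat option list" where
  "path us (s, bs) = strip (pads us bs)"

text \<open>A base 3 numeral of the exponents with the slot on top; digit lists in the data have
  length at most 2. Distinct keys show distinct vectors or slots, and for this it suffices that
  \<open>code\<close> depends on the lengths and the slot only.\<close>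

fun code :: "nat list list \<Rightarrow> nat \<Rightarrow> nat" where
  "code [] s = s"
| "code (b # bs) s = length b + 3 * code bs s"

fun key :: "nat \<times> nat list list \<Rightarrow> nat" where
  "key (s, bs) = code bs s"

text \<open>A form of distinctness that rewrites to comparisons of numerals, without sets.\<close>

fun fresh :: "nat \<Rightarrow> nat list \<Rightarrow> bool" where
  "fresh x [] = True"
| "fresh x (y # ys) = (x \<noteq> y \<and> fresh x ys)"

fun dist :: "nat list \<Rightarrow> bool" where
  "dist [] = True"
| "dist (x # xs) = (fresh x xs \<and> dist xs)"

lemma fresh: "fresh x xs = (x \<notin> set xs)"
  by (induction xs) auto

lemma dist: "dist xs = distinct xs"
  by (induction xs) (auto simp: fresh)

lemma code_cong: "map length bs = map length cs \<Longrightarrow> code bs s = code cs s"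
proof (induction bs arbitrary: cs)
  case (Cons b bs)
  then obtain c cs' where cs: "cs = c # cs'" by (cases cs) auto
  show ?case using Cons.IH[of cs'] Cons.prems unfolding cs by simp
qed simp

text \<open>A single check on the concatenation shows both that no list repeats a key and that
  different lists have no key in common.\<close>

lemma distinct_concat_map:
  "distinct (map f (concat xss)) \<Longrightarrow> i < length xss \<Longrightarrow> j < length xss \<Longrightarrow> x \<in> set (xss ! i) \<Longrightarrow>
   y \<in> set (xss ! j) \<Longrightarrow> f x = f y \<Longrightarrow> i = j \<and> x = y"
proof (induction xss arbitrary: i j)
  case (Cons xs xss)
  have dj: "f ` set xs \<inter> f ` set (concat xss) = {}" "inj_on f (set xs)" "distinct (map f (concat xss))"
    using Cons.prems(1) by (auto simp: distinct_map inj_on_Un)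
  have mem: "z \<in> set (concat xss)" if "k < length xss" "z \<in> set (xss ! k)" for k z
    using that by auto
  show ?case
  proof (cases i; cases j)
    fix k l assume "i = Suc k" "j = Suc l"
    then show ?thesis using Cons.IH[OF dj(3), of k l] Cons.prems by simp
  next
    assume "i = 0" "j = 0"
    then show ?thesis using Cons.prems dj(2) by (auto dest: inj_onD)
  next
    fix l assume "i = 0" "j = Suc l"
    then have "x \<in> set xs" "y \<in> set (concat xss)"
      using Cons.prems mem[of l y] by simp_all
    then show ?thesis using dj(1) Cons.prems(6) by (metis IntI empty_iff imageI)
  next
    fix k assume "i = Suc k" "j = 0"
    then have "y \<in> set xs" "x \<in> set (concat xss)"
      using Cons.prems mem[of k x] by simp_all
    then show ?thesis using dj(1) Cons.prems(6) by (metis IntI empty_iff imageI)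
  qed
qed simp

lemma units_eq:
  assumes "k < n" "l < n"
    "map length ((replicate n [])[k := [i :: nat]]) = map length ((replicate n [])[l := [j :: nat]])"
  shows "k = l"
proof (rule ccontr)
  assume "k \<noteq> l"
  moreover have "map length ((replicate n [])[k := [i]]) ! k = map length ((replicate n [])[l := [j]]) ! k"
    using assms(3) by simp
  ultimately show False using assms(1,2) by simp
qed

lemma units_neq: "k < n \<Longrightarrow> 1 \<in> set (map length ((replicate n [])[k := [i :: nat]]))"
  by (simp add: map_update set_update_memI)

lemma path_sound:
  assumes "accp (path us (s, bs)) (digits ps us y)" "length bs = length ps" "length us = length ps"
    "list_all2 (\<lambda>b u. length b \<le> length u) bs us"
  shows "mt ps bs y"
proof (rule accp_pads[OF assms(2-4)])
  show "accp (pads us bs) (digits ps us y)"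
    using assms accp_strip length_pads by simp
qed

section \<open>Data for 5, 7, 11, 13, 17 and the patches\<close>

text \<open>
  The data were found by a computer search. An entry consists of the slot \<open>s\<close> and, for each of the primes
  5, 7, 11, 13, 17, the digits prescribed by the congruence, least significant first.
\<close>

definition base0 :: "(nat \<times> nat list list) list" where
 "base0 =
[(0,[[],[],[],[],[0]]), (1,[[],[],[],[],[1]]), (0,[[],[1],[],[],[]]), (1,[[],[2],[],[],[]]),
(1,[[],[],[7],[],[]]), (0,[[],[],[],[0],[]]), (1,[[],[],[],[1],[]]), (0,[[3],[3],[],[],[]]),
(1,[[3],[5],[],[],[]]), (0,[[4],[],[10],[],[]]), (1,[[4],[],[8],[],[]]), (0,[[3],[],[],[2],[]]),
(1,[[3],[],[],[5],[]]), (0,[[],[6],[9],[],[]]), (1,[[],[4],[9],[],[]]), (0,[[3],[],[],[],[5]]),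
(1,[[3],[],[],[],[12]]), (0,[[],[6],[],[4],[]]), (1,[[],[6],[],[3],[]]), (0,[[],[4],[],[],[16]]),
(1,[[],[4],[],[],[11]]), (0,[[],[],[10,0],[],[]]), (1,[[],[],[10,6],[],[]]), (0,[[],[],[8],[7],[]]),
(1,[[],[],[10],[12],[]]), (0,[[],[],[8],[],[8]]), (1,[[],[],[8],[],[10]]), (0,[[],[],[],[4],[4]]),
(1,[[],[],[],[3],[4]]), (0,[[4],[5],[9],[],[]]), (1,[[4],[3],[9],[],[]]), (0,[[3],[6],[],[11],[]]),
(1,[[3],[6],[],[6],[]]), (0,[[3],[4],[],[],[15]]), (1,[[3],[4],[],[],[6]]), (0,[[3],[],[10,3],[],[]]),
(1,[[3],[],[10,8],[],[]]), (0,[[3],[],[10],[7],[]]), (1,[[3],[],[10],[8],[]]), (0,[[],[4],[10,2],[],[]]),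
(1,[[],[4],[10,7],[],[]]), (0,[[3],[],[8],[],[7]]), (1,[[3],[],[8],[],[3]]), (0,[[],[6],[8],[8],[]]),
(1,[[],[6],[8],[10],[]]), (0,[[3],[],[],[6],[4]]), (1,[[3],[],[],[10],[4]]), (0,[[],[4],[8],[],[9]]),
(1,[[],[4],[8],[],[13]]), (0,[[],[4],[],[9],[4]]), (1,[[],[4],[],[11],[4]]), (0,[[],[],[10,10],[3],[]]),
(1,[[],[],[10,10],[4],[]]), (0,[[],[],[10,4],[],[9]]), (1,[[],[],[10,4],[],[13]]), (0,[[],[],[8],[8],[4]]),
(1,[[],[],[8],[12],[4]]), (0,[[3],[4],[10,1],[],[]]), (1,[[3],[4],[10,9],[],[]]), (0,[[3],[6],[8],[12],[]]),
(1,[[3],[6],[10],[10],[]]), (0,[[3],[4],[8],[],[14]]), (1,[[3],[4],[8],[],[2]]), (0,[[3],[0],[],[10],[6]]),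
(1,[[3],[0],[],[3],[15]]), (0,[[3],[],[10,10],[10],[]]), (1,[[3],[],[10,5],[3],[]]),
(0,[[3],[],[10,4],[],[10]]), (1,[[3],[],[10,4],[],[7]]), (0,[[],[4],[10,10],[6],[]]),
(1,[[],[4],[10,10],[11],[]]), (0,[[3],[],[8],[6],[15]]), (1,[[3],[],[8],[6],[6]]), (0,[[],[4],[10,4],[],[8]]),
(1,[[],[4],[10,4],[],[2]]), (0,[[],[0],[8],[8],[6]]), (1,[[],[0],[8],[4],[15]]), (0,[[],[],[10,4],[3],[3]]),
(1,[[],[],[10,2],[3],[16]]), (0,[[3],[0],[10,7],[4],[]]), (1,[[3],[0],[10,2],[4],[]]),
(0,[[0],[4],[8,9],[],[2]]), (1,[[3],[4],[10,4],[],[14]]), (0,[[3],[0],[8],[4],[6]]),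
(1,[[3],[0],[8],[8],[15]]), (0,[[3],[],[10,4],[4],[3]]), (1,[[3],[],[10,4],[10],[3]]),
(0,[[],[4],[10,4],[11],[3]]), (1,[[],[0],[10,4],[4],[15]]), (0,[[3],[0],[10,4],[4],[16]]),
(1,[[3],[4],[10,4],[6],[3]]), (2,[[],[5],[],[],[]]), (2,[[],[],[10],[],[]]), (2,[[],[],[],[12],[]]),
(2,[[],[],[],[],[3]]), (2,[[],[3],[9],[],[]]), (2,[[],[6],[],[11],[]]), (2,[[],[4],[],[],[15]]),
(2,[[],[],[8,8],[],[]]), (2,[[],[],[8],[5],[]]), (2,[[],[],[8],[],[6]]), (2,[[],[],[],[8],[7]]),
(2,[[],[4],[8,10],[],[]]), (2,[[],[6],[8],[2],[]]), (2,[[],[4],[8],[],[5]]), (2,[[],[4],[],[3],[7]]),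
(2,[[],[],[8,0],[10],[]]), (2,[[],[],[8,2],[],[2]]), (2,[[],[],[8],[4],[7]]), (2,[[],[4],[8,0],[2],[]]),
(2,[[],[4],[8,6],[],[2]]), (2,[[],[4],[8],[11],[7]]), (2,[[],[],[8,6],[10],[7]]), (2,[[],[4],[8,3],[3],[2]]),
(3,[[],[],[9],[],[]]), (3,[[],[],[],[11],[]]), (3,[[],[],[],[],[14]]), (3,[[],[],[10,1],[],[]]),
(3,[[],[],[10],[6],[]]), (3,[[],[],[8],[],[16]]), (3,[[],[],[],[3],[6]]), (3,[[],[],[10,9],[4],[]]),
(3,[[],[],[10,4],[],[8]]), (3,[[],[],[8],[12],[15]]), (3,[[],[],[10,2],[3],[7]])]"

text \<open>The first two lists carry the old groups over. In the last two, the entries of slot 3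
  and of slot 2 without any digits admit all surviving multiples of 7 and of 5, respectively, by one
  chain each.\<close>

definition groups0 :: "(nat \<times> nat list list) list list" where
 "groups0 =
[[(0,[[],[],[],[],[]])], [(1,[[],[],[],[],[]])], [(0,[[],[],[],[9],[]]), (0,[[3],[],[10,5],[],[]]),
(0,[[],[],[8,2],[],[14]]), (0,[[],[4],[8,5],[],[14]]), (2,[[],[3],[],[],[]]), (2,[[],[],[],[6],[]]),
(2,[[],[],[],[],[12]]), (2,[[],[],[8,5],[],[2]]), (2,[[],[4],[8,3],[3],[2]]), (3,[[],[],[8],[],[]])],
[(0,[[],[],[8],[],[]]), (0,[[],[],[10],[9],[]]), (0,[[],[4],[],[10],[8]]), (0,[[],[],[10,5],[4],[]]),
(0,[[3],[4],[10,5],[],[9]]), (3,[[],[],[10],[10],[]])], [(1,[[],[],[8],[],[]]), (0,[[3],[],[10],[9],[]]),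
(1,[[],[],[10,5],[4],[]]), (0,[[3],[],[10,5],[10],[]]), (0,[[3],[4],[10,5],[11],[9]])],
[(1,[[],[],[],[9],[]]), (0,[[],[0],[8],[],[]]), (0,[[0],[3],[8],[],[]]), (0,[[0],[],[],[6],[4]]),
(1,[[],[],[8,2],[],[14]]), (0,[[0],[6],[8],[6],[]]), (1,[[3],[],[10,5],[4],[]]), (0,[[3],[],[10],[10],[10]]),
(1,[[],[4],[8,5],[],[14]]), (0,[[3],[4],[10,5],[11],[]]), (1,[[0],[4],[8,5],[],[2]]),
(0,[[],[4],[10,5],[10],[8]]), (1,[[],[4],[10,5],[10],[9]]), (2,[[],[],[8],[],[12]]),
(2,[[],[],[8,5],[6],[7]]), (3,[[],[],[10,5],[10],[]])], [(0,[[0],[],[8],[],[]]), (0,[[3],[],[],[],[13]]),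
(0,[[],[],[],[9],[4]]), (0,[[3],[0],[],[],[2]]), (1,[[3],[0],[],[],[11]]), (1,[[3],[],[10,5],[],[]]),
(1,[[3],[],[10],[9],[]]), (0,[[3],[],[8],[],[9]]), (1,[[3],[],[],[9],[15]]), (1,[[],[6],[],[9],[11]]),
(0,[[],[],[8],[9],[6]]), (1,[[3],[],[8],[12],[6]]), (0,[[],[6],[8],[9],[16]]), (1,[[],[6],[8],[9],[14]]),
(0,[[3],[6],[8],[9],[2]]), (3,[[],[],[],[10],[15]])], [(0,[[],[0],[],[],[]]), (1,[[0],[3],[8],[],[]]),
(0,[[],[4],[10,5],[],[]]), (0,[[],[6],[10],[9],[]]), (1,[[],[6],[8],[9],[]]), (0,[[0],[4],[8],[],[12]]),
(2,[[],[6],[],[6],[]]), (2,[[],[],[],[6],[4]]), (2,[[],[4],[8,5],[],[]]), (2,[[],[4],[],[9],[7]]),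
(2,[[],[4],[8,3],[3],[]]), (2,[[],[4],[8,2],[],[14]])], [(0,[[0],[],[],[],[]]), (0,[[3],[0],[],[],[]]),
(0,[[3],[6],[],[9],[]]), (0,[[3],[4],[10,5],[],[]])], [(1,[[3],[0],[],[],[]]), (1,[[0],[],[8],[],[]]),
(1,[[3],[6],[],[9],[]]), (1,[[],[4],[10,5],[],[]])], [(0,[[],[],[],[],[2]]), (0,[[],[6],[],[9],[]]),
(0,[[],[0],[],[],[9]]), (0,[[],[],[10,5],[],[]]), (0,[[],[],[8],[],[13]]), (1,[[],[],[],[10],[15]]),
(0,[[3],[0],[],[12],[6]]), (2,[[],[],[8],[],[]]), (3,[[],[],[],[9],[]]), (3,[[],[],[],[],[11]])],
[(1,[[0],[],[],[],[]]), (0,[[3],[],[],[9],[]]), (1,[[],[0],[],[],[11]]), (1,[[],[],[10,5],[],[]]),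
(1,[[],[],[8],[],[13]]), (1,[[3],[],[8],[],[2]]), (0,[[],[0],[8],[],[9]]), (1,[[3],[0],[8],[12],[6]]),
(3,[[],[],[10,4],[],[6]]), (3,[[],[],[8],[10],[15]])], [(1,[[],[0],[],[],[]]), (1,[[],[3],[8],[],[]]),
(1,[[],[6],[],[9],[]]), (0,[[0],[],[8,2],[],[14]]), (0,[[],[4],[10,5],[9],[]]), (1,[[],[4],[10,5],[4],[]]),
(0,[[],[],[10,5],[10],[7]]), (0,[[3],[],[10,5],[10],[9]]), (1,[[3],[],[10,5],[10],[8]]),
(1,[[3],[4],[10,5],[11],[9]]), (2,[[],[],[8,5],[],[]]), (2,[[],[6],[8],[6],[]]), (2,[[],[4],[8],[],[12]]),
(2,[[],[],[8],[9],[7]]), (2,[[],[4],[8],[6],[4]])], [(1,[[],[],[8],[9],[]]), (1,[[],[4],[8],[],[12]]),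
(1,[[3],[4],[10,5],[],[]]), (1,[[3],[6],[10],[9],[]]), (1,[[0],[],[8,5],[],[2]]), (2,[[],[3],[8],[],[]]),
(2,[[],[4],[],[],[14]]), (2,[[],[],[8],[6],[]]), (2,[[],[],[8,3],[3],[]]), (3,[[],[],[],[],[]])],
[(1,[[],[],[],[],[11]]), (1,[[3],[],[],[9],[]]), (1,[[3],[],[],[],[9]]), (1,[[],[],[8],[12],[6]]),
(1,[[3],[0],[8],[],[13]]), (1,[[3],[0],[],[10],[15]]), (1,[[],[],[10,5],[10],[8]]),
(1,[[3],[4],[10,5],[4],[]]), (2,[[],[],[],[],[]]), (3,[[],[],[10,5],[],[]]), (3,[[],[],[8],[],[2]]),
(3,[[],[],[10,4],[4],[6]])]]"

text \<open>The list at position \<open>i\<close> belongs to the class \<open>i\<close> modulo 31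
  and has to hit every hole treated by the patch. Keys are distinct across all lists of the patch
  since all its moduli contain the same factor 31. The patches for 73 and 79 have one entry per list
  and so treat one residue class each.\<close>

definition patch31 :: "(nat \<times> nat list list) list list" where
 "patch31 =
[[(0,[[],[],[],[],[]])], [(1,[[],[],[],[],[]])], [(0,[[0],[],[],[],[]]), (0,[[3],[],[10,7],[],[16]]),
(0,[[],[0],[10,2],[10],[16]])], [(0,[[],[],[8,4],[],[]]), (0,[[0],[],[8,3],[],[]]), (1,[[0],[],[8,7],[],[]]),
(0,[[],[4],[8,6],[],[]]), (1,[[],[4],[8,0],[],[]]), (0,[[0],[4],[8,1],[],[]]), (0,[[0],[],[8,2],[10],[]]),
(0,[[],[0],[10],[10],[16]]), (0,[[0],[4],[8,2],[],[7]]), (0,[[0],[4],[8,5],[2],[7]]),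
(2,[[],[4],[8,9],[],[]]), (2,[[],[4],[8,5],[10],[]]), (2,[[],[],[8,5],[2],[4]]), (2,[[],[4],[8,2],[2],[4]])],
[(0,[[],[],[8],[],[]]), (3,[[],[],[10],[10],[]])], [(0,[[],[],[],[],[2]]), (0,[[],[4],[],[2],[]]),
(0,[[],[],[8],[6],[]]), (0,[[0],[],[8],[],[14]]), (0,[[],[],[10,2],[],[16]]), (1,[[3],[0],[10,7],[],[]]),
(2,[[],[4],[8],[10],[]])], [(0,[[],[],[10,2],[10],[]]), (2,[[],[4],[8],[],[]]), (3,[[],[],[10,7],[],[]])],
[(0,[[0],[],[],[],[2]]), (1,[[],[],[8],[10],[]]), (0,[[],[],[8],[],[14]]), (0,[[0],[4],[],[6],[7]]),
(0,[[0],[4],[8],[2],[4]]), (2,[[],[4],[8],[2],[7]]), (3,[[],[],[10],[10],[16]])], [(0,[[],[4],[],[],[]]),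
(1,[[3],[0],[10],[10],[16]])], [(0,[[],[0],[10,2],[],[16]]), (2,[[],[],[],[],[]]),
(3,[[],[],[10,7],[10],[]])], [(1,[[],[4],[],[10],[]]), (0,[[0],[4],[],[],[2]]), (0,[[0],[4],[8],[],[14]]),
(1,[[],[4],[8],[6],[7]]), (2,[[],[],[],[2],[]]), (2,[[],[],[8,0],[],[2]]), (3,[[],[],[],[10],[]])],
[(1,[[0],[],[8],[],[14]]), (0,[[],[4],[8],[2],[]]), (0,[[],[4],[],[10],[4]]), (0,[[3],[0],[10,7],[10],[]]),
(1,[[],[0],[10,2],[10],[16]]), (2,[[],[4],[],[6],[]]), (2,[[],[4],[],[],[2]]), (2,[[],[],[8],[10],[7]])],
[(0,[[0],[4],[8],[],[]]), (1,[[],[],[10,7],[10],[]]), (1,[[3],[],[10,2],[],[16]])], [(0,[[],[],[],[10],[]]),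
(0,[[0],[],[],[6],[7]]), (0,[[],[4],[8],[],[14]]), (2,[[],[],[8],[2],[]]), (2,[[],[4],[8],[],[2]])],
[(0,[[0],[4],[],[],[]]), (1,[[3],[0],[],[10],[16]])], [(0,[[],[],[10],[10],[16]]), (2,[[],[4],[],[],[]])],
[(1,[[0],[4],[],[],[]]), (0,[[3],[],[10],[10],[16]])], [(2,[[],[],[8],[],[]]), (3,[[],[],[10],[],[16]])],
[(1,[[],[],[],[10],[]]), (1,[[],[],[],[],[14]]), (1,[[],[4],[8],[2],[]]), (1,[[0],[],[8],[6],[7]]),
(2,[[],[],[],[],[2]])], [(1,[[],[],[8],[],[]]), (1,[[],[],[10,2],[],[16]]), (0,[[],[0],[10,7],[10],[]])],
[(0,[[0],[],[],[2],[]]), (1,[[0],[4],[],[],[2]]), (0,[[3],[],[10],[10],[]]), (1,[[],[4],[8],[],[14]]),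
(1,[[],[],[8],[6],[7]]), (0,[[0],[4],[8],[10],[]])], [(1,[[0],[],[],[],[14]]), (1,[[],[],[8],[],[2]]),
(0,[[],[],[],[6],[7]]), (1,[[0],[],[8],[2],[]]), (1,[[0],[4],[8],[10],[]]), (1,[[],[0],[10,2],[],[16]]),
(0,[[3],[],[10,7],[10],[16]])], [(0,[[],[4],[],[],[14]]), (1,[[],[],[],[2],[4]]), (0,[[0],[4],[],[10],[]]),
(1,[[],[4],[],[2],[7]]), (1,[[0],[4],[8],[],[2]]), (0,[[],[],[10,2],[10],[16]]), (2,[[],[4],[],[6],[7]]),
(3,[[],[],[10,7],[10],[16]])], [(0,[[0],[],[8],[],[]]), (3,[[],[],[10],[],[]])], [(1,[[0],[],[],[10],[]]),
(1,[[],[4],[],[],[14]]), (1,[[0],[4],[],[2],[]]), (1,[[3],[],[10,7],[10],[]]), (1,[[3],[0],[10,2],[10],[]]),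
(2,[[],[],[8],[],[2]]), (2,[[],[],[],[6],[7]])], [(1,[[],[4],[],[],[]]), (3,[[],[],[],[],[]])],
[(1,[[0],[],[],[],[]]), (1,[[3],[0],[10,2],[],[16]]), (1,[[3],[],[10,7],[10],[16]])], [(0,[[],[4],[8],[],[]]),
(3,[[],[],[],[10],[16]])], [(1,[[0],[],[8],[],[]]), (3,[[],[],[],[],[16]])], [(1,[[0],[4],[8],[],[]]),
(1,[[],[0],[10,2],[10],[]]), (1,[[3],[0],[10,7],[10],[16]])], [(1,[[],[4],[8],[],[]]),
(1,[[3],[],[],[10],[16]])]]"

definition patch41 :: "(nat \<times> nat list list) list list" where
 "patch41 =
[[(0,[[],[],[],[],[]])], [(1,[[],[],[],[],[]])], [(0,[[],[],[10],[],[]])], [(0,[[3],[0],[],[],[2]]),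
(0,[[3],[0],[10],[10],[]]), (0,[[3],[],[10,5],[10],[2]])], [(0,[[],[],[],[10],[]]), (3,[[],[],[],[],[2]])],
[(0,[[],[],[],[],[2]]), (0,[[],[0],[],[10],[]])], [(0,[[],[],[10,7],[],[]]), (0,[[],[0],[10,9],[],[]]),
(0,[[3],[0],[10,4],[],[]]), (0,[[3],[0],[10,2],[10],[]]), (0,[[3],[0],[10,2],[],[2]]),
(0,[[3],[4],[10],[10],[2]])], [(1,[[],[],[],[10],[]]), (0,[[],[0],[10],[],[2]])], [(1,[[],[],[10],[],[]])],
[(1,[[],[],[],[],[2]]), (0,[[],[0],[10],[10],[]])], [(0,[[],[],[10],[],[2]]), (0,[[3],[0],[],[10],[]])],
[(1,[[],[],[10,7],[],[]]), (0,[[3],[],[10,9],[],[]]), (0,[[3],[],[10],[],[2]]), (0,[[],[],[10,4],[],[15]]),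
(0,[[3],[0],[10],[],[16]]), (0,[[],[0],[10,4],[],[11]]), (3,[[],[],[10,2],[10],[]])],
[(0,[[3],[0],[10],[],[]]), (0,[[3],[],[10],[10],[2]])], [(0,[[3],[],[],[],[2]]), (0,[[],[],[10,9],[10],[]]),
(0,[[3],[],[10,2],[10],[]]), (0,[[3],[],[10,4],[],[11]]), (3,[[],[],[10,7],[],[]]), (3,[[],[],[],[10],[15]]),
(3,[[],[],[10,4],[10],[16]])], [(1,[[3],[0],[],[],[2]]), (1,[[],[0],[10,9],[],[]]),
(0,[[],[],[10],[10],[16]]), (1,[[3],[0],[10,2],[],[]]), (1,[[3],[],[10,7],[10],[]]),
(1,[[],[0],[10,4],[],[15]]), (0,[[],[],[10,4],[10],[11]]), (0,[[],[4],[10,5],[10],[2]])],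
[(1,[[3],[],[10,4],[],[]]), (1,[[],[],[10,7],[10],[]]), (0,[[3],[0],[],[3],[2]]), (1,[[3],[],[10,5],[],[2]]),
(0,[[],[0],[10,9],[10],[]]), (1,[[3],[0],[10,2],[10],[]])], [(0,[[],[0],[],[],[2]]),
(1,[[3],[4],[10],[10],[2]]), (3,[[],[],[10],[10],[]])], [(0,[[],[4],[],[10],[2]]), (3,[[],[],[],[],[]])],
[(0,[[3],[],[10],[10],[]]), (1,[[3],[0],[10],[],[2]])], [(0,[[],[0],[],[],[]]), (1,[[],[4],[],[10],[2]])],
[(0,[[3],[],[],[10],[]]), (3,[[],[],[10],[],[2]])], [(0,[[3],[0],[],[],[]]), (1,[[],[],[10],[10],[2]])],
[(0,[[3],[],[10],[],[]])], [(0,[[3],[],[],[],[]])], [(0,[[],[0],[10],[],[]]), (1,[[3],[],[10,5],[10],[2]])],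
[(1,[[],[0],[10],[],[]]), (1,[[],[4],[10,5],[10],[2]])], [(0,[[],[],[10],[10],[]]), (1,[[],[0],[10],[],[2]])],
[(1,[[3],[],[],[],[]])], [(0,[[3],[4],[10,5],[10],[2]]), (3,[[],[],[10],[],[]])], [(1,[[],[0],[],[10],[]]),
(1,[[],[],[10],[],[2]])], [(1,[[],[],[10],[10],[]]), (0,[[],[0],[10],[3],[2]]), (1,[[3],[0],[10,4],[4],[2]])],
[(1,[[3],[0],[],[10],[]]), (1,[[],[],[10,5],[],[2]]), (1,[[3],[0],[],[3],[2]]), (1,[[],[],[10,4],[4],[2]])],
[(1,[[],[0],[],[],[]]), (1,[[],[4],[10],[10],[2]])], [(0,[[],[],[],[10],[2]]), (1,[[3],[0],[10],[],[]])],
[(1,[[3],[],[10],[],[]])], [(1,[[],[0],[],[],[2]]), (1,[[],[],[],[10],[2]]), (1,[[],[0],[10],[10],[]])],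
[(1,[[3],[],[],[10],[]]), (1,[[3],[],[],[],[2]])], [(0,[[3],[],[],[4],[2]]), (1,[[],[4],[10,5],[10],[]]),
(1,[[3],[],[10],[3],[2]]), (3,[[],[],[],[10],[]])], [(1,[[3],[],[10],[10],[]]), (3,[[],[],[10,4],[],[2]]),
(3,[[],[],[10],[3],[2]])], [(1,[[3],[0],[],[],[]]), (1,[[3],[4],[10,5],[],[2]])], [(1,[[3],[],[10],[],[2]]),
(1,[[3],[0],[10],[10],[]])]]"

definition patch43 :: "(nat \<times> nat list list) list list" where
 "patch43 =
[[(0,[[],[],[],[],[]])], [(1,[[],[],[],[],[]])], [(0,[[3],[0],[10],[3],[]]), (0,[[3],[0],[10],[4],[11]])],
[(0,[[3],[],[],[3],[]]), (0,[[],[],[10,4],[4],[11]])], [(0,[[],[0],[],[],[]])], [(0,[[],[],[],[],[13]]),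
(0,[[],[0],[],[],[11]]), (0,[[],[],[],[3],[16]]), (1,[[],[],[],[3],[8]]), (0,[[3],[0],[],[],[10]]),
(0,[[3],[],[10],[],[3]]), (0,[[],[0],[10],[],[7]]), (0,[[],[0],[10],[3],[9]])], [(0,[[],[0],[10],[],[]])],
[(0,[[],[],[],[3],[]]), (0,[[3],[],[10,4],[],[11]])], [(0,[[3],[0],[],[],[]])], [(3,[[],[],[],[3],[]]),
(3,[[],[],[],[],[11]])], [(0,[[],[],[10],[],[13]]), (0,[[3],[],[],[3],[16]]), (0,[[],[0],[],[3],[11]]),
(1,[[],[0],[],[3],[9]]), (0,[[],[],[10],[3],[3]]), (0,[[3],[0],[10,4],[],[]]), (0,[[3],[0],[10],[],[8]]),
(0,[[3],[0],[],[3],[7]]), (1,[[],[0],[10],[3],[10]])], [(3,[[],[],[],[],[]])], [(1,[[],[0],[],[],[]])],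
[(1,[[],[0],[],[],[9]]), (1,[[],[],[10],[],[3]]), (1,[[3],[0],[],[],[13]]), (1,[[3],[],[10],[],[7]]),
(1,[[3],[],[],[3],[8]]), (1,[[],[0],[10],[],[11]]), (1,[[],[],[10],[3],[10]]), (1,[[3],[0],[10],[3],[16]])],
[(0,[[3],[],[10,2],[3],[]]), (1,[[3],[],[10,4],[3],[]]), (0,[[],[0],[10,9],[3],[]]),
(0,[[3],[0],[10,7],[3],[]]), (3,[[],[],[10,4],[4],[11]])], [(3,[[],[],[10],[],[]])],
[(0,[[3],[],[10,2],[],[]]), (1,[[3],[],[10,9],[],[]]), (1,[[3],[0],[10,7],[],[]]),
(1,[[3],[0],[10,4],[3],[]]), (0,[[3],[],[10,4],[4],[11]])], [(0,[[],[0],[10,9],[],[]]),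
(1,[[3],[],[10,4],[],[11]]), (1,[[],[0],[10,7],[3],[]]), (0,[[3],[0],[10,4],[],[16]]),
(3,[[],[],[10,2],[3],[]])], [(0,[[3],[0],[10],[],[]])], [(0,[[3],[],[10],[],[]])], [(0,[[3],[],[10],[3],[]]),
(3,[[],[],[10],[],[11]])], [(1,[[3],[],[10],[],[]])], [(0,[[3],[],[],[],[16]]), (0,[[],[],[10,2],[],[]]),
(1,[[],[],[10,7],[],[]]), (1,[[],[0],[10,9],[],[]]), (0,[[],[],[10,4],[],[11]])], [(1,[[],[],[],[3],[]]),
(3,[[],[],[10],[4],[11]])], [(1,[[],[0],[10],[],[]])], [(1,[[],[],[],[],[11]]), (0,[[],[0],[10],[3],[]])],
[(0,[[],[],[10],[3],[]]), (0,[[],[0],[10,4],[4],[11]])], [(1,[[3],[0],[10],[3],[]]),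
(1,[[3],[0],[10],[],[11]])], [(1,[[3],[0],[],[],[]])], [(1,[[],[0],[10],[3],[]]), (3,[[],[],[],[4],[11]])],
[(0,[[3],[],[],[],[]])], [(1,[[3],[],[],[],[11]]), (0,[[3],[0],[],[3],[]])], [(1,[[3],[],[10],[3],[]]),
(0,[[3],[],[10],[4],[11]])], [(0,[[],[],[10],[],[]])], [(1,[[],[],[10],[],[]])], [(1,[[3],[0],[],[4],[11]]),
(3,[[],[],[10],[3],[]])], [(1,[[3],[0],[],[3],[]]), (1,[[],[],[10,4],[4],[11]])], [(1,[[],[],[10],[3],[]]),
(1,[[3],[],[10],[4],[11]])], [(1,[[3],[],[],[],[]])], [(1,[[3],[0],[10],[],[]])], [(0,[[],[0],[],[3],[]]),
(1,[[3],[0],[10,4],[],[11]])], [(1,[[3],[],[],[3],[]]), (0,[[],[],[10,4],[4],[]])], [(1,[[],[0],[],[3],[]]),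
(3,[[],[],[10,4],[],[11]])]]"

definition patch47 :: "(nat \<times> nat list list) list list" where
 "patch47 =
[[(0,[[],[],[],[],[]])], [(1,[[],[],[],[],[]])], [(0,[[],[4],[],[],[3]]), (0,[[3],[],[10,10],[9],[]])],
[(0,[[3],[],[],[],[]])], [(0,[[3],[4],[],[9],[]]), (0,[[],[],[10,5],[],[3]])], [(0,[[3],[],[],[9],[]]),
(1,[[],[],[10,5],[],[3]])], [(1,[[3],[4],[],[9],[]]), (0,[[3],[],[10,5],[],[3]])], [(0,[[],[4],[],[9],[]]),
(0,[[],[],[10],[11],[3]]), (0,[[3],[4],[],[6],[3]]), (0,[[3],[],[10],[10],[3]])], [(0,[[],[],[10],[],[]])],
[(1,[[3],[],[],[9],[]]), (0,[[3],[4],[10,5],[],[3]])], [(0,[[],[],[10],[],[3]]), (0,[[3],[4],[10,10],[],[]])],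
[(0,[[],[4],[10],[9],[]]), (1,[[3],[4],[],[6],[3]]), (0,[[],[4],[10],[11],[3]]), (0,[[3],[4],[10],[10],[3]])],
[(0,[[3],[4],[10],[],[]])], [(1,[[3],[4],[10,10],[],[]]), (0,[[3],[4],[10],[],[3]])], [(0,[[],[4],[],[],[]])],
[(0,[[3],[4],[],[],[3]]), (0,[[],[4],[10,10],[],[]])], [(0,[[3],[4],[],[],[]])], [(0,[[],[4],[10],[],[]])],
[(0,[[],[],[10],[9],[]]), (1,[[3],[4],[],[],[3]])], [(1,[[],[],[10],[9],[]]), (0,[[],[4],[10],[],[3]])],
[(0,[[3],[],[10],[],[]])], [(1,[[],[],[10],[],[]])], [(1,[[],[4],[],[],[]])], [(0,[[3],[],[],[],[3]]),
(0,[[3],[4],[10],[9],[]])], [(0,[[],[],[],[9],[]]), (1,[[3],[4],[10],[11],[3]]), (0,[[3],[],[10,5],[10],[3]]),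
(0,[[3],[4],[10,5],[6],[3]])], [(0,[[],[],[],[],[3]]), (0,[[],[],[10,10],[9],[]])], [(1,[[3],[],[],[],[3]]),
(1,[[3],[],[10,10],[9],[]])], [(1,[[],[],[],[],[3]]), (0,[[3],[4],[10,10],[9],[]])],
[(1,[[3],[],[10],[],[]])], [(0,[[3],[],[10,10],[],[]]), (1,[[3],[4],[10],[],[3]])], [(1,[[],[4],[10],[9],[]]),
(1,[[3],[],[10,5],[],[3]])], [(0,[[],[],[10,10],[],[]]), (0,[[],[],[10,4],[9],[3]]),
(1,[[3],[4],[10,5],[],[3]])], [(0,[[3],[],[10],[],[3]]), (0,[[],[4],[10,10],[9],[]])],
[(0,[[],[],[],[10],[3]]), (0,[[3],[],[10],[9],[]]), (0,[[3],[],[],[6],[3]]), (1,[[],[4],[10],[11],[3]])],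
[(1,[[],[4],[],[9],[]]), (1,[[],[],[10],[],[3]])], [(1,[[3],[],[10],[9],[]]), (0,[[],[4],[10,5],[],[3]])],
[(1,[[],[],[10,10],[],[]]), (1,[[],[4],[10],[],[3]])], [(1,[[],[4],[],[],[3]]), (1,[[3],[4],[10],[9],[]])],
[(1,[[],[4],[10,10],[9],[]]), (1,[[],[4],[10,5],[],[3]]), (0,[[],[4],[10,4],[9],[3]])],
[(1,[[3],[4],[10],[],[]])], [(1,[[3],[4],[],[],[]])], [(1,[[],[4],[10,10],[],[]]), (1,[[3],[],[],[9],[3]]),
(0,[[],[4],[],[11],[3]]), (1,[[],[],[10],[6],[3]]), (1,[[],[4],[10,5],[10],[3]])], [(1,[[3],[],[],[],[]])],
[(1,[[],[],[],[9],[3]]), (1,[[],[4],[],[11],[3]]), (1,[[],[],[10,10],[9],[]]), (1,[[],[],[10,5],[10],[3]]),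
(1,[[3],[],[10,5],[6],[3]])], [(1,[[],[],[],[9],[]]), (1,[[3],[],[10,5],[],[]])], [(1,[[3],[],[10],[],[3]]),
(1,[[3],[4],[10,10],[9],[]])], [(1,[[],[4],[10],[],[]])]]"

definition patch53 :: "(nat \<times> nat list list) list list" where
 "patch53 =
[[(0,[[],[],[],[],[]])], [(1,[[],[],[],[],[]])], [(0,[[3],[],[10,5],[6],[]])], [(0,[[3],[],[],[],[14]]),
(0,[[],[4],[],[],[2]]), (0,[[],[4],[10],[],[10]]), (0,[[],[],[10],[6],[9]]), (0,[[3],[4],[10],[],[7]]),
(0,[[3],[],[10],[6],[8]]), (0,[[],[4],[10,5],[],[13]])], [(0,[[3],[],[10],[6],[]])],
[(0,[[],[],[10,5],[],[]])], [(0,[[],[4],[10,5],[6],[]])], [(0,[[3],[],[10,5],[],[]])],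
[(1,[[],[4],[10,5],[6],[]])], [(0,[[],[],[10],[6],[]])], [(0,[[3],[],[],[],[]])], [(0,[[3],[4],[10],[6],[]])],
[(0,[[],[4],[10],[],[]])], [(0,[[],[],[],[6],[]])], [(0,[[3],[4],[10],[],[]])], [(0,[[3],[4],[],[],[]])],
[(1,[[],[4],[],[],[9]]), (0,[[3],[],[10],[],[2]]), (1,[[3],[],[10],[],[13]]), (0,[[3],[],[],[6],[8]]),
(0,[[],[4],[],[6],[10]]), (0,[[],[],[10,5],[6],[7]]), (0,[[3],[],[10,5],[6],[14]])],
[(1,[[3],[],[10,5],[],[]])], [(0,[[3],[4],[10,5],[6],[]])], [(1,[[],[],[],[6],[]])],
[(0,[[3],[4],[],[6],[]])], [(1,[[3],[4],[10],[],[]])], [(0,[[3],[],[],[6],[]])], [(0,[[],[4],[],[],[]])],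
[(0,[[],[4],[],[6],[]])], [(0,[[3],[],[10],[],[]])], [(1,[[3],[],[],[],[]])], [(0,[[3],[4],[10,5],[],[]])],
[(0,[[],[4],[10],[6],[]])], [(1,[[],[4],[10],[],[]])], [(0,[[3],[4],[],[],[14]]), (1,[[3],[],[],[6],[7]]),
(0,[[],[],[10,5],[],[2]]), (1,[[],[],[10],[6],[10]]), (0,[[],[4],[10],[6],[13]]), (0,[[3],[4],[10],[6],[9]]),
(0,[[3],[4],[10,5],[6],[8]])], [(1,[[],[4],[10],[6],[]])], [(1,[[],[],[10],[6],[]])],
[(0,[[],[],[10],[],[]])], [(1,[[],[],[10,5],[],[]])], [(1,[[3],[4],[],[],[]])], [(1,[[],[4],[],[6],[]])],
[(0,[[],[],[10],[],[13]]), (1,[[],[4],[10],[],[9]]), (1,[[],[],[10,5],[],[7]]), (0,[[3],[4],[],[6],[2]]),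
(1,[[],[4],[10],[6],[8]]), (1,[[3],[],[10,5],[6],[14]]), (1,[[3],[4],[10,5],[6],[10]])],
[(1,[[3],[],[10,5],[6],[]])], [(1,[[3],[],[10],[6],[]])], [(1,[[3],[4],[10],[6],[]])],
[(1,[[3],[4],[10,5],[6],[]])], [(1,[[3],[],[],[],[7]]), (1,[[],[],[10],[],[2]]), (0,[[],[],[],[6],[8]]),
(1,[[],[4],[],[6],[10]]), (1,[[3],[4],[],[6],[13]]), (0,[[3],[],[10,5],[],[9]]),
(0,[[3],[4],[10,5],[],[14]])], [(1,[[3],[],[10],[],[]])], [(0,[[],[4],[10,5],[],[]])],
[(1,[[],[4],[],[],[]])], [(1,[[],[],[10],[],[]])], [(0,[[],[],[10,5],[6],[]])], [(1,[[3],[],[],[6],[]])],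
[(1,[[],[],[10,5],[6],[]])], [(1,[[3],[4],[10,5],[],[]])], [(1,[[],[4],[10,5],[],[]])],
[(1,[[3],[4],[],[6],[]])]]"

definition patch59 :: "(nat \<times> nat list list) list list" where
 "patch59 =
[[(0,[[],[],[],[],[]])], [(1,[[],[],[],[],[]])], [(0,[[3],[],[10],[],[]])], [(0,[[3],[4],[],[],[]])],
[(0,[[],[],[],[],[13]]), (0,[[3],[],[],[],[10]]), (0,[[],[4],[],[10],[7]]), (0,[[],[],[10,5],[10],[14]])],
[(0,[[3],[4],[],[10],[]])], [(0,[[3],[4],[10],[10],[]])], [(0,[[],[4],[],[10],[]])], [(0,[[],[4],[],[],[]])],
[(0,[[3],[],[],[10],[]])], [(0,[[],[],[10],[],[]])], [(0,[[],[4],[10],[10],[]])], [(0,[[],[],[10],[10],[]])],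
[(0,[[3],[4],[10],[],[]])], [(0,[[],[4],[10,5],[10],[]])], [(0,[[3],[4],[10,5],[10],[]])],
[(0,[[],[],[10,5],[],[]])], [(0,[[],[],[],[10],[14]]), (0,[[],[4],[10],[],[10]]),
(0,[[],[4],[10,5],[10],[7]]), (0,[[3],[4],[10,5],[10],[13]])], [(1,[[],[],[10,5],[],[]])],
[(0,[[3],[],[10],[10],[]])], [(1,[[],[4],[],[10],[]])], [(0,[[],[4],[10,5],[],[]])],
[(0,[[],[],[10,5],[10],[]])], [(0,[[3],[4],[10,5],[],[]])], [(1,[[],[],[],[],[10]]), (0,[[3],[4],[],[],[13]]),
(0,[[3],[],[10],[],[7]]), (1,[[],[],[10,5],[10],[14]])], [(0,[[],[4],[],[],[14]]), (1,[[3],[],[10],[],[7]]),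
(1,[[],[4],[10],[],[13]]), (0,[[],[],[10],[10],[10]])], [(1,[[],[],[10],[10],[]])], [(0,[[],[4],[10],[],[]])],
[(0,[[],[],[10],[],[10]]), (1,[[],[],[10],[],[14]]), (0,[[3],[4],[],[10],[7]]), (0,[[3],[4],[10,5],[],[13]])],
[(1,[[],[],[10,5],[10],[]])], [(0,[[],[],[],[10],[]])], [(0,[[3],[],[],[],[]])], [(1,[[3],[],[10],[10],[]])],
[(1,[[],[],[10],[],[]])], [(1,[[3],[4],[],[10],[]])], [(1,[[],[],[],[10],[7]]), (1,[[3],[4],[],[10],[10]]),
(0,[[3],[],[10,5],[],[13]]), (0,[[3],[4],[10],[10],[14]])], [(0,[[3],[],[10,5],[10],[]])],
[(1,[[],[4],[10,5],[],[]])], [(1,[[],[4],[],[],[13]]), (1,[[3],[],[10,5],[],[10]]),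
(0,[[],[4],[10,5],[],[14]]), (0,[[3],[],[10,5],[10],[7]])], [(1,[[],[4],[10],[10],[]])],
[(0,[[],[4],[10],[10],[10]]), (1,[[3],[4],[10,5],[],[14]]), (1,[[3],[],[10,5],[10],[13]]),
(1,[[],[4],[10,5],[10],[7]])], [(1,[[3],[4],[10],[10],[]])], [(1,[[],[4],[10],[],[]])],
[(1,[[3],[],[10,5],[10],[]])], [(1,[[],[],[],[10],[]])], [(1,[[3],[],[],[10],[]])], [(1,[[3],[],[10],[],[]])],
[(0,[[3],[],[],[10],[7]]), (1,[[3],[],[],[10],[10]]), (1,[[],[],[10],[10],[14]]),
(1,[[],[4],[10,5],[],[13]])], [(0,[[3],[],[10,5],[],[]])], [(1,[[3],[],[],[],[]])],
[(1,[[3],[4],[10],[],[]])], [(1,[[3],[],[],[],[10]]), (0,[[3],[4],[10],[],[14]]), (0,[[3],[],[10],[10],[7]]),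
(1,[[3],[4],[10,5],[10],[13]])], [(1,[[3],[4],[],[],[]])], [(1,[[3],[4],[],[],[13]]),
(0,[[],[],[10,5],[],[10]]), (1,[[],[],[10,5],[],[14]]), (1,[[3],[],[10],[10],[7]])], [(1,[[],[4],[],[],[]])],
[(1,[[3],[4],[10,5],[],[]])], [(1,[[],[4],[10,5],[10],[]])], [(1,[[3],[],[10,5],[],[]])],
[(1,[[3],[4],[10,5],[10],[]])]]"

definition patch61 :: "(nat \<times> nat list list) list list" where
 "patch61 =
[[(0,[[],[],[],[],[]])], [(1,[[],[],[],[],[]])], [(0,[[3],[],[10,4],[4],[]]), (0,[[],[0],[10,7],[10],[]])],
[(0,[[],[],[10,4],[4],[6]]), (1,[[],[],[10,7],[10],[10]])], [(0,[[],[],[10],[],[]])],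
[(0,[[3],[0],[],[],[]])], [(0,[[3],[],[],[10],[]]), (3,[[],[],[10],[4],[]])], [(0,[[],[0],[10,7],[],[10]]),
(3,[[],[],[],[],[6]])], [(0,[[],[0],[],[],[10]]), (0,[[],[],[10,4],[],[6]])], [(3,[[],[],[],[],[]])],
[(0,[[],[],[10],[4],[6]]), (0,[[3],[0],[10],[],[10]])], [(0,[[3],[0],[10,4],[4],[6]]),
(3,[[],[],[10],[],[10]])], [(1,[[],[0],[],[],[10]]), (0,[[],[0],[10,4],[],[]])], [(0,[[3],[],[10],[4],[]]),
(1,[[],[],[10,7],[],[10]])], [(0,[[],[0],[],[10],[10]]), (0,[[3],[0],[],[4],[6]])], [(1,[[],[],[10],[],[]])],
[(0,[[],[0],[],[],[]])], [(1,[[],[0],[10,7],[],[]]), (0,[[],[0],[10,4],[4],[6]])], [(0,[[3],[],[10],[],[]])],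
[(1,[[3],[0],[],[],[]])], [(0,[[3],[],[],[],[6]]), (0,[[3],[],[],[10],[10]])], [(1,[[3],[],[],[10],[]]),
(0,[[3],[0],[10,4],[],[6]])], [(0,[[3],[],[10,7],[],[]]), (0,[[3],[],[10],[4],[6]])],
[(0,[[3],[0],[],[10],[]]), (3,[[],[],[],[4],[]])], [(0,[[3],[0],[10],[],[]])], [(1,[[],[0],[],[10],[10]]),
(0,[[3],[],[10,4],[4],[6]])], [(0,[[3],[0],[10],[4],[]]), (1,[[3],[],[10,7],[10],[10]])],
[(1,[[],[0],[],[],[]])], [(0,[[3],[],[],[],[]])], [(0,[[],[],[10,4],[],[]]), (1,[[3],[0],[],[10],[10]])],
[(0,[[3],[0],[10,4],[],[]]), (3,[[],[],[10],[10],[10]])], [(0,[[3],[0],[10],[10],[10]]),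
(1,[[3],[0],[10,4],[4],[6]])], [(1,[[3],[0],[10],[10],[10]]), (3,[[],[],[10,4],[4],[]])],
[(0,[[],[0],[10],[],[]])], [(0,[[],[0],[10],[4],[]]), (0,[[],[0],[10],[],[10]])], [(1,[[],[0],[10],[10],[]]),
(0,[[],[0],[10],[4],[6]])], [(1,[[],[0],[10],[],[]])], [(1,[[3],[0],[10,7],[],[]]),
(1,[[],[0],[10,4],[4],[6]])], [(0,[[3],[],[10],[],[10]]), (1,[[3],[],[10],[],[6]])], [(0,[[],[],[10],[4],[]]),
(0,[[3],[0],[10,7],[10],[]])], [(0,[[],[0],[],[4],[]]), (1,[[3],[],[10,7],[],[]])], [(0,[[],[],[10],[],[10]]),
(1,[[],[],[10],[4],[6]])], [(0,[[3],[0],[],[],[6]]), (3,[[],[],[10,7],[],[]])], [(1,[[3],[],[],[4],[6]]),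
(1,[[],[0],[10,7],[10],[]])], [(1,[[],[],[10],[4],[]]), (1,[[3],[],[10],[10],[10]])],
[(0,[[3],[],[10,4],[],[6]]), (1,[[],[0],[10],[10],[10]])], [(1,[[3],[],[],[],[]])], [(1,[[],[0],[],[4],[]]),
(1,[[],[0],[10,7],[],[10]])], [(0,[[],[],[10,4],[4],[]]), (1,[[3],[0],[10],[],[10]])],
[(1,[[3],[],[10],[4],[]]), (1,[[3],[0],[10,7],[10],[]])], [(0,[[],[],[],[4],[]]), (1,[[],[0],[10],[],[10]])],
[(1,[[3],[0],[10],[],[]])], [(1,[[3],[],[10],[],[]])], [(1,[[],[],[],[4],[]]), (0,[[],[],[],[],[10]])],
[(1,[[3],[0],[],[4],[]]), (1,[[3],[],[10,7],[],[10]])], [(1,[[3],[0],[],[],[6]]),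
(3,[[],[],[10,7],[10],[10]])], [(0,[[],[],[],[10],[10]]), (1,[[3],[],[10,4],[4],[]])],
[(3,[[],[],[10],[],[]])], [(1,[[3],[],[],[],[10]]), (3,[[],[],[10,4],[],[6]])], [(1,[[],[],[],[10],[10]]),
(3,[[],[],[],[4],[6]])], [(1,[[],[],[10,7],[],[]]), (1,[[3],[0],[10],[4],[]])]]"

definition patch67 :: "(nat \<times> nat list list) list list" where
 "patch67 =
[[(0,[[],[],[],[],[]])], [(1,[[],[],[],[],[]])], [(0,[[],[4],[10],[11],[]])], [(0,[[],[4],[10],[],[2]]),
(0,[[3],[4],[10],[11],[10]])], [(0,[[],[],[],[],[2]]), (0,[[],[4],[10,5],[11],[10]])],
[(0,[[],[4],[],[],[]])], [(0,[[],[4],[10],[11],[10]]), (0,[[3],[4],[10,5],[11],[2]])],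
[(0,[[3],[],[10,5],[11],[]])], [(0,[[3],[4],[],[],[2]]), (0,[[3],[4],[10],[],[10]])],
[(0,[[],[4],[10,5],[11],[]])], [(0,[[],[],[10],[11],[10]]), (0,[[3],[],[10,5],[],[2]])],
[(0,[[],[4],[],[],[10]]), (0,[[3],[4],[],[11],[2]])], [(0,[[3],[4],[10,5],[],[]])], [(0,[[3],[],[10],[],[]])],
[(0,[[3],[],[],[],[]])], [(0,[[],[],[],[11],[]])], [(1,[[],[4],[],[],[2]]), (0,[[],[],[10,5],[],[10]])],
[(0,[[3],[4],[10],[11],[]])], [(0,[[],[],[10,5],[],[]])], [(0,[[3],[],[10,5],[],[]])],
[(0,[[],[],[10],[],[2]]), (0,[[],[],[10,5],[11],[10]])], [(0,[[],[4],[],[11],[]])], [(0,[[],[],[],[11],[10]]),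
(1,[[],[4],[10,5],[11],[2]])], [(0,[[3],[4],[],[],[]])], [(1,[[3],[],[10,5],[11],[]])],
[(0,[[3],[4],[10],[],[]])], [(0,[[],[4],[],[11],[10]]), (1,[[],[],[10,5],[],[2]])],
[(0,[[],[4],[10,5],[],[]])], [(0,[[],[],[10],[],[]])], [(1,[[3],[4],[10],[11],[]])],
[(0,[[],[4],[10],[],[]])], [(0,[[3],[],[],[11],[]])], [(1,[[],[],[],[],[2]]), (0,[[3],[],[10],[],[10]])],
[(0,[[3],[4],[],[11],[]])], [(1,[[],[4],[10],[],[10]]), (1,[[],[4],[],[11],[2]])], [(0,[[],[],[10],[11],[]])],
[(0,[[],[],[10,5],[11],[]])], [(1,[[3],[4],[],[],[10]]), (0,[[3],[],[],[11],[2]])], [(1,[[3],[4],[],[],[]])],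
[(1,[[3],[4],[10,5],[],[]])], [(1,[[3],[4],[],[11],[]])], [(1,[[3],[],[10,5],[],[]])],
[(0,[[],[4],[10,5],[],[10]]), (1,[[],[4],[10,5],[],[2]])], [(1,[[],[4],[],[11],[]])], [(1,[[3],[],[],[],[]])],
[(1,[[],[],[],[11],[]])], [(1,[[],[],[],[11],[2]]), (0,[[3],[4],[10,5],[],[10]])],
[(1,[[],[4],[10,5],[],[]])], [(1,[[],[4],[10],[11],[]])], [(1,[[3],[],[10],[],[10]]),
(1,[[3],[4],[10],[],[2]])], [(1,[[3],[],[10,5],[],[10]]), (0,[[3],[],[10],[11],[2]])],
[(0,[[3],[],[10],[11],[]])], [(1,[[],[],[10,5],[],[]])], [(1,[[],[],[10,5],[11],[]])],
[(0,[[3],[4],[10,5],[11],[]])], [(1,[[3],[4],[10,5],[11],[]])], [(1,[[3],[4],[10],[],[]])],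
[(0,[[3],[],[],[],[2]]), (1,[[3],[4],[10,5],[],[10]])], [(1,[[3],[],[10],[],[]])], [(1,[[],[],[10],[],[]])],
[(1,[[],[4],[],[],[]])], [(1,[[],[4],[10],[],[]])], [(1,[[3],[],[],[11],[]])], [(1,[[],[4],[10,5],[11],[]])],
[(1,[[3],[],[10],[11],[]])], [(1,[[],[],[10],[11],[]])], [(1,[[],[],[10],[],[2]]),
(0,[[3],[],[10,5],[11],[10]])]]"

definition patch71 :: "(nat \<times> nat list list) list list" where
 "patch71 =
[[(0,[[],[],[],[],[]])], [(1,[[],[],[],[],[]])], [(0,[[],[],[],[],[7]]), (0,[[3],[],[],[11],[13]])],
[(0,[[3],[4],[],[],[]])], [(0,[[3],[4],[10],[],[]])], [(0,[[],[4],[],[],[]])], [(0,[[3],[],[],[],[7]]),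
(0,[[3],[],[10,5],[11],[13]])], [(0,[[3],[],[],[11],[]])], [(1,[[3],[4],[],[],[]])], [(0,[[],[],[],[11],[]])],
[(0,[[],[],[10,5],[],[]])], [(0,[[3],[],[10],[],[]])], [(0,[[],[4],[],[11],[]])], [(0,[[3],[4],[],[],[7]]),
(0,[[],[4],[10],[],[13]])], [(0,[[3],[4],[],[11],[7]]), (0,[[3],[],[10,5],[],[13]])], [(1,[[],[],[],[],[7]]),
(0,[[],[],[],[11],[13]])], [(0,[[],[],[10,5],[11],[]])], [(1,[[],[],[10,5],[11],[]])],
[(1,[[],[],[10,5],[],[]])], [(0,[[3],[4],[],[11],[]])], [(1,[[3],[],[10,5],[],[7]]),
(0,[[],[4],[10,5],[],[13]])], [(0,[[],[],[10],[11],[]])], [(0,[[3],[],[10],[11],[]])],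
[(0,[[],[4],[10,5],[11],[]])], [(0,[[],[4],[10,5],[],[]])], [(0,[[],[4],[10],[11],[7]]),
(0,[[],[],[10,5],[11],[13]])], [(0,[[3],[4],[10,5],[],[]])], [(0,[[],[4],[],[],[13]]),
(1,[[],[4],[10,5],[],[7]])], [(1,[[3],[4],[],[11],[]])], [(0,[[],[],[10,5],[],[7]]),
(0,[[3],[],[10],[11],[13]])], [(0,[[],[],[10],[11],[7]]), (1,[[],[4],[10],[11],[13]])],
[(1,[[3],[],[10],[],[]])], [(0,[[3],[4],[10],[11],[]])], [(1,[[3],[4],[],[],[7]]), (0,[[3],[],[10],[],[13]])],
[(1,[[],[4],[10,5],[],[]])], [(0,[[3],[],[10,5],[11],[]])], [(1,[[3],[],[10],[11],[]])],
[(0,[[],[4],[10],[],[]])], [(0,[[3],[],[10,5],[],[]])], [(1,[[3],[4],[10,5],[],[]])],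
[(0,[[],[],[10],[],[]])], [(1,[[3],[],[10,5],[11],[]])], [(1,[[3],[],[],[],[13]]),
(0,[[3],[4],[10,5],[11],[7]])], [(1,[[3],[],[],[11],[]])], [(0,[[3],[4],[10],[],[7]]),
(0,[[3],[4],[10,5],[],[13]])], [(1,[[],[4],[],[],[]])], [(0,[[],[4],[],[11],[13]]),
(1,[[3],[4],[10,5],[11],[7]])], [(0,[[],[4],[10],[11],[]])], [(0,[[],[],[10],[],[13]]),
(0,[[3],[4],[10],[11],[7]])], [(1,[[],[4],[10],[],[]])], [(0,[[3],[],[],[],[]])],
[(1,[[],[4],[10,5],[11],[]])], [(1,[[3],[],[10,5],[],[]])], [(1,[[],[4],[],[],[13]]),
(1,[[3],[4],[10,5],[],[7]])], [(1,[[3],[4],[10],[],[13]]), (1,[[3],[4],[],[11],[7]])],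
[(1,[[],[],[10,5],[],[13]]), (1,[[],[],[10],[11],[7]])], [(1,[[],[],[10],[],[13]]), (1,[[],[],[],[11],[7]])],
[(1,[[],[],[10],[11],[]])], [(0,[[3],[4],[10,5],[11],[]])], [(1,[[],[4],[10],[],[13]]),
(1,[[3],[],[10,5],[11],[7]])], [(0,[[],[4],[10,5],[11],[7]]), (1,[[],[4],[10,5],[11],[13]])],
[(1,[[3],[4],[10,5],[11],[]])], [(1,[[3],[4],[10],[11],[]])], [(1,[[],[],[],[11],[]])],
[(1,[[3],[],[],[],[]])], [(1,[[],[],[10],[],[]])], [(1,[[],[4],[],[11],[]])], [(1,[[3],[],[10],[],[7]]),
(1,[[],[4],[],[11],[13]])], [(1,[[3],[],[],[11],[7]]), (1,[[3],[],[10],[11],[13]])],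
[(1,[[],[4],[10],[11],[]])], [(1,[[3],[4],[10],[],[]])]]"

definition patch73 :: "(nat \<times> nat list list) list list" where
 "patch73 =
[[(0,[[],[],[],[],[]])], [(1,[[],[],[],[],[]])], [(0,[[],[4],[10,5],[11],[8]])], [(0,[[3],[],[10],[],[]])],
[(0,[[],[4],[10,5],[],[8]])], [(0,[[],[4],[10,5],[11],[]])], [(0,[[3],[4],[],[11],[8]])],
[(0,[[],[],[10,5],[],[]])], [(0,[[],[],[10,5],[11],[]])], [(0,[[3],[],[10],[11],[]])],
[(0,[[3],[4],[],[11],[]])], [(0,[[],[4],[],[],[8]])], [(0,[[],[4],[10],[11],[8]])],
[(0,[[],[],[10],[11],[8]])], [(0,[[3],[4],[10],[],[8]])], [(0,[[3],[],[10,5],[11],[]])],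
[(0,[[],[],[],[11],[8]])], [(0,[[],[4],[10,5],[],[]])], [(1,[[],[4],[10,5],[],[]])],
[(0,[[3],[],[10,5],[],[8]])], [(0,[[3],[],[],[11],[8]])], [(0,[[],[],[10,5],[11],[8]])],
[(1,[[3],[],[],[11],[8]])], [(0,[[3],[4],[],[],[8]])], [(0,[[],[],[],[11],[]])], [(0,[[3],[],[],[11],[]])],
[(0,[[3],[4],[10],[11],[8]])], [(1,[[],[4],[10,5],[11],[8]])], [(0,[[],[4],[10],[],[]])],
[(0,[[3],[4],[10],[],[]])], [(1,[[],[4],[10],[11],[8]])], [(0,[[3],[4],[10,5],[],[]])],
[(0,[[],[4],[],[],[]])], [(0,[[3],[4],[10],[11],[]])], [(0,[[3],[4],[],[],[]])], [(0,[[],[],[10],[],[8]])],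
[(0,[[3],[4],[10,5],[11],[]])], [(1,[[3],[4],[10],[11],[]])], [(1,[[],[4],[],[],[]])],
[(0,[[3],[],[],[],[]])], [(0,[[],[],[10],[11],[]])], [(1,[[],[],[],[11],[8]])], [(0,[[3],[],[10],[],[8]])],
[(1,[[3],[],[],[],[]])], [(1,[[3],[],[10],[],[8]])], [(1,[[3],[4],[10],[],[]])], [(0,[[],[],[],[],[8]])],
[(0,[[],[],[10,5],[],[8]])], [(1,[[],[],[10,5],[11],[8]])], [(1,[[3],[4],[],[],[8]])],
[(1,[[],[4],[10,5],[],[8]])], [(1,[[],[],[],[],[8]])], [(1,[[3],[4],[],[11],[8]])],
[(1,[[],[],[10],[11],[]])], [(1,[[],[],[10],[],[8]])], [(0,[[3],[],[10,5],[11],[8]])],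
[(1,[[3],[],[10,5],[],[8]])], [(1,[[3],[4],[10,5],[11],[]])], [(0,[[],[],[10],[],[]])],
[(1,[[3],[],[10],[],[]])], [(1,[[3],[],[10,5],[11],[]])], [(1,[[3],[4],[10,5],[],[]])],
[(0,[[3],[],[10,5],[],[]])], [(1,[[],[4],[],[],[8]])], [(1,[[3],[4],[],[11],[]])], [(0,[[],[4],[],[11],[]])],
[(1,[[3],[4],[],[],[]])], [(1,[[],[],[],[11],[]])], [(0,[[3],[4],[10,5],[],[8]])],
[(1,[[3],[4],[10],[11],[8]])], [(0,[[3],[],[],[],[8]])], [(1,[[],[],[10],[11],[8]])],
[(1,[[3],[4],[10,5],[],[8]])]]"

definition patch79 :: "(nat \<times> nat list list) list list" where
 "patch79 =
[[(0,[[],[],[],[],[]])], [(1,[[],[],[],[],[]])], [(0,[[],[],[10],[11],[]])], [(0,[[3],[],[],[],[]])],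
[(0,[[],[4],[],[],[14]])], [(0,[[],[4],[10,5],[],[14]])], [(0,[[3],[4],[10],[],[]])],
[(0,[[3],[],[],[11],[14]])], [(0,[[],[4],[],[11],[]])], [(0,[[3],[],[10,5],[],[14]])],
[(0,[[3],[],[10],[11],[]])], [(0,[[3],[4],[],[],[14]])], [(0,[[3],[],[10,5],[],[]])],
[(1,[[],[4],[],[],[14]])], [(0,[[3],[4],[10,5],[11],[14]])], [(0,[[3],[],[10],[11],[14]])],
[(0,[[],[4],[10],[11],[]])], [(0,[[3],[],[10],[],[14]])], [(1,[[],[],[10],[11],[]])],
[(0,[[3],[],[10],[],[]])], [(0,[[3],[4],[10],[],[14]])], [(0,[[],[4],[10,5],[11],[]])],
[(0,[[3],[],[10,5],[11],[]])], [(1,[[3],[],[10],[],[14]])], [(0,[[],[],[10],[11],[14]])],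
[(1,[[],[4],[],[11],[]])], [(0,[[3],[4],[10],[11],[14]])], [(0,[[3],[4],[],[],[]])],
[(0,[[],[4],[10,5],[11],[14]])], [(0,[[],[4],[10],[],[]])], [(1,[[3],[4],[10],[],[]])],
[(0,[[3],[4],[10,5],[],[]])], [(0,[[],[],[],[11],[14]])], [(0,[[],[],[10],[],[]])],
[(0,[[],[],[10],[],[14]])], [(0,[[],[4],[10,5],[],[]])], [(0,[[3],[4],[10,5],[],[14]])],
[(1,[[3],[4],[],[],[]])], [(1,[[],[4],[10,5],[11],[14]])], [(1,[[3],[],[10,5],[11],[]])],
[(0,[[],[4],[10],[],[14]])], [(0,[[3],[],[10,5],[11],[14]])], [(1,[[3],[],[10,5],[11],[14]])],
[(0,[[],[],[],[11],[]])], [(0,[[],[],[10,5],[],[]])], [(1,[[],[4],[10],[],[14]])], [(0,[[],[4],[],[],[]])],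
[(0,[[3],[4],[10],[11],[]])], [(1,[[3],[],[10],[],[]])], [(0,[[3],[4],[],[11],[14]])],
[(0,[[],[4],[10],[11],[14]])], [(1,[[3],[4],[],[],[14]])], [(1,[[3],[4],[10,5],[11],[14]])],
[(1,[[3],[],[10],[11],[14]])], [(1,[[],[4],[10,5],[],[14]])], [(0,[[3],[],[],[],[14]])],
[(1,[[3],[4],[10,5],[],[]])], [(1,[[3],[],[],[],[14]])], [(1,[[3],[4],[10,5],[],[14]])],
[(0,[[],[4],[],[11],[14]])], [(0,[[3],[],[],[11],[]])], [(0,[[3],[4],[10,5],[11],[]])],
[(1,[[],[4],[],[],[]])], [(1,[[],[4],[10,5],[],[]])], [(1,[[3],[4],[10,5],[11],[]])],
[(1,[[3],[],[],[11],[]])], [(1,[[],[],[10],[11],[14]])], [(0,[[3],[4],[],[11],[]])], [(0,[[],[],[],[],[14]])],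
[(1,[[3],[],[10,5],[],[]])], [(0,[[],[],[10,5],[11],[14]])], [(1,[[],[4],[10],[],[]])],
[(1,[[3],[],[10],[11],[]])], [(0,[[],[],[10,5],[11],[]])], [(1,[[],[],[10],[],[]])],
[(1,[[3],[4],[],[11],[]])], [(1,[[],[],[],[11],[14]])], [(0,[[],[],[10,5],[],[14]])],
[(1,[[3],[4],[],[11],[14]])]]"

definition pp :: "nat list" where
 "pp =
[31, 41, 43, 47, 53, 59, 61, 67, 71, 73, 79]"

definition patches0 :: "(nat \<times> nat list list) list list list" where
 "patches0 =
[patch31, patch41, patch43, patch47, patch53, patch59, patch61, patch67, patch71, patch73, patch79]"

text \<open>The digits still open: residues 1 and 2 modulo 5 are removed by powers of 5, and 0 to 6
  modulo 11 by the repeated modulus. The prime 11 has a second row because its square is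
  used.\<close>

definition rows0 :: "nat list list list" where
 "rows0 =
[[[0, 3, 4]], [[0, 1, 2, 3, 4, 5, 6]], [[7, 8, 9, 10], [0, 1, 2, 3, 4, 5, 6, 7, 8, 9, 10]], [[0, 1, 2, 3, 4,
5, 6, 7, 8, 9, 10, 11, 12]], [[0, 1, 2, 3, 4, 5, 6, 7, 8, 9, 10, 11, 12, 13, 14, 15, 16]]]"


text \<open>For the search, a chain is the condition of being a multiple of 5 or 7, that is digit 0.
  The \<open>key\<close> is taken without this digit, as the exponent is supplied by
  \<open>expand\<close>.\<close>

fun chain :: "nat \<times> nat list list \<Rightarrow> nat \<times> nat list list" where
  "chain (s, a # b # bs) = (s, (if s = 2 then [0] else a) # (if s = 3 then [0] else b) # bs)"
| "chain e = e"

definition path0 :: "nat \<times> nat list list \<Rightarrow> nat option list" where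
  "path0 e = path rows0 (chain e)"

fun ok0 :: "nat \<times> nat list list \<Rightarrow> bool" where
  "ok0 (s, [a, b, c, d, e]) =
     (s < 4 \<and> length a \<le> 1 \<and> length b \<le> 1 \<and> length c \<le> 2 \<and> length d \<le> 1 \<and> length e \<le> 1 \<and>
      (s = 2 \<longrightarrow> a = []) \<and> (s = 3 \<longrightarrow> a = [] \<and> b = []))"
| "ok0 _ = False"

text \<open>These are the hypotheses \<open>I0\<close> and \<open>I11\<close> of
  \<open>kit_flex\<close>: no clash with the automatic powers of 5 and 7, and no bare modulus 11 on
  slot 0.\<close>

fun unit0 :: "nat \<times> nat list list \<Rightarrow> bool" where
  "unit0 (s, [a, b, c, d, e]) =
     (b @ c @ d @ e \<noteq> [] \<and> \<not> (s = 0 \<and> a = [] \<and> b = [] \<and> length c = 1 \<and> d = [] \<and> e = []))"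
| "unit0 _ = False"

lemma base0: "list_all ok0 base0" "list_all unit0 base0" "distinct (map key base0)"
  unfolding dist[symmetric] by (simp_all add: base0_def)

lemma groups0: "list_all (list_all ok0) groups0" "distinct (map key (concat groups0))"
  "length groups0 = 15" "groups0 ! 0 = [(0, [[], [], [], [], []])]"
  unfolding dist[symmetric] by (simp_all add: groups0_def)

lemma patches0: "list_all (list_all (list_all ok0)) patches0"
  "list_all (\<lambda>P. distinct (map key (concat P))) patches0" "map length patches0 = pp"
  unfolding dist[symmetric] by (simp_all add: patches0_def pp_def patch31_def patch41_def patch43_def patch47_def patch53_def patch59_def patch61_def patch67_def patch71_def patch73_def patch79_def)

text \<open>The finite verification: 3 * 7 * 4 * 11 * 13 * 17 = 204204 digit strings, most of them
  settled by a common prefix, and the holes sieved by eleven patches.\<close>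

lemma search0:
  "sieves (map (map (map path0)) patches0)
     (holes False (concat rows0) (map path0 base0) (trim (map (map path0) groups0)) []) = []"
  by (simp add: patches0_def path0_def rows0_def base0_def groups0_def patch31_def patch41_def patch43_def patch47_def patch53_def patch59_def patch61_def patch67_def patch71_def patch73_def patch79_def)

section \<open>Data for 19, 23, 29\<close>

text \<open>Here the digits belong to 19, 23, 29, and the slot is one of the 15 groups obtained before.\<close>

definition mbase :: "(nat \<times> nat list list) list" where
 "mbase =
[(0,[[0],[],[]]), (1,[[1],[],[]]), (2,[[2],[],[]]), (3,[[3],[],[]]), (4,[[4],[],[]]), (5,[[5],[],[]]),
(6,[[6],[],[]]), (7,[[7],[],[]]), (8,[[8],[],[]]), (9,[[9],[],[]]), (10,[[10],[],[]]), (11,[[11],[],[]]),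
(12,[[12],[],[]]), (13,[[13],[],[]]), (14,[[14],[],[]]), (0,[[],[0],[]]), (1,[[],[1],[]]), (2,[[],[2],[]]),
(3,[[],[3],[]]), (4,[[],[4],[]]), (5,[[],[5],[]]), (6,[[],[6],[]]), (7,[[],[7],[]]), (8,[[],[8],[]]),
(9,[[],[9],[]]), (10,[[],[10],[]]), (11,[[],[11],[]]), (12,[[],[12],[]]), (13,[[],[13],[]]),
(14,[[],[14],[]]), (0,[[],[],[0]]), (1,[[],[],[1]]), (2,[[],[],[2]]), (3,[[],[],[3]]), (4,[[],[],[4]]),
(5,[[],[],[5]]), (6,[[],[],[6]]), (7,[[],[],[7]]), (8,[[],[],[8]]), (9,[[],[],[9]]), (10,[[],[],[10]]),
(11,[[],[],[11]]), (12,[[],[],[12]]), (13,[[],[],[13]]), (14,[[],[],[14]]), (0,[[16],[17],[]]),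
(1,[[16],[15],[]]), (2,[[15],[22],[]]), (3,[[15],[19],[]]), (4,[[15],[15],[]]), (5,[[15],[17],[]]),
(6,[[15],[18],[]]), (7,[[15],[16],[]]), (8,[[15],[21],[]]), (9,[[16],[19],[]]), (10,[[16],[21],[]]),
(11,[[16],[22],[]]), (12,[[16],[16],[]]), (13,[[17],[15],[]]), (14,[[16],[18],[]]), (0,[[18],[],[22]]),
(1,[[18],[],[28]]), (2,[[18],[],[25]]), (3,[[18],[],[18]]), (4,[[18],[],[17]]), (5,[[18],[],[24]]),
(6,[[18],[],[20]]), (7,[[18],[],[16]]), (8,[[18],[],[15]]), (9,[[18],[],[27]]), (10,[[18],[],[21]]),
(11,[[18],[],[26]]), (12,[[18],[],[19]]), (13,[[17],[],[19]]), (14,[[18],[],[23]]), (0,[[],[20],[28]]),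
(1,[[],[20],[22]]), (2,[[],[20],[26]]), (3,[[],[20],[27]]), (4,[[],[20],[23]]), (5,[[],[20],[17]]),
(6,[[],[20],[20]]), (7,[[],[20],[19]]), (8,[[],[20],[16]]), (9,[[],[20],[24]]), (10,[[],[20],[15]]),
(11,[[],[22],[26]]), (12,[[],[20],[18]]), (13,[[],[20],[25]]), (14,[[],[20],[21]]), (0,[[17],[18],[23]]),
(1,[[17],[18],[17]]), (2,[[17],[16],[15]]), (3,[[17],[22],[15]]), (4,[[17],[21],[15]]), (5,[[17],[18],[28]]),
(6,[[17],[16],[20]]), (7,[[17],[19],[25]]), (8,[[17],[18],[15]]), (9,[[17],[21],[28]]), (10,[[17],[18],[26]]),
(11,[[17],[18],[18]]), (12,[[17],[21],[25]]), (13,[[17],[22],[28]]), (14,[[17],[22],[16]])]"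

text \<open>The count is 15 + 15 + 7 = 37: the old groups, the same groups once more with the class
  17 modulo 19, and seven mixed ones. The second fifteen work because \<open>mbase\<close> removes
  everything outside the class 17 modulo 19.\<close>

definition mgroups :: "(nat \<times> nat list list) list list" where
 "mgroups =
[[(0,[[],[],[]])], [(1,[[],[],[]])], [(2,[[],[],[]])], [(3,[[],[],[]])], [(4,[[],[],[]])], [(5,[[],[],[]])],
[(6,[[],[],[]])], [(7,[[],[],[]])], [(8,[[],[],[]])], [(9,[[],[],[]])], [(10,[[],[],[]])], [(11,[[],[],[]])],
[(12,[[],[],[]])], [(13,[[],[],[]])], [(14,[[],[],[]])], [(0,[[17],[],[]])], [(1,[[17],[],[]])],
[(0,[[],[16],[]]), (1,[[],[22],[]]), (0,[[],[],[27]]), (1,[[],[],[25]]), (0,[[17],[19],[]]),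
(1,[[17],[17],[]]), (2,[[17],[21],[]]), (0,[[17],[],[21]]), (1,[[17],[],[26]]), (0,[[],[18],[22]]),
(1,[[],[18],[16]]), (2,[[],[18],[15]]), (3,[[],[18],[24]]), (4,[[],[18],[23]]), (0,[[17],[18],[20]])],
[(2,[[],[17],[]]), (2,[[],[],[17]]), (3,[[],[],[26]]), (4,[[],[],[16]]), (5,[[],[],[25]]), (6,[[],[],[20]]),
(7,[[],[],[18]]), (2,[[17],[],[22]]), (3,[[17],[],[27]]), (4,[[17],[],[23]]), (5,[[17],[],[24]]),
(6,[[17],[],[21]]), (5,[[],[18],[24]]), (6,[[],[19],[16]]), (7,[[],[19],[15]]), (1,[[17],[16],[28]]),
(2,[[17],[18],[15]]), (3,[[17],[18],[23]]), (4,[[17],[19],[28]]), (5,[[17],[19],[26]])], [(2,[[17],[],[]])],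
[(3,[[17],[],[]])], [(4,[[17],[],[]])], [(5,[[17],[],[]])], [(6,[[17],[],[]])], [(3,[[],[17],[]]),
(4,[[],[22],[]]), (5,[[],[19],[]]), (6,[[],[16],[]]), (7,[[],[21],[]]), (8,[[],[18],[]]), (8,[[],[19],[23]])],
[(7,[[17],[],[]])], [(8,[[17],[],[]])], [(9,[[17],[],[]])], [(9,[[],[18],[]]), (10,[[],[16],[]]),
(3,[[17],[21],[]]), (4,[[17],[17],[]]), (5,[[17],[19],[]]), (6,[[17],[22],[]]), (7,[[17],[],[27]]),
(9,[[],[21],[17]]), (10,[[],[16],[16]]), (6,[[17],[22],[20]]), (7,[[17],[22],[18]]), (8,[[17],[22],[23]])],
[(10,[[17],[],[]])], [(11,[[],[17],[]]), (8,[[],[],[25]]), (9,[[],[],[18]]), (10,[[],[],[23]]),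
(11,[[],[],[24]]), (12,[[],[],[21]]), (8,[[17],[],[20]]), (9,[[17],[],[27]]), (10,[[17],[],[26]]),
(11,[[17],[],[28]]), (12,[[17],[],[22]]), (13,[[17],[],[17]]), (14,[[17],[],[16]]), (9,[[17],[19],[15]]),
(10,[[17],[16],[28]]), (11,[[17],[16],[25]])], [(11,[[17],[],[]])], [(7,[[17],[22],[]]), (8,[[17],[17],[]]),
(9,[[17],[16],[]]), (10,[[17],[19],[]]), (11,[[17],[21],[]]), (12,[[17],[18],[]]), (11,[[],[19],[15]])],
[(12,[[],[17],[]]), (13,[[],[19],[]]), (14,[[],[16],[]]), (13,[[],[],[20]]), (14,[[],[],[17]]),
(13,[[17],[22],[]]), (14,[[17],[21],[]]), (12,[[],[18],[16]]), (13,[[],[18],[27]]), (14,[[],[18],[22]]),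
(12,[[17],[18],[21]]), (13,[[17],[18],[25]]), (14,[[17],[18],[24]])], [(12,[[17],[],[]])],
[(13,[[17],[],[]])], [(14,[[17],[],[]])]]"

definition rows1 :: "nat list list list" where
  "rows1 = [[[0, 1, 2, 3, 4, 5, 6, 7, 8, 9, 10, 11, 12, 13, 14, 15, 16, 17, 18]], [[0, 1, 2, 3, 4, 5, 6, 7, 8, 9, 10, 11, 12, 13, 14, 15, 16, 17, 18, 19, 20, 21, 22]], [[0, 1, 2, 3, 4, 5, 6, 7, 8, 9, 10, 11, 12, 13, 14, 15, 16, 17, 18, 19, 20, 21, 22, 23, 24, 25, 26, 27, 28]]]"

fun ok1 :: "nat \<times> nat list list \<Rightarrow> bool" where
  "ok1 (t, [a, b, c]) = (t < 15 \<and> length a \<le> 1 \<and> length b \<le> 1 \<and> length c \<le> 1)"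
| "ok1 _ = False"

fun unit1 :: "nat \<times> nat list list \<Rightarrow> bool" where
  "unit1 (t, [a, b, c]) = (a @ b @ c \<noteq> [])"
| "unit1 _ = False"

lemma mbase: "list_all ok1 mbase" "list_all unit1 mbase" "distinct (map key mbase)"
  unfolding dist[symmetric] by (simp_all add: mbase_def)

lemma mgroups: "list_all (list_all ok1) mgroups" "distinct (map key (concat mgroups))"
  "length mgroups = 37" "mgroups ! 0 = [(0, [[], [], []])]"
  unfolding dist[symmetric] by (simp_all add: mgroups_def)

lemma search1:
  "sieves [] (holes False (concat rows1) (map (path rows1) mbase) (trim (map (map (path rows1)) mgroups)) []) = []"
  by (simp add: rows1_def mbase_def mgroups_def)

section \<open>Assembling the stages\<close>

definition ps0 :: "nat list" where "ps0 = [5, 7, 11, 13, 17]"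

definition item0 :: "nat list list \<Rightarrow> nat \<times> nat list list \<Rightarrow> item" where
  "item0 cs = (\<lambda>(s, bs). (s, length (bs ! 0), length (bs ! 1), map length (drop 2 bs @ cs),
     {y. mt (ps0 @ pp) (bs @ cs) y}))"

lemma ok0E:
  assumes "ok0 x"
  obtains s a b c d e where "x = (s, [a, b, c, d, e])" "s < 4" "length a \<le> 1" "length b \<le> 1"
    "length c \<le> 2" "length d \<le> 1" "length e \<le> 1" "s = 2 \<longrightarrow> a = []" "s = 3 \<longrightarrow> a = [] \<and> b = []"
  using assms by (cases x rule: ok0.cases) auto

lemma item0_key:
  assumes "ok0 x" "ok0 x'" "item0 cs x = (s, a, b, w, M)" "item0 cs' x' = (s, a, b, w, M')"
  shows "key x = key x' \<and> map length cs = map length cs'"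
proof -
  obtain s1 a1 b1 c1 d1 e1 where x: "x = (s1, [a1, b1, c1, d1, e1])" using assms(1) by (rule ok0E)
  obtain s2 a2 b2 c2 d2 e2 where x': "x' = (s2, [a2, b2, c2, d2, e2])" using assms(2) by (rule ok0E)
  have eq: "s1 = s2" "map length [a1, b1, c1, d1, e1] = map length [a2, b2, c2, d2, e2]"
    "map length cs = map length cs'"
    using assms(3,4) unfolding x x' item0_def by auto
  have "code [a1, b1, c1, d1, e1] s1 = code [a2, b2, c2, d2, e2] s1"
    using eq(2) by (rule code_cong)
  then show ?thesis unfolding x x' key.simps using eq(1,3) by metis
qed

lemma prime_pp: "list_all prime pp"
  by (simp add: pp_def)

lemma prime_ps0: "list_all prime (ps0 @ pp)"
  using prime_pp by (simp add: ps0_def)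

lemma item0_wf:
  assumes "ok0 x" "length cs = length pp"
  shows "wf_item ([11, 13, 17] @ pp) (item0 cs x)"
proof -
  obtain s a b c d e where x: "x = (s, [a, b, c, d, e])" "s < 4" "length a \<le> 1" "length b \<le> 1"
    "s = 2 \<longrightarrow> a = []" "s = 3 \<longrightarrow> a = [] \<and> b = []" using assms(1) by (rule ok0E)
  have "cls (ps0 @ pp) (map length ([a, b, c, d, e] @ cs)) {y. mt (ps0 @ pp) ([a, b, c, d, e] @ cs) y}"
    by (rule cls_mt[OF prime_ps0]) (use assms(2) in \<open>simp add: ps0_def\<close>)
  then show ?thesis
    using assms(2) x(2-6) unfolding x(1) item0_def wf_item_def by (simp add: ps0_def del: mt.simps)
qed

lemma item0_covers:
  assumes "ok0 x" "accp (path0 x) (digits ps0 rows0 y)" "mt pp cs y"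
  shows "covers (item0 cs x) y"
proof -
  obtain s a b c d e where x: "x = (s, [a, b, c, d, e])" "s < 4" "length a \<le> 1" "length b \<le> 1"
    "length c \<le> 2" "length d \<le> 1" "length e \<le> 1" "s = 2 \<longrightarrow> a = []" "s = 3 \<longrightarrow> a = [] \<and> b = []"
    using assms(1) by (rule ok0E)
  have m: "mt ps0 [if s = 2 then [0] else a, if s = 3 then [0] else b, c, d, e] y"
    by (rule path_sound[of rows0 s]) (use assms(2) x(3-7) in \<open>simp_all add: x(1) path0_def ps0_def rows0_def\<close>)
  have "mt ps0 [a, b, c, d, e] y" using m x(8,9) by (auto simp: ps0_def split: if_splits)
  moreover have "5 dvd y" if "s = 2" using m that by (auto simp: ps0_def dvd_eq_mod_eq_0 split: if_splits)
  moreover have "7 dvd y" if "s = 3" using m that by (auto simp: ps0_def dvd_eq_mod_eq_0 split: if_splits)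
  ultimately show ?thesis
    using assms(3) mt_append[of ps0 "[a, b, c, d, e]" pp cs y] unfolding x(1) item0_def covers_def
    by (simp add: ps0_def)
qed

lemma below:
  "k < 7 \<Longrightarrow> k \<in> set [0, 1, 2, 3, 4, 5, 6 :: nat]"
  "k < 11 \<Longrightarrow> k \<in> set [0, 1, 2, 3, 4, 5, 6, 7, 8, 9, 10 :: nat]"
  "k < 13 \<Longrightarrow> k \<in> set [0, 1, 2, 3, 4, 5, 6, 7, 8, 9, 10, 11, 12 :: nat]"
  "k < 17 \<Longrightarrow> k \<in> set [0, 1, 2, 3, 4, 5, 6, 7, 8, 9, 10, 11, 12, 13, 14, 15, 16 :: nat]"
  "k < 19 \<Longrightarrow> k \<in> set [0, 1, 2, 3, 4, 5, 6, 7, 8, 9, 10, 11, 12, 13, 14, 15, 16, 17, 18 :: nat]"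
  "k < 23 \<Longrightarrow> k \<in> set [0, 1, 2, 3, 4, 5, 6, 7, 8, 9, 10, 11, 12, 13, 14, 15, 16, 17, 18, 19, 20, 21, 22 :: nat]"
  "k < 29 \<Longrightarrow> k \<in> set [0, 1, 2, 3, 4, 5, 6, 7, 8, 9, 10, 11, 12, 13, 14, 15, 16, 17, 18, 19, 20, 21, 22,
     23, 24, 25, 26, 27, 28 :: nat]"
  by (auto simp: eval_nat_numeral less_Suc_eq)

lemma rows0:
  assumes "\<not> y mod 11 < 7" "y mod 5 \<noteq> 1" "y mod 5 \<noteq> 2"
  shows "list_all2 (\<lambda>d u. d \<in> set u) (digits ps0 rows0 y) (concat rows0)"
proof -
  have "nat (y mod 5) \<in> set [0, 3, 4]"
  proof -
    have "y mod 5 = 0 \<or> y mod 5 = 3 \<or> y mod 5 = 4" using assms(2,3) by presburger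
    then show ?thesis by auto
  qed
  moreover have "nat (y mod 11) \<in> set [7, 8, 9, 10]"
  proof -
    have "y mod 11 = 7 \<or> y mod 11 = 8 \<or> y mod 11 = 9 \<or> y mod 11 = 10" using assms(1) by presburger
    then show ?thesis by auto
  qed
  ultimately show ?thesis
    using below(1)[of "nat (y mod 7)"] below(2)[of "nat (y div 11 mod 11)"]
      below(3)[of "nat (y mod 13)"] below(4)[of "nat (y mod 17)"]
    unfolding rows0_def ps0_def by (simp add: nat_less_iff)
qed

text \<open>The single digit in position \<open>k\<close> gives every patch modulus exponent 1 at
  its own prime and 0 at the other patch primes. This separates the patches from each other and from
  \<open>base0\<close>, so keys are compared only inside one patch or inside
  \<open>base0\<close>.\<close>

definition base_items :: "item set" where
  "base_items = item0 (replicate (length pp) []) ` set base0 \<union>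
     (\<Union>k<length pp. \<Union>i<pp ! k. item0 ((replicate (length pp) [])[k := [i]]) ` set (patches0 ! k ! i))"

definition group_items :: "nat \<Rightarrow> item set" where
  "group_items h = item0 (replicate (length pp) []) ` set (groups0 ! h)"

lemma length_patches0: "length patches0 = length pp" "k < length pp \<Longrightarrow> length (patches0 ! k) = pp ! k"
  using patches0(3) by (auto simp: list_eq_iff_nth_eq)

lemma base_itemsE:
  assumes "i \<in> base_items"
  obtains x where "x \<in> set base0" "ok0 x" "unit0 x" "i = item0 (replicate (length pp) []) x"
    | k l x where "k < length pp" "l < pp ! k" "x \<in> set (patches0 ! k ! l)" "ok0 x"
        "i = item0 ((replicate (length pp) [])[k := [l]]) x"
proof -
  have "ok0 x" if "k < length pp" "l < pp ! k" "x \<in> set (patches0 ! k ! l)" for k l x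
    using patches0(1) that length_patches0 by (simp add: list_all_length) (metis in_set_conv_nth)
  then show thesis
    using assms that base0(1,2) unfolding base_items_def by (auto simp: list_all_iff)
qed

lemma units_nil:
  assumes "k < n"
  shows "map length (replicate n ([] :: nat list)) \<noteq> map length ((replicate n [])[k := [i :: nat]])"
    "map length ((replicate n [])[k := [i :: nat]]) \<noteq> replicate n 0"
proof -
  show n: "map length ((replicate n [])[k := [i]]) \<noteq> replicate n 0"
    using units_neq[OF assms, of i] by (metis in_set_replicate zero_neq_one)
  have "map length (replicate n ([] :: nat list)) = replicate n 0" by simp
  then show "map length (replicate n ([] :: nat list)) \<noteq> map length ((replicate n [])[k := [i]])"
    using n by metis
qed

lemma base_items_unique:
  assumes "(s, a, b, w, M) \<in> base_items" "(s, a, b, w, M') \<in> base_items"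
  shows "M = M'"
  using assms(1)
proof (cases rule: base_itemsE)
  case (1 x)
  note x = this
  show ?thesis using assms(2)
  proof (cases rule: base_itemsE)
    case (1 x')
    then have "key x = key x'" using item0_key x by metis
    then have "x = x'" using base0(3) x(1) 1(1) by (auto simp: distinct_map dest: inj_onD)
    then show ?thesis using x(4) 1(4) by (metis prod.inject)
  next
    case (2 k l x')
    then have "map length (replicate (length pp) ([] :: nat list)) = map length ((replicate (length pp) [])[k := [l]])"
      using item0_key x by metis
    then show ?thesis using units_nil(1)[OF 2(1), of l] by metis
  qed
next
  case (2 k l x)
  note x = this
  show ?thesis using assms(2)
  proof (cases rule: base_itemsE)
    case (1 x')
    then have "map length (replicate (length pp) ([] :: nat list)) = map length ((replicate (length pp) [])[k := [l]])"
      using item0_key x by metis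
    then show ?thesis using units_nil(1)[OF x(1), of l] by metis
  next
    case (2 k' l' x')
    then have *: "key x = key x'" "map length ((replicate (length pp) [])[k := [l]]) = map length ((replicate (length pp) [])[k' := [l']])"
      using item0_key x by metis+
    then have k: "k' = k" using units_eq x(1) 2(1) by metis
    have "distinct (map key (concat (patches0 ! k)))"
      using patches0(2) x(1) length_patches0(1) by (simp add: list_all_length)
    then have "l = l' \<and> x = x'"
      using distinct_concat_map[of key "patches0 ! k" l l' x x'] length_patches0(2) x 2 * unfolding k by auto
    then show ?thesis using x(5) 2(5) k by (metis prod.inject)
  qed
qed

text \<open>\<open>1 # replicate (2 + length pp) 0\<close> is the exponent vector of 11, the first
  prime after 5 and 7. Patch entries avoid it, and the zero vector, by the exponent at the patch
  prime.\<close>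

lemma base_items_nontrivial:
  assumes "(s, a, b, w, M) \<in> base_items"
  shows "\<not> (b = 0 \<and> (\<forall>k\<in>set w. k = 0)) \<and> \<not> (s = 0 \<and> a = 0 \<and> b = 0 \<and> w = 1 # replicate (2 + length pp) 0)"
  using assms
proof (cases rule: base_itemsE)
  case (1 x)
  obtain s' a' b' c d e where x: "x = (s', [a', b', c, d, e])" using 1(2) by (rule ok0E)
  show ?thesis using 1(3,4) unfolding x item0_def by auto
next
  case (2 k l x)
  obtain s' a' b' c d e where x: "x = (s', [a', b', c, d, e])" using 2(4) by (rule ok0E)
  have w: "w = length c # length d # length e # map length ((replicate (length pp) [])[k := [l]])"
    using 2(5) unfolding x item0_def by simp
  then have "w \<noteq> 1 # replicate (2 + length pp) 0"
    using units_nil(2)[OF 2(1), of l] by auto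
  then show ?thesis using units_neq[OF 2(1), of l] w by (metis list.set_intros(2) zero_neq_one)
qed

lemma base_items_wf:
  assumes "i \<in> base_items"
  shows "wf_item ([11, 13, 17] @ pp) i"
  using assms
proof (cases rule: base_itemsE)
  case (1 x)
  show ?thesis unfolding 1(4) by (rule item0_wf[OF 1(2)]) simp
next
  case (2 k l x)
  show ?thesis unfolding 2(5) by (rule item0_wf[OF 2(4)]) simp
qed

lemma groups0_ok: "h < 15 \<Longrightarrow> x \<in> set (groups0 ! h) \<Longrightarrow> ok0 x"
  using groups0(1,3) nth_mem[of h groups0] unfolding list_all_iff by metis

lemma group_items_unique:
  assumes "h < 15" "h' < 15" "(s, a, b, w, M) \<in> group_items h" "(s, a, b, w, M') \<in> group_items h'"
  shows "h = h' \<and> M = M'"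
proof -
  obtain x x' where x: "x \<in> set (groups0 ! h)" "(s, a, b, w, M) = item0 (replicate (length pp) []) x"
    "x' \<in> set (groups0 ! h')" "(s, a, b, w, M') = item0 (replicate (length pp) []) x'"
    using assms(3,4) unfolding group_items_def by auto
  have "ok0 x" "ok0 x'" using groups0_ok x(1,3) assms(1,2) by blast+
  then have "key x = key x'" using item0_key x by metis
  then have "h = h' \<and> x = x'"
    using distinct_concat_map[OF groups0(2), of h h' x x'] groups0(3) assms(1,2) x by auto
  then show ?thesis using x by (metis prod.inject)
qed

lemma stage0_cover:
  assumes "\<not> y mod 11 < 7" "y mod 5 \<noteq> 1" "y mod 5 \<noteq> 2"
  shows "(\<exists>i\<in>base_items. covers i y) \<or> (\<forall>h<15. \<exists>i\<in>group_items h. covers i y)"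
proof -
  let ?ds = "digits ps0 rows0 y"
  have cov: "\<exists>x\<in>set L. covers (item0 cs x) y"
    if L: "acc (map path0 L) ?ds" "list_all ok0 L" "mt pp cs y" for L cs
  proof -
    obtain x where x: "x \<in> set L" "accp (path0 x) ?ds"
      using L(1) unfolding acc_def set_map by blast
    then have "ok0 x" using L(2) by (simp add: list_all_iff)
    then show ?thesis using item0_covers x L(3) by blast
  qed
  have nil: "mt pp (replicate (length pp) []) y" by (rule mt_nil)
  consider "acc (map path0 base0) ?ds"
    | "\<forall>G\<in>set groups0. acc (map path0 G) ?ds"
    | P where "P \<in> set patches0" "\<forall>G\<in>set P. acc (map path0 G) ?ds"
    using search_sound[OF search0 rows0[OF assms]] by auto
  then show ?thesis
  proof cases
    case 1
    then show ?thesis using cov[OF _ base0(1) nil] unfolding base_items_def by blast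
  next
    case 2
    have "\<exists>i\<in>group_items h. covers i y" if "h < 15" for h
    proof -
      have "groups0 ! h \<in> set groups0" using that groups0(3) by simp
      then have "acc (map path0 (groups0 ! h)) ?ds" "list_all ok0 (groups0 ! h)"
        using 2 groups0(1) by (auto simp: list_all_iff)
      then show ?thesis using cov[OF _ _ nil] unfolding group_items_def by blast
    qed
    then show ?thesis by blast
  next
    case 3
    then obtain k where k: "k < length pp" "P = patches0 ! k"
      using length_patches0(1) by (auto simp: in_set_conv_nth)
    \<comment> \<open>All lists of the patch accept the digits of \<open>y\<close>, so in particular
      the one for the class of \<open>y\<close> modulo the patch prime.\<close>
    define i where "i = nat (y mod int (pp ! k))"
    have "0 < pp ! k" using prime_pp k(1) by (simp add: list_all_length prime_gt_0_nat)
    then have i: "i < pp ! k" unfolding i_def by (simp add: nat_less_iff)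
    then have G: "patches0 ! k ! i \<in> set P" using k length_patches0 by simp
    have "list_all ok0 (patches0 ! k ! i)" using patches0(1) 3(1) G by (auto simp: list_all_iff)
    moreover have "mt pp ((replicate (length pp) [])[k := [i]]) y"
      using mt_unit[OF k(1)] i_def by simp
    ultimately obtain x where "x \<in> set (patches0 ! k ! i)" "covers (item0 ((replicate (length pp) [])[k := [i]]) x) y"
      using cov 3(2) G by blast
    then show ?thesis using k(1) i unfolding base_items_def by blast
  qed
qed

lemma kit_stage0:
  assumes "kit {3, 83} 2 B G"
  shows "\<exists>B' G'. kit ({3, 83} \<union> set (5 # 7 # 89 # 97 # [11, 13, 17] @ pp)) 15 B' G'"
proof (rule kit_flex[OF assms, where I = base_items and J = group_items])
  show "list_all prime (5 # 7 # 89 # 97 # [11, 13, 17] @ pp)" using prime_pp by simp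
  show "distinct (5 # 7 # 89 # 97 # [11, 13, 17] @ pp)"
    "{3, 83} \<inter> set (5 # 7 # 89 # 97 # [11, 13, 17] @ pp) = {}"
    by (simp_all add: pp_def)
  show "finite base_items" "\<And>h. finite (group_items h)"
    unfolding base_items_def group_items_def by simp_all
  show "wf_item ([11, 13, 17] @ pp) i" if "i \<in> base_items" for i
    using base_items_wf[OF that] .
  show "wf_item ([11, 13, 17] @ pp) i" if hi: "h < 15" "i \<in> group_items h" for h i
  proof -
    obtain x where x: "x \<in> set (groups0 ! h)" "i = item0 (replicate (length pp) []) x"
      using hi(2) unfolding group_items_def by blast
    show ?thesis unfolding x(2) by (rule item0_wf[OF groups0_ok[OF hi(1) x(1)]]) simp
  qed
  show "M = M'" if "(s, a, b, w, M) \<in> base_items" "(s, a, b, w, M') \<in> base_items" for s a b w M M'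
    using base_items_unique[OF that] .
  show "\<not> (b = 0 \<and> (\<forall>k\<in>set w. k = 0))" if "(s, a, b, w, M) \<in> base_items" for s a b w M
    using base_items_nontrivial[OF that] by blast
  show "pprod ([11, 13, 17] @ pp) w \<noteq> 11" if i: "(0, 0, 0, w, M) \<in> base_items" for M w
  proof
    assume "pprod ([11, 13, 17] @ pp) w = 11"
    also have "11 = pprod ([11, 13, 17] @ pp) (1 # replicate (2 + length pp) 0)"
      using pprod_zero[of "replicate (2 + length pp) 0" "[13, 17] @ pp"] by simp
    finally have "w = 1 # replicate (2 + length pp) 0"
    proof (rule pprod_inj[rotated 4])
      show "list_all prime ([11, 13, 17] @ pp)" using prime_pp by simp
      show "distinct ([11, 13, 17] @ pp)" by (simp add: pp_def)
      have "wf_item ([11, 13, 17] @ pp) (0, 0, 0, w, M)"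
        using base_items_wf[OF i] .
      then show "length w = length ([11, 13, 17] @ pp)" unfolding wf_item_def by simp
    qed simp
    then show False using base_items_nontrivial[OF i] by blast
  qed
  show "h = h' \<and> M = M'" if "h < 15" "h' < 15" "(s, a, b, w, M) \<in> group_items h"
    "(s, a, b, w, M') \<in> group_items h'" for h h' s a b w M M'
    using group_items_unique[OF that] .
  show "h = 0" if h: "h < 15" "(0, 0, 0, w, M) \<in> group_items h" "\<forall>k\<in>set w. k = 0" for h w M
  proof -
    \<comment> \<open>The entry without digits on slot 0 is in group 0, so uniqueness across the
      groups forces \<open>h = 0\<close>.\<close>
    have "(0, 0, 0, w, {y. mt (ps0 @ pp) ([[], [], [], [], []] @ replicate (length pp) []) y}) \<in> group_items 0"
    proof -
      obtain x where x: "x \<in> set (groups0 ! h)" "(0, 0, 0, w, M) = item0 (replicate (length pp) []) x"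
        using h(2) unfolding group_items_def by auto
      have "ok0 x" using groups0_ok x(1) h(1) by blast
      then obtain s a b c d e where "x = (s, [a, b, c, d, e])" by (rule ok0E)
      then have "w = map length ([[], [], []] @ replicate (length pp) ([] :: nat list))"
        using x(2) h(3) unfolding item0_def by auto
      then show ?thesis unfolding group_items_def groups0(4) item0_def by simp
    qed
    then show ?thesis using group_items_unique[OF h(1) _ h(2)] by simp
  qed
  show "y mod 11 < 7 \<or> y mod 5 = 1 \<or> y mod 5 = 2 \<or> (\<exists>i\<in>base_items. covers i y) \<or>
      (\<forall>h<15. \<exists>i\<in>group_items h. covers i y)" for y
    using stage0_cover by blast
qed simp_all

definition ps1 :: "nat list" where "ps1 = [19, 23, 29]"

definition item1 :: "nat \<times> nat list list \<Rightarrow> nat list \<times> int set \<times> nat" where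
  "item1 = (\<lambda>(t, bs). (map length bs, {y. mt ps1 bs y}, t))"

lemma ok1E:
  assumes "ok1 x"
  obtains t a b c where "x = (t, [a, b, c])" "t < 15" "length a \<le> 1" "length b \<le> 1" "length c \<le> 1"
  using assms by (cases x rule: ok1.cases) auto

lemma item1_key:
  assumes "ok1 x" "ok1 x'" "item1 x = (v, Y, t)" "item1 x' = (v, Y', t)"
  shows "key x = key x'"
proof -
  obtain bs bs' where x: "x = (t, bs)" "x' = (t, bs')" "map length bs = map length bs'"
    using assms(3,4) unfolding item1_def by (auto split: prod.splits)
  from code_cong[OF x(3)] show ?thesis unfolding x(1,2) key.simps .
qed

lemma item1_wf:
  assumes "ok1 x" "item1 x = (v, Y, t)"
  shows "t < 15" "length v = length ps1" "cls ps1 v Y"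
proof -
  obtain a b c where x: "x = (t, [a, b, c])" and t: "t < 15"
    using assms by (auto elim!: ok1E simp: item1_def)
  have "cls ps1 (map length [a, b, c]) {y. mt ps1 [a, b, c] y}"
    by (rule cls_mt) (simp_all add: ps1_def)
  then show "t < 15" "length v = length ps1" "cls ps1 v Y"
    using t assms(2) unfolding x item1_def by (auto simp: ps1_def simp del: mt.simps)
qed

lemma item1_covers:
  assumes "ok1 x" "accp (path rows1 x) (digits ps1 rows1 y)"
  shows "case item1 x of (v, Y, t) \<Rightarrow> y \<in> Y"
proof -
  obtain t a b c where x: "x = (t, [a, b, c])" "length a \<le> 1" "length b \<le> 1" "length c \<le> 1"
    using assms(1) by (rule ok1E)
  have "mt ps1 [a, b, c] y"
    by (rule path_sound[of rows1 t]) (use assms(2) x(2-4) in \<open>simp_all add: x(1) ps1_def rows1_def\<close>)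
  then show ?thesis unfolding x(1) item1_def by simp
qed

lemma rows1: "list_all2 (\<lambda>d u. d \<in> set u) (digits ps1 rows1 y) (concat rows1)"
  using below(5)[of "nat (y mod 19)"] below(6)[of "nat (y mod 23)"] below(7)[of "nat (y mod 29)"]
  unfolding rows1_def ps1_def by (simp add: nat_less_iff)

lemma kit_stage1:
  assumes "kit P 15 B G" "P \<inter> set ps1 = {}"
  shows "\<exists>B' G'. kit (P \<union> set ps1) 37 B' G'"
proof (rule kit_units[OF assms(1) _ _ assms(2), where U = "item1 ` set mbase" and W = "\<lambda>h. item1 ` set (mgroups ! h)"])
  show pr: "list_all prime ps1" and di: "distinct ps1" by (simp_all add: ps1_def)
  have okb: "ok1 x" if "x \<in> set mbase" for x using that mbase(1) by (simp add: list_all_iff)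
  have okg: "ok1 x" if "h < 37" "x \<in> set (mgroups ! h)" for h x
    using that mgroups(1,3) nth_mem[of h mgroups] unfolding list_all_iff by metis
  show "t < 15 \<and> length v = length ps1 \<and> cls ps1 v Y \<and> \<not> (\<forall>k\<in>set v. k = 0) \<and> (t = 0 \<longrightarrow> pprod ps1 v \<noteq> 11)"
    if i: "(v, Y, t) \<in> item1 ` set mbase" for v Y t
  proof -
    obtain x where x: "x \<in> set mbase" "item1 x = (v, Y, t)" using i by auto
    note wf = item1_wf[OF okb[OF x(1)] x(2)]
    have "unit1 x" using x(1) mbase(2) by (simp add: list_all_iff)
    then have "\<not> (\<forall>k\<in>set v. k = 0)"
      using x(2) by (cases x rule: unit1.cases) (auto simp: item1_def)
    moreover have "pprod ps1 v \<noteq> 11"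
    proof
      assume "pprod ps1 v = 11"
      moreover have "prime (11 :: nat)" by simp
      ultimately have "11 \<in> set ps1" using smooth_pprod[OF pr wf(2)] unfolding smooth_def by auto
      then show False by (simp add: ps1_def)
    qed
    ultimately show ?thesis using wf by blast
  qed
  show "Y = Y'" if i: "(v, Y, t) \<in> item1 ` set mbase" "(v, Y', t) \<in> item1 ` set mbase" for v Y Y' t
  proof -
    obtain x where x: "x \<in> set mbase" "item1 x = (v, Y, t)"
      using i(1) unfolding image_iff by metis
    obtain x' where x': "x' \<in> set mbase" "item1 x' = (v, Y', t)"
      using i(2) unfolding image_iff by metis
    have "key x = key x'"
      by (rule item1_key[OF okb[OF x(1)] okb[OF x'(1)] x(2) x'(2)])
    then have "x = x'" using mbase(3) x x' by (auto simp: distinct_map dest: inj_onD)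
    then show ?thesis using x x' by simp
  qed
  have uniq: "h = h' \<and> Y = Y'"
    if i: "h < 37" "h' < 37" "(v, Y, t) \<in> item1 ` set (mgroups ! h)" "(v, Y', t) \<in> item1 ` set (mgroups ! h')"
    for h h' v Y Y' t
  proof -
    obtain x where x: "x \<in> set (mgroups ! h)" "item1 x = (v, Y, t)"
      using i(3) unfolding image_iff by metis
    obtain x' where x': "x' \<in> set (mgroups ! h')" "item1 x' = (v, Y', t)"
      using i(4) unfolding image_iff by metis
    have "key x = key x'"
      by (rule item1_key[OF okg[OF i(1) x(1)] okg[OF i(2) x'(1)] x(2) x'(2)])
    then have "h = h' \<and> x = x'"
      using distinct_concat_map[OF mgroups(2), of h h' x x'] mgroups(3) i(1,2) x x' by simp
    then show ?thesis using x x' by simp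
  qed
  then show "h = h' \<and> Y = Y'"
    if "h < 37" "h' < 37" "(v, Y, t) \<in> item1 ` set (mgroups ! h)" "(v, Y', t) \<in> item1 ` set (mgroups ! h')"
    for h h' v Y Y' t using that by blast
  show "t < 15 \<and> length v = length ps1 \<and> cls ps1 v Y \<and> ((\<forall>k\<in>set v. k = 0) \<and> t = 0 \<longrightarrow> h = 0)"
    if i: "h < 37" "(v, Y, t) \<in> item1 ` set (mgroups ! h)" for h v Y t
  proof -
    obtain x where x: "x \<in> set (mgroups ! h)" "item1 x = (v, Y, t)" using i by auto
    note wf = item1_wf[OF okg[OF i(1) x(1)] x(2)]
    have "h = 0" if z: "\<forall>k\<in>set v. k = 0" "t = 0"
    proof -
      obtain a b c where "x = (t, [a, b, c])"
        using okg[OF i(1) x(1)] x(2) by (auto elim!: ok1E simp: item1_def)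
      then have "v = [0, 0, 0]" using x(2) z by (auto simp: item1_def)
      then have "(v, {y. mt ps1 [[], [], []] y}, t) \<in> item1 ` set (mgroups ! 0)"
        unfolding mgroups(4) item1_def using z(2) by simp
      then show ?thesis using uniq[OF i(1) _ i(2)] by simp
    qed
    then show ?thesis using wf by blast
  qed
  fix y
  let ?ds = "digits ps1 rows1 y"
  have cov: "\<exists>(v, Y, t)\<in>item1 ` set L. y \<in> Y"
    if L: "acc (map (path rows1) L) ?ds" "\<And>x. x \<in> set L \<Longrightarrow> ok1 x" for L
  proof -
    obtain x where x: "x \<in> set L" "accp (path rows1 x) ?ds"
      using L(1) unfolding acc_def set_map by blast
    show ?thesis
      using item1_covers[OF L(2)[OF x(1)] x(2)] by (rule bexI) (rule imageI[OF x(1)])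
  qed
  have "acc (map (path rows1) mbase) ?ds \<or> (\<forall>G\<in>set mgroups. acc (map (path rows1) G) ?ds)"
    using search_sound[OF search1 rows1] by auto
  then show "y mod 11 < 7 \<or> (\<exists>(v, Y, t)\<in>item1 ` set mbase. y \<in> Y) \<or>
      (\<forall>h<37. \<exists>(v, Y, t)\<in>item1 ` set (mgroups ! h). y \<in> Y)"
  proof
    assume "acc (map (path rows1) mbase) ?ds"
    then show ?thesis using cov[OF _ okb] by blast
  next
    assume G: "\<forall>G\<in>set mgroups. acc (map (path rows1) G) ?ds"
    have "\<exists>(v, Y, t)\<in>item1 ` set (mgroups ! h). y \<in> Y" if "h < 37" for h
    proof -
      have "mgroups ! h \<in> set mgroups" using that mgroups(3) by simp
      then show ?thesis by (rule cov[OF bspec[OF G] okg[OF that]])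
    qed
    then show ?thesis by blast
  qed
qed simp_all

theorem theorem4p2:
  "\<exists>C :: (int \<times> int) set.
     covering_system C \<and>
     (\<forall>(r, m) \<in> C. odd m \<and> m > 1) \<and>
     card {(r, m) \<in> C. m = 11} = 7 \<and>
     (\<forall>(r, m) \<in> C. \<forall>(r', m') \<in> C. (r, m) \<noteq> (r', m') \<and> m = m' \<longrightarrow> m = 11)"
proof -
  obtain B G where 1: "kit {3, 83} 2 B G" using kit_two by blast
  define P where "P = {3, 83} \<union> set (5 # 7 # 89 # 97 # [11, 13, 17] @ pp)"
  obtain B' G' where 2: "kit P 15 B' G'" using kit_stage0[OF 1] unfolding P_def by blast
  have "P \<inter> set ps1 = {}" by (simp add: P_def ps1_def pp_def)
  from kit_stage1[OF 2 this] obtain B'' G'' where "kit (P \<union> set ps1) 37 B'' G''" by blast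
  then show ?thesis
    by (rule kit_covering[where p = 37]) (simp_all add: P_def ps1_def pp_def)
qed

end
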